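(* Let $\alpha=[a_0;a_1,a_2,\dots]$ be irrational with convergent denominators $q_k$, and assume $\frac{\log a_k}{a_{k+1}} \le T$ for all $k \ge k_0$ with some constants $k_0,T\ge 1$. Let $N^*=\sum_{k=0}^{K-1} \lfloor (5/6)a_{k+1}\rfloor q_k$. Then for any real $c \ge 0.01$, \[ \begin{split} \log \left( \sum_{N=0}^{q_K-1} P_N(\alpha )^c \right)^{1/c} = &\log P_{N^*}(\alpha) + \frac{1}{2c} \sum_{k=1}^K \log \frac{2a_k}{\sqrt{3}c} \\&+ O_T \left( \sum_{k=1}^K \left( \frac{\log^{1/2} (a_k/c+2)}{c^{1/2} a_k^{1/2}} +\frac{\log^{3/2} (a_k/c+2)}{c^{3/2} a_k^{1/2}} +\frac{1}{a_k} \right) \right) + O_{\alpha} (1) , \end{split} \] and \[ \log \max_{0 \le N < q_K} P_N(\alpha ) = \log P_{N^*} (\alpha ) + O_T \left( \sum_{k=1}^K \frac{1}{a_k} \right) + O_{\alpha}(1) . \]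
   Context: For real $\alpha$ and integer $N\ge 0$, $P_N(\alpha)=\prod_{n=1}^N |2\sin(\pi n\alpha)|$. The $q_k$ are the denominators of the convergents $p_k/q_k=[a_0;a_1,\dots,a_k]$, with $q_0=1$, $q_1=a_1$, $q_{k+1}=a_{k+1}q_k+q_{k-1}$. $O_T$ denotes an implied constant depending only on $T$ (not on $c$, $K$); $O_\alpha$ an implied constant that may depend on $\alpha$ (including $k_0,T$) but not on $c$ or $K$. *)

theory Defs
  imports Complex_Main
begin

fun cf_rem :: "real \<Rightarrow> nat \<Rightarrow> real" where
  "cf_rem x 0 = x"
| "cf_rem x (Suc n) = 1 / (cf_rem x n - of_int \<lfloor>cf_rem x n\<rfloor>)"

definition cf_digit :: "real \<Rightarrow> nat \<Rightarrow> int" where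
  "cf_digit x k = \<lfloor>cf_rem x k\<rfloor>"

fun cf_den :: "real \<Rightarrow> nat \<Rightarrow> int" where
  "cf_den x 0 = 1"
| "cf_den x (Suc 0) = cf_digit x 1"
| "cf_den x (Suc (Suc k)) = cf_digit x (k + 2) * cf_den x (Suc k) + cf_den x k"

definition sinprod :: "nat \<Rightarrow> real \<Rightarrow> real" where
  "sinprod N x = (\<Prod>n=1..N. \<bar>2 * sin (pi * real n * x)\<bar>)"

definition Nstar :: "real \<Rightarrow> nat \<Rightarrow> nat" where
  "Nstar x K = nat (\<Sum>k<K. \<lfloor>(5/6::real) * of_int (cf_digit x (k+1))\<rfloor> * cf_den x k)"

end

theory Submission
  imports Defs "HOL-Probability.Probability" "HOL-Real_Asymp.Real_Asymp"
begin

text \<open>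
  Write the partial quotients as $a_k$, let $\<delta>_k = |q_k \<alpha> - p_k|$, and compare $N = \<Sum> b_k q_k$ with $N^*$ by
  replacing the digits of $N$ one at a time, the highest one first.  Raising the digit $b$ of level $j$ by one
  multiplies $P_N$ by $q_j$ consecutive factors.  Up to the perturbation $n\<delta>_j/q_j$ these sit at the
  points $i/q_j + b\<delta>_j$, so their product is $2\sin(\pi q_j \<delta>_j (b + 1/2))$, about
  $2\sin(\pi (b+1/2)/a_{j+1})$, times the exponential of a cotangent sum of size $O(1/a_{j+1})$.  Since
  $2\sin(\pi x) = 1$ at $x = 5/6$ with logarithmic derivative $-\pi\sqrt 3$ there, a digit at
  distance $d$ from $b^*$ costs $\frac{\pi\sqrt 3}{2} d^2/a_{j+1}$ up to errors $O(d/a_{j+1} + d^3/a_{j+1}^2 + 1/a_{j+1})$,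
  and every level contributes a discrete Gaussian sum.

  The cotangent sum is $\<Sum> (n/q_j) \cot(\pi n p_j/q_j)$ over a window of length $q_j$.  Pairing the residues $i$ and $-i$
  leaves sums of fractional parts along the rotation by $q_{j-1}/q_j$, which are controlled by Denjoy-Koksma at the
  denominators of that rational, that is, at the continuants of $a_j, a_{j-1}, \dots$; this is where $\log a_k / a_{k+1} \le T$
  enters.  The first $a_j$ terms cancel if the digit of level $j-1$ is away from $0$ and $a_j$.  Otherwise they cost $\log a_j$,
  which is charged to the quadratic loss of level $j-1$.
\<close>

section \<open>Products of sines\<close>

text \<open>Replacing from the top makes the shift at level j independent of N: all higher digits
  are already those of N*, so the shift is the single number \<open>star_shift j K\<close>, between
  -5/6 \<delta>_j and 5/6 \<delta>_(j+1). The factor 5/6 < 1 keeps the sine arguments off the zeros;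
  arbitrary higher digits would allow factors much closer to zero. The lower digits enter only as
  the start M of the window, and essentially only through whether M lies in the middle part of [0,
  q_j). This dependence is isolated in a cost that telescopes from level to level. What is left
  depends on one digit at a time, so the sum over N factorises over the levels. Each Gaussian sum is
  close to sqrt (2a/(sqrt 3 c)), the source of the main term. A level may contribute only O(1/a) to
  the maximum, so a loss of ln a is never an error term: it is bounded by a small multiple of a plus
  O(1/a), and the former is paid by the quadratic loss. The hypothesis on the partial quotients
  controls the cotangent sums only from some index on; the earlier levels have a finite total
  excess, which is the O(1) depending on \<alpha>.\<close>

lemma norm_cis_minus_1: "cmod (cis x - 1) = \<bar>2 * sin (x / 2)\<bar>"
proof -
  have "(cmod (cis x - 1))\<^sup>2 = (cos x - 1)\<^sup>2 + (sin x)\<^sup>2"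
    by (simp add: cmod_power2)
  also have "\<dots> = 2 - 2 * cos x"
    using sin_cos_squared_add[of x] by (simp add: power2_eq_square algebra_simps)
  also have "\<dots> = (2 * sin (x/2))\<^sup>2"
    using cos_double_sin[of "x/2"] by (simp add: power2_eq_square)
  finally show ?thesis
    by (metis abs_norm_cancel power2_eq_iff_nonneg abs_ge_zero power2_abs norm_ge_zero)
qed

text \<open>Both sides are monic of degree q in w and agree at the q distinct roots of unity; a
  nonzero difference would have degree below q and at least q roots.\<close>

lemma prod_roots_of_unity:
  fixes w :: complex
  assumes "q > 0"
  shows "(\<Prod>i<q. w - cis (2 * pi * real i / real q)) = w ^ q - 1"
proof -
  define g where "g i = cis (2 * pi * real i / real q)" for i
  define P where "P = (\<Prod>i<q. [:- g i, 1:])"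
  define R where "R = monom 1 q - (1 :: complex poly)"
  have inj: "inj_on g {..<q}"
    unfolding g_def using Complex.bij_betw_roots_unity[OF assms] by (auto simp: bij_betw_def)
  have gq: "g i ^ q = 1" for i
    unfolding g_def using assms cis_multiple_2pi[of "real i"] by (simp add: Complex.DeMoivre)
  have degP: "degree P = q"
    unfolding P_def by (subst degree_prod_eq_sum_degree) auto
  have degR: "degree R = q" 
    unfolding R_def using assms
    by (metis (no_types, lifting) degree_1 degree_diff_less degree_linear_power degree_monom_eq diff_0_right degree_add_eq_left degree_minus one_neq_zero diff_conv_add_uminus)
  have lcP: "coeff P q = 1"
    using degP lead_coeff_prod[of "\<lambda>i. [:- g i, 1:]" "{..<q}"] unfolding P_def by simp
  have lcR: "coeff R q = 1" unfolding R_def using assms by simp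
  have "P = R"
  proof (rule ccontr)
    assume "P \<noteq> R"
    hence nz: "P - R \<noteq> 0" by simp
    have dl: "degree (P - R) < q"
      using assms degP degR lcP lcR nz
      by (metis coeff_diff degree_diff_le diff_self le_neq_implies_less leading_coeff_0_iff order_refl)
    have "g ` {..<q} \<subseteq> {x. poly (P - R) x = 0}"
      using gq by (auto simp: P_def R_def poly_prod poly_monom)
    hence "card (g ` {..<q}) \<le> card {x. poly (P - R) x = 0}"
      using poly_roots_finite[OF nz] card_mono by blast
    also have "\<dots> \<le> degree (P - R)" using card_poly_roots_bound[OF nz] .
    finally show False using dl card_image[OF inj] by simp
  qed
  hence "poly P w = poly R w" by simp
  thus ?thesis by (simp add: P_def R_def poly_prod poly_monom g_def)
qed

text \<open>With w = cis (-2 pi z) each factor is the distance from w to a q-th root of unity, so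
  the product is |w^q - 1|. It serves both for a block of q_j factors and for the full sum of
  \<open>\<phi>\<close> over one level.\<close>

lemma prod_abs_sin:
  assumes "q > 0"
  shows "(\<Prod>i<q. \<bar>2 * sin (pi * (real i / real q + z))\<bar>) = \<bar>2 * sin (pi * real q * z)\<bar>"
proof -
  define w where "w = cis (- (2 * pi * z))"
  have "(\<Prod>i<q. \<bar>2 * sin (pi * (real i / real q + z))\<bar>) = (\<Prod>i<q. cmod (w - cis (2 * pi * real i / real q)))"
  proof (rule prod.cong)
    fix i
    have "w - cis (2 * pi * real i / real q) = - w * (cis (2 * (pi * (real i / real q + z))) - 1)"
      unfolding w_def by (simp add: algebra_simps cis_mult)
    hence "cmod (w - cis (2 * pi * real i / real q)) = cmod (cis (2 * (pi * (real i / real q + z))) - 1)"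
      by (simp add: norm_mult w_def)
    thus "\<bar>2 * sin (pi * (real i / real q + z))\<bar> = cmod (w - cis (2 * pi * real i / real q))"
      by (simp add: norm_cis_minus_1)
  qed simp
  also have "\<dots> = cmod (w ^ q - 1)"
    by (subst prod_norm) (simp add: prod_roots_of_unity[OF assms])
  also have "w ^ q = cis (- (2 * (pi * real q * z)))"
    unfolding w_def by (simp add: Complex.DeMoivre algebra_simps)
  also have "cmod (cis (- (2 * (pi * real q * z))) - 1) = \<bar>2 * sin (pi * real q * z)\<bar>"
    unfolding norm_cis_minus_1 by (simp add: sin_minus)
  finally show ?thesis .
qed

lemma cot_diff:
  fixes s t :: real
  assumes "sin s \<noteq> 0" "sin t \<noteq> 0"
  shows "cot t - cot s = sin (s - t) / (sin s * sin t)"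
  using assms by (simp add: cot_def sin_diff field_simps)

text \<open>Concavity: the derivative \<open>cot\<close> of ln sin decreases, since by
  \<open>cot_diff\<close> the sign of cot x - cot y is that of sin (y - x).\<close>

lemma ln_sin_tangent:
  fixes s t :: real
  assumes "0 < s" "s < pi" "0 < t" "t < pi"
  shows "ln (sin s) \<le> ln (sin t) + (s - t) * cot t"
proof -
  have ps: "sin s > 0" "sin t > 0" using assms sin_gt_zero by auto
  define f where "f x = ln (sin x) - (x - t) * cot t" for x
  have der: "(f has_real_derivative (cot x - cot t)) (at x)" if "0 < x" "x < pi" for x
    unfolding f_def using sin_gt_zero[OF that] ps
    by (auto intro!: derivative_eq_intros simp: cot_def)
  have mono: "cot x - cot y \<ge> 0" if "0 < x" "x \<le> y" "y < pi" for x y :: real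
  proof -
    have "sin x > 0" "sin y > 0" "sin (y - x) \<ge> 0" using that sin_gt_zero[of x] sin_gt_zero[of y] sin_ge_zero[of "y-x"] by auto
    thus ?thesis using cot_diff[of y x] by simp
  qed
  have "f s \<le> f t"
  proof (cases "s \<le> t")
    case True
    have "\<exists>y. (f has_real_derivative y) (at x) \<and> 0 \<le> y" if "s \<le> x" "x \<le> t" for x
      using der[of x] mono[of x t] that assms by (intro exI[of _ "cot x - cot t"]) auto
    thus ?thesis using DERIV_nonneg_imp_nondecreasing[OF True] by blast
  next
    case False
    have "\<exists>y. (f has_real_derivative y) (at x) \<and> y \<le> 0" if "t \<le> x" "x \<le> s" for x
      using der[of x] mono[of t x] that assms by (intro exI[of _ "cot x - cot t"]) auto
    thus ?thesis using DERIV_nonpos_imp_nonincreasing[of t s f] False by auto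
  qed
  thus ?thesis by (simp add: f_def)
qed

section \<open>Denjoy-Koksma and summation by parts\<close>

text \<open>In units of 1/Q, the point x + i \<beta> lies between \<open>m i\<close> - 1 and
  \<open>m i\<close> + 2, and coprimality makes \<open>m i\<close> run through all residues modulo
  Q. So the sum is compared with that of k/Q over k < Q, which is (Q - 1)/2.\<close>

lemma denjoy_koksma_frac:
  fixes x \<beta> :: real and P :: int and Q :: nat
  assumes "Q > 0" "coprime P (int Q)" "\<bar>\<beta> - of_int P / real Q\<bar> \<le> 1 / (real Q)\<^sup>2"
  shows "\<bar>(\<Sum>i=1..Q. frac (x + real i * \<beta>)) - real Q / 2\<bar> \<le> 5"
proof -
  define m where "m i = \<lfloor>real Q * x\<rfloor> + int i * P" for i :: nat
  define k where "k i = nat (m i mod int Q)" for i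
  \<comment> \<open>Near both ends of the unit interval the fractional part may wrap around;
    \<open>e\<close> charges 1 to each of these residues. The total error is 2 + 2, plus 1/2 from (Q
    - 1)/2 against Q/2.\<close>
  define e where "e i = (if i = 0 \<or> i = Q - 1 then 1 else 0 :: real)" for i :: nat
  have klt: "k i < Q" for i unfolding k_def using assms(1) by (simp add: nat_less_iff)
  have inj: "inj_on k {1..Q}"
  proof (rule inj_onI)
    fix i i' assume ii: "i \<in> {1..Q}" "i' \<in> {1..Q}" "k i = k i'"
    hence "m i mod int Q = m i' mod int Q"
      unfolding k_def using assms(1) by (metis eq_nat_nat_iff of_nat_0_less_iff pos_mod_sign)
    hence "int Q dvd m i - m i'" by (simp add: mod_eq_dvd_iff)
    hence "int Q dvd (int i - int i') * P" by (simp add: m_def algebra_simps)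
    hence "int Q dvd int i - int i'" using assms(2)
      by (metis coprime_commute coprime_dvd_mult_left_iff)
    moreover have "\<bar>int i - int i'\<bar> < int Q" using ii by auto
    ultimately show "i = i'" by (metis abs_of_nat dvd_imp_le_int eq_iff_diff_eq_0 linorder_not_less of_nat_eq_iff)
  qed
  have img: "k ` {1..Q} = {..<Q}"
  proof (rule card_subset_eq)
    show "k ` {1..Q} \<subseteq> {..<Q}" using klt by auto
    show "card (k ` {1..Q}) = card {..<Q}" using card_image[OF inj] by simp
  qed simp
  have step: "\<bar>frac (x + real i * \<beta>) - real (k i) / real Q\<bar> \<le> 2 / real Q + e (k i)" if i: "i \<in> {1..Q}" for i
  proof -
    define t where "t = m i div int Q"
    define y where "y = x + real i * \<beta> - of_int t"
    have mt: "m i = t * int Q + int (k i)" unfolding t_def k_def using assms(1) by simp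
    have "real i * real Q * \<bar>\<beta> - of_int P / real Q\<bar> \<le> real Q * real Q * (1 / (real Q)\<^sup>2)"
      using i assms by (intro mult_mono) auto
    hence "\<bar>real i * real Q * (\<beta> - of_int P / real Q)\<bar> \<le> 1"
      using assms(1) by (simp add: abs_mult power2_eq_square)
    moreover have "real i * real Q * (\<beta> - of_int P / real Q) = real Q * (real i * \<beta>) - real i * of_int P"
      using assms(1) by (simp add: field_simps)
    ultimately have b1: "\<bar>real Q * (real i * \<beta>) - real i * of_int P\<bar> \<le> 1" by simp
    have b2: "of_int \<lfloor>real Q * x\<rfloor> \<le> real Q * x" "real Q * x < of_int \<lfloor>real Q * x\<rfloor> + 1"
      by linarith+
    have "real_of_int (m i) = of_int \<lfloor>real Q * x\<rfloor> + real i * of_int P" by (simp add: m_def)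
    hence b3: "real Q * y \<ge> real (k i) - 1" "real Q * y < real (k i) + 2"
    proof -
      have "real Q * y = real Q * x + real Q * (real i * \<beta>) - of_int t * real Q"
        by (simp add: y_def algebra_simps)
      moreover have "of_int t * real Q + real (k i) = of_int \<lfloor>real Q * x\<rfloor> + real i * of_int P"
        using \<open>real_of_int (m i) = _\<close> unfolding mt by simp
      ultimately show "real Q * y \<ge> real (k i) - 1" "real Q * y < real (k i) + 2"
        using b1 b2 by linarith+
    qed
    have fy: "frac (x + real i * \<beta>) = frac y" unfolding y_def by (simp add: frac_def)
    show ?thesis
    proof (cases "k i = 0 \<or> k i = Q - 1")
      case True
      have "0 \<le> frac y" "frac y < 1" by (simp_all add: frac_lt_1)
      moreover have "0 \<le> real (k i) / real Q" "real (k i) / real Q \<le> 1" using klt[of i] by auto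
      moreover have "2 / real Q \<ge> 0" by simp
      moreover have "e (k i) = 1" using True by (simp add: e_def)
      ultimately show ?thesis unfolding fy abs_le_iff by linarith
    next
      case False
      hence "k i \<ge> 1" "k i + 2 \<le> Q" using klt[of i] by auto
      hence "real (k i) \<ge> 1" "real (k i) + 2 \<le> real Q" by linarith+
      hence y01: "real Q * y \<ge> 0" "real Q * y < real Q * 1" using b3 by linarith+
      have "0 \<le> y" using y01(1) assms(1) by (simp add: zero_le_mult_iff)
      moreover have "y < 1"
        using y01(2) assms(1) by (simp only: mult_less_cancel_left_pos of_nat_0_less_iff)
      ultimately have "0 \<le> y" "y < 1" by auto
      hence "frac y = y" by (simp add: frac_eq)
      moreover have "\<bar>y - real (k i) / real Q\<bar> \<le> 2 / real Q"
        using b3 assms(1) by (simp add: abs_le_iff field_simps)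
      moreover have "e (k i) \<ge> 0" by (simp add: e_def)
      ultimately show ?thesis unfolding fy by linarith
    qed
  qed
  have "(\<Sum>i\<in>{1..Q}. e (k i)) = (\<Sum>j<Q. e j)"
    using sum.reindex[OF inj, of e] img by simp
  also have "\<dots> \<le> 2"
  proof -
    have "(\<Sum>j<Q. e j) = (\<Sum>j\<in>{..<Q} \<inter> {0, Q-1}. 1)"
      by (rule sum.mono_neutral_cong_right) (auto simp: e_def)
    also have "\<dots> = real (card ({..<Q} \<inter> {0, Q-1}))" by simp
    also have "card ({..<Q} \<inter> {0, Q-1}) \<le> card {0, Q-1}" by (intro card_mono) auto
    also have "\<dots> \<le> 2" using card_insert_le_m1[of 2 "{Q-1}" 0] by simp
    finally show ?thesis by simp
  qed
  finally have e2: "(\<Sum>i\<in>{1..Q}. e (k i)) \<le> 2" .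
  have "(\<Sum>i\<in>{1..Q}. real (k i) / real Q) = (\<Sum>j<Q. real j / real Q)"
    using sum.reindex[OF inj, of "\<lambda>j. real j / real Q"] img by simp
  also have "\<dots> = (\<Sum>j<Q. real j) / real Q" by (simp add: sum_divide_distrib)
  also have "(\<Sum>j<Q. real j) = real Q * (real Q - 1) / 2" 
    by (induction Q) (auto simp: field_simps)
  finally have k2: "(\<Sum>i\<in>{1..Q}. real (k i) / real Q) = (real Q - 1) / 2" using assms(1) by simp
  have "\<bar>(\<Sum>i=1..Q. frac (x + real i * \<beta>)) - (\<Sum>i\<in>{1..Q}. real (k i) / real Q)\<bar>
      \<le> (\<Sum>i=1..Q. \<bar>frac (x + real i * \<beta>) - real (k i) / real Q\<bar>)"
    by (subst sum_subtractf[symmetric]) (rule sum_abs)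
  also have "\<dots> \<le> (\<Sum>i=1..Q. 2 / real Q + e (k i))" by (rule sum_mono) (use step in auto)
  also have "\<dots> \<le> 4" using e2 assms(1) by (simp add: sum.distrib)
  finally show ?thesis unfolding k2 by (simp add: abs_le_iff field_simps)
qed

text \<open>Summation by parts for coefficients of size 1/i: of a partial sum bound X n + Y, the
  linear part yields X/(n + 1) at each step, hence a logarithm, and the constant part yields the
  telescoping 1/n - 1/(n + 1).\<close>

lemma abel_block:
  fixes c \<psi> :: "nat \<Rightarrow> real"
  assumes s: "s \<ge> 1" and se: "s \<le> e"
    and K: "K \<ge> 0" and X: "X \<ge> 0" and Y: "Y \<ge> 0"
    and c0: "\<And>i. s \<le> i \<Longrightarrow> i \<le> e \<Longrightarrow> 0 \<le> c i \<and> c i \<le> K / real i"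
    and c1: "\<And>i. s \<le> i \<Longrightarrow> i < e \<Longrightarrow> \<bar>c i - c (i+1)\<bar> \<le> K / (real i * real (i+1))"
    and ps: "\<And>I. \<bar>\<Sum>i=s+1..s+I. \<psi> i\<bar> \<le> X * real I + Y"
  shows "\<bar>\<Sum>i=s+1..e. c i * \<psi> i\<bar> \<le> K * (X * (ln (real e / real s) + 1) + 2 * Y / real s)"
proof -
  define S where "S n = (\<Sum>i=s+1..n. \<psi> i)" for n
  have Sb: "\<bar>S n\<bar> \<le> X * real n + Y" if "s \<le> n" for n
  proof -
    have "\<bar>S n\<bar> \<le> X * real (n - s) + Y" using ps[of "n - s"] that unfolding S_def by simp
    also have "\<dots> \<le> X * real n + Y" using X by (simp add: mult_left_mono)
    finally show ?thesis .
  qed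
  have main: "n \<le> e \<longrightarrow> \<bar>(\<Sum>i=s+1..n. c i * \<psi> i) - c n * S n\<bar> \<le> K * (X * ln (real n / real s) + Y * (1 / real s - 1 / real n))"
    if "s \<le> n" for n using that
  proof (induction n rule: dec_induct)
    case base
    show ?case using s by (simp add: S_def)
  next
    case (step n)
    show ?case
    proof
      assume ne: "Suc n \<le> e"
      have n1: "real n \<ge> 1" using step s by linarith
      define A where "A = (\<Sum>i=s+1..n. c i * \<psi> i) - c n * S n"
      have eq: "(\<Sum>i=s+1..Suc n. c i * \<psi> i) - c (Suc n) * S (Suc n) = A + (c n - c (n+1)) * S n"
        using step by (simp add: A_def S_def algebra_simps)
      have "\<bar>(c n - c (n+1)) * S n\<bar> \<le> (K / (real n * real (n+1))) * (X * real n + Y)"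
        unfolding abs_mult using c1[of n] Sb[of n] ne step K X Y by (intro mult_mono) auto
      also have "\<dots> = K * (X * (1 / real (n+1)) + Y * (1 / real n - 1 / real (n+1)))"
      proof -
        have "1 / (real n * real (n+1)) = 1 / real n - 1 / real (n+1)"
          using n1 by (simp add: field_simps)
        moreover have "K / d * (X * real n + Y) = K * (X * (real n / d) + Y * (1 / d))" for d :: real
          by (simp add: add_divide_distrib ring_distribs)
        moreover have "real n / (real n * real (n+1)) = 1 / real (n+1)" using n1 by simp
        ultimately show ?thesis by metis
      qed
      also have "\<dots> \<le> K * (X * ln (real (n+1) / real n) + Y * (1 / real n - 1 / real (n+1)))"
      proof -
        have "ln (real n / real (n+1)) \<le> real n / real (n+1) - 1" using n1 by (intro ln_le_minus_one) auto
        hence "1 / real (n+1) \<le> ln (real (n+1) / real n)" using n1 by (simp add: ln_div field_simps)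
        thus ?thesis using K X by (intro mult_left_mono add_right_mono) auto
      qed
      finally have b: "\<bar>(c n - c (n+1)) * S n\<bar> \<le> \<dots>" .
      have "\<bar>A\<bar> \<le> K * (X * ln (real n / real s) + Y * (1 / real s - 1 / real n))"
        using step ne by (simp add: A_def)
      hence "\<bar>A + (c n - c (n+1)) * S n\<bar> \<le> K * (X * ln (real n / real s) + Y * (1 / real s - 1 / real n))
         + K * (X * ln (real (n+1) / real n) + Y * (1 / real n - 1 / real (n+1)))"
        using b by linarith
      also have "\<dots> = K * (X * ln (real (Suc n) / real s) + Y * (1 / real s - 1 / real (Suc n)))"
        using n1 s by (simp add: ln_div algebra_simps)
      finally show "\<bar>(\<Sum>i=s+1..Suc n. c i * \<psi> i) - c (Suc n) * S (Suc n)\<bar> \<le> \<dots>" unfolding eq .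
    qed
  qed
  have e1: "real e \<ge> 1" using s se by linarith
  have "\<bar>c e * S e\<bar> \<le> K / real e * (X * real e + Y)"
    unfolding abs_mult using c0[of e] Sb[OF se] se K by (intro mult_mono) auto
  also have "\<dots> = K * (X + Y / real e)" using e1 by (simp add: field_simps)
  finally have 1: "\<bar>c e * S e\<bar> \<le> K * (X + Y / real e)" .
  have "\<bar>\<Sum>i=s+1..e. c i * \<psi> i\<bar> \<le> K * (X * ln (real e / real s) + Y * (1 / real s - 1 / real e)) + K * (X + Y / real e)"
    using main[OF se] 1 by auto
  also have "\<dots> = K * (X * (ln (real e / real s) + 1) + Y / real s)"
    by (simp add: algebra_simps)
  also have "\<dots> \<le> K * (X * (ln (real e / real s) + 1) + 2 * Y / real s)"
    using K X Y s by (intro mult_left_mono add_left_mono divide_right_mono) auto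
  finally show ?thesis .
qed

text \<open>Continued fraction denominators are sure to double only every two steps, so the decay is
  assumed along steps of length two and two initial terms appear.\<close>

lemma sum_two_step_contraction:
  fixes u w :: "nat \<Rightarrow> real"
  assumes "\<And>l. l \<le> n \<Longrightarrow> u l \<ge> 0" "\<And>l. l \<le> n \<Longrightarrow> w l \<ge> 0"
    and "\<And>l. l + 2 \<le> n \<Longrightarrow> u (l+2) \<le> u l / 2 + w l"
    and n1: "n \<ge> 1"
  shows "(\<Sum>l\<le>n. u l) \<le> 2 * u 0 + 2 * u 1 + 2 * (\<Sum>l\<le>n. w l)"
proof -
  obtain m where m: "n = Suc m" using n1 by (cases n) auto
  have "(\<Sum>l\<le>n. u l) = u 0 + u 1 + (\<Sum>l<m. u (l+2))"
    unfolding m by (induction m) auto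
  moreover have "(\<Sum>l<m. u (l+2)) \<le> (\<Sum>l<m. u l / 2 + w l)"
    by (rule sum_mono) (use assms(3) m in auto)
  moreover have "(\<Sum>l<m. u l / 2 + w l) = (\<Sum>l<m. u l) / 2 + (\<Sum>l<m. w l)"
    by (simp add: sum.distrib sum_divide_distrib)
  moreover have "(\<Sum>l<m. u l) \<le> (\<Sum>l\<le>n. u l)" using assms m by (intro sum_mono2) auto
  moreover have "(\<Sum>l<m. w l) \<le> (\<Sum>l\<le>n. w l)" using assms m by (intro sum_mono2) auto
  ultimately show ?thesis by linarith
qed

lemma sum_inverse_denominators:
  fixes Q :: "nat \<Rightarrow> nat"
  assumes "Q 0 = 1" "\<And>l. l \<le> J \<Longrightarrow> Q l \<ge> 1" "\<And>l. l + 2 \<le> J \<Longrightarrow> 2 * Q l \<le> Q (l+2)" "n \<le> J"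
  shows "(\<Sum>l\<le>n. 1 / real (Q l)) \<le> 4"
proof (cases "n \<ge> 1")
  case True
  have "(\<Sum>l\<le>n. 1 / real (Q l)) \<le> 2 * (1 / real (Q 0)) + 2 * (1 / real (Q 1)) + 2 * (\<Sum>l\<le>n. 0::real)"
  proof (rule sum_two_step_contraction[OF _ _ _ True])
    fix l assume l: "l + 2 \<le> n"
    hence "2 * Q l \<le> Q (l+2)" "Q l \<ge> 1" using assms by auto
    hence "2 * real (Q l) \<le> real (Q (l+2))" "real (Q l) \<ge> 1" by linarith+
    thus "1 / real (Q (l+2)) \<le> 1 / real (Q l) / 2 + 0" by (simp add: field_simps)
  qed auto
  moreover have "1 / real (Q 1) \<le> 1" using assms(2)[of 1] True assms(4) by simp
  ultimately show ?thesis using assms(1) by simp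
next
  case False
  hence "n = 0" by simp
  thus ?thesis using assms(1) by simp
qed

text \<open>Greedy expansion of a length in the block lengths \<open>Q l\<close> bounds every window
  sum of \<psi>; \<open>abel_block\<close> is then applied between consecutive \<open>Q l\<close>.
  The stretch up to \<open>Q 1\<close> stays explicit in the conclusion because in the application
  its size depends on M.\<close>

lemma sum_over_denominators:
  fixes c \<psi> :: "nat \<Rightarrow> real" and Q :: "nat \<Rightarrow> nat"
  assumes Q0: "Q 0 = 1" and Qm: "\<And>l. l < J \<Longrightarrow> Q l \<le> Q (l+1)"
    and Q2: "\<And>l. l + 2 \<le> J \<Longrightarrow> 2 * Q l \<le> Q (l+2)"
    and J: "J \<ge> 1" and H: "H < Q J" and K: "K \<ge> 0"
    and c0: "\<And>i. 1 \<le> i \<Longrightarrow> i \<le> H \<Longrightarrow> 0 \<le> c i \<and> c i \<le> K / real i"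
    and c1: "\<And>i. 1 \<le> i \<Longrightarrow> i < H \<Longrightarrow> \<bar>c i - c (i+1)\<bar> \<le> K / (real i * real (i+1))"
    and psi1: "\<And>i. \<bar>\<psi> i\<bar> \<le> 10"
    and block: "\<And>l s. l < J \<Longrightarrow> \<bar>\<Sum>i=s+1..s+Q l. \<psi> i\<bar> \<le> 10"
  shows "\<bar>\<Sum>i=1..H. c i * \<psi> i\<bar> \<le> \<bar>\<Sum>i=1..min H (Q 1). c i * \<psi> i\<bar>
     + K * (400 + 10 * (\<Sum>l=1..<J. ln (real (Q (l+1)) / real (Q l)) / real (Q l)))"
proof -
  have Qpos: "Q l \<ge> 1" if "l \<le> J" for l
    using that by (induction l) (use Q0 Qm in \<open>auto simp: Suc_le_eq intro: order.strict_trans2\<close>)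
  have Qmono: "Q l \<le> Q l'" if "l \<le> l'" "l' \<le> J" for l l'
    using that by (induction l' rule: dec_induct) (use Qm in \<open>auto intro: order_trans\<close>)
  \<comment> \<open>Bounds the number of blocks of levels below l used by the greedy expansion of a
    length below \<open>Q l\<close>.\<close>
  define V where "V l = (\<Sum>m<l. real (Q (m+1)) / real (Q m))" for l
  have V0: "V l \<ge> 0" for l unfolding V_def by (intro sum_nonneg) auto
  have disc: "\<bar>\<Sum>i=s+1..s+I. \<psi> i\<bar> \<le> 10 / real (Q l) * real I + 10 * V l" if "l < J" for l s I
    using that
  proof (induction l arbitrary: s I)
    case 0
    have "\<bar>\<Sum>i=s+1..s+I. \<psi> i\<bar> \<le> (\<Sum>i=s+1..s+I. 10)" 
      by (rule order_trans[OF sum_abs sum_mono]) (use psi1 in auto)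
    thus ?case by (simp add: Q0 V_def)
  next
    case (Suc l)
    have mult: "\<bar>\<Sum>i=s+1..s+t * Q (Suc l). \<psi> i\<bar> \<le> 10 * real t" for t
    proof (induction t)
      case (Suc t)
      have "(\<Sum>i=s+1..s+Suc t * Q (Suc l). \<psi> i) = (\<Sum>i=s+1..s+t * Q (Suc l). \<psi> i)
          + (\<Sum>i=(s+t*Q (Suc l))+1..(s+t*Q (Suc l)) + Q (Suc l). \<psi> i)"
        by (subst sum.ub_add_nat[symmetric]) (auto simp: algebra_simps)
      thus ?case using Suc.IH block[of "Suc l" "s + t * Q (Suc l)"] \<open>Suc l < J\<close> by (simp add: algebra_simps)
    qed simp
    define t where "t = I div Q (Suc l)"
    define I' where "I' = I mod Q (Suc l)"
    have Il: "I = t * Q (Suc l) + I'" by (simp add: t_def I'_def)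
    have q1: "Q (Suc l) \<ge> 1" "Q l \<ge> 1" using Qpos Suc.prems by auto
    have I'lt: "I' < Q (Suc l)" using q1 by (simp add: I'_def)
    have "(\<Sum>i=s+1..s+I. \<psi> i) = (\<Sum>i=s+1..s+t*Q (Suc l). \<psi> i) + (\<Sum>i=(s+t*Q (Suc l))+1..(s+t*Q (Suc l)) + I'. \<psi> i)"
      unfolding Il by (subst sum.ub_add_nat[symmetric]) (auto simp: algebra_simps)
    hence "\<bar>\<Sum>i=s+1..s+I. \<psi> i\<bar> \<le> 10 * real t + (10 / real (Q l) * real I' + 10 * V l)"
      using mult[of t] Suc.IH[of "s+t*Q (Suc l)" I'] Suc.prems by linarith
    also have "10 * real t \<le> 10 / real (Q (Suc l)) * real I"
      using q1 by (simp add: Il field_simps)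
    also have "10 / real (Q l) * real I' \<le> 10 / real (Q l) * real (Q (Suc l))"
      using I'lt by (intro mult_left_mono) auto
    also have "10 / real (Q (Suc l)) * real I + (10 / real (Q l) * real (Q (Suc l)) + 10 * V l)
        = 10 / real (Q (Suc l)) * real I + 10 * V (Suc l)" by (simp add: V_def)
    finally show ?case by simp
  qed
  define B where "B l = K * (10 / real (Q l) * (ln (real (Q (l+1)) / real (Q l)) + 1) + 20 * V l / real (Q l))" for l
  have Bnn: "B l \<ge> 0" if "l < J" for l
    unfolding B_def using K V0[of l] Qm[OF that] Qpos[of l] that by (intro mult_nonneg_nonneg add_nonneg_nonneg) auto
  have blk: "\<bar>\<Sum>i=1..min H (Q (l+1)). c i * \<psi> i\<bar> \<le> \<bar>\<Sum>i=1..min H (Q l). c i * \<psi> i\<bar> + B l" if l: "1 \<le> l" "l < J" for l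
  proof (cases "H \<le> Q l")
    case True
    hence "min H (Q (l+1)) = min H (Q l)" using Qm[OF l(2)] by simp
    thus ?thesis using Bnn[OF l(2)] by simp
  next
    case False
    define s where "s = Q l" define e where "e = min H (Q (l+1))"
    have q1: "s \<ge> 1" using Qpos[of l] l by (simp add: s_def)
    have se: "s \<le> e" using False Qm[OF l(2)] by (simp add: s_def e_def)
    have eH: "e \<le> H" by (simp add: e_def)
    have "\<bar>\<Sum>i=s+1..e. c i * \<psi> i\<bar> \<le> K * (10 / real (Q l) * (ln (real e / real s) + 1) + 2 * (10 * V l) / real s)"
      using q1 se K V0 eH by (intro abel_block c0 c1 disc l) auto
    also have "\<dots> \<le> B l"
    proof -
      have "real e / real s \<le> real (Q (l+1)) / real (Q l)" unfolding s_def e_def by (intro divide_right_mono) auto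
      hence "ln (real e / real s) \<le> ln (real (Q (l+1)) / real (Q l))" 
        using q1 se Qm[OF l(2)] by (subst ln_le_cancel_iff) (auto simp: s_def)
      thus ?thesis unfolding B_def s_def using K by (intro mult_left_mono add_mono) auto
    qed
    finally have "\<bar>\<Sum>i=s+1..e. c i * \<psi> i\<bar> \<le> B l" .
    moreover have "(\<Sum>i=1..e. c i * \<psi> i) = (\<Sum>i=1..s. c i * \<psi> i) + (\<Sum>i=s+1..e. c i * \<psi> i)"
    proof -
      obtain k where "e = s + k" using se le_Suc_ex by blast
      thus ?thesis using sum.ub_add_nat[of 1 s "\<lambda>i. c i * \<psi> i" k] by simp
    qed
    moreover have "min H (Q l) = s" using False by (simp add: s_def)
    ultimately show ?thesis unfolding e_def by simp
  qed
  have tele: "\<bar>\<Sum>i=1..min H (Q l). c i * \<psi> i\<bar> \<le> \<bar>\<Sum>i=1..min H (Q 1). c i * \<psi> i\<bar> + (\<Sum>m=1..<l. B m)" if "1 \<le> l" "l \<le> J" for l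
    using that
  proof (induction l rule: dec_induct)
    case (step n)
    have "(\<Sum>m=1..<Suc n. B m) = (\<Sum>m=1..<n. B m) + B n" using step by simp
    thus ?case using step blk[of n] by auto
  qed simp
  have iq: "(\<Sum>l\<le>n. 1 / real (Q l)) \<le> 4" if "n < J" for n
    using that by (intro sum_inverse_denominators[of Q J] Q0 Qpos Q2) auto
  \<comment> \<open>From l to l + 2 the old part of V l / Q l loses a factor 2, and the two new
    ratios contribute at most 1/Q l + 1/Q (l+1). Hence 18 = 2 + 2 * 8, and below 400 = 10 * 4 + 20 *
    18.\<close>
  have vq: "(\<Sum>l\<le>n. V l / real (Q l)) \<le> 18" if nJ: "n < J" for n
  proof (cases "n \<ge> 1")
    case True
    have "(\<Sum>l\<le>n. V l / real (Q l)) \<le> 2 * (V 0 / real (Q 0)) + 2 * (V 1 / real (Q 1)) + 2 * (\<Sum>l\<le>n. 1 / real (Q l) + 1 / real (Q (l+1)))"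
    proof (rule sum_two_step_contraction[OF _ _ _ True])
      fix l assume l: "l + 2 \<le> n"
      have q: "2 * real (Q l) \<le> real (Q (l+2))" "real (Q l) \<ge> 1" "real (Q (l+1)) \<ge> 1" "real (Q (l+1)) \<le> real (Q (l+2))"
        using Q2[of l] Qpos[of l] Qpos[of "l+1"] Qm[of "l+1"] that l by (auto simp flip: of_nat_mult simp: numeral_eq_Suc)
      have "V (l+2) / real (Q (l+2)) = V l / real (Q (l+2)) + (real (Q (l+1)) / real (Q (l+2))) / real (Q l) + 1 / real (Q (l+1))"
        using q by (simp add: V_def numeral_eq_Suc add_divide_distrib)
      also have "V l / real (Q (l+2)) \<le> V l / (2 * real (Q l))" using q V0[of l] by (intro divide_left_mono) auto
      also have "(real (Q (l+1)) / real (Q (l+2))) / real (Q l) \<le> 1 / real (Q l)" using q by (intro divide_right_mono) auto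
      finally show "V (l+2) / real (Q (l+2)) \<le> V l / real (Q l) / 2 + (1 / real (Q l) + 1 / real (Q (l+1)))" by simp
    qed (use V0 in auto)
    also have "2 * (V 0 / real (Q 0)) + 2 * (V 1 / real (Q 1)) = 2" using Qpos[of 1] J by (simp add: V_def Q0)
    also have "(\<Sum>l\<le>n. 1 / real (Q l) + 1 / real (Q (l+1))) \<le> (\<Sum>l\<le>n. 1 / real (Q l) + 1 / real (Q l))"
      using nJ Qm Qpos by (intro sum_mono add_left_mono divide_left_mono mult_pos_pos) (auto simp: Suc_le_eq)
    also have "\<dots> \<le> 8" using iq[OF that] by (simp only: sum.distrib)
    finally show ?thesis by simp
  next
    case False
    hence "n = 0" by simp
    thus ?thesis by (simp add: V_def)
  qed
  obtain J' where J': "J = Suc J'" using J by (cases J) auto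
  have "(\<Sum>m=1..<J. B m) = K * ((\<Sum>m=1..<J. 10 * (ln (real (Q (m+1)) / real (Q m)) / real (Q m))) + 10 * (\<Sum>m=1..<J. 1 / real (Q m)) + 20 * (\<Sum>m=1..<J. V m / real (Q m)))"
    unfolding B_def by (simp add: sum_distrib_left sum.distrib[symmetric] add_divide_distrib algebra_simps)
  also have "\<dots> \<le> K * ((\<Sum>m=1..<J. 10 * (ln (real (Q (m+1)) / real (Q m)) / real (Q m))) + 400)"
  proof -
    have "(\<Sum>m=1..<J. 1 / real (Q m)) \<le> (\<Sum>l\<le>J'. 1 / real (Q l))" by (rule sum_mono2) (auto simp: J')
    hence 1: "(\<Sum>m=1..<J. 1 / real (Q m)) \<le> 4" using iq[of J'] J' by simp
    have "(\<Sum>m=1..<J. V m / real (Q m)) \<le> (\<Sum>l\<le>J'. V l / real (Q l))" using V0 by (intro sum_mono2) (auto simp: J')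
    hence 2: "(\<Sum>m=1..<J. V m / real (Q m)) \<le> 18" using vq[of J'] J' by simp
    show ?thesis using 1 2 K by (intro mult_left_mono) auto
  qed
  finally have "(\<Sum>m=1..<J. B m) \<le> K * (400 + 10 * (\<Sum>l=1..<J. ln (real (Q (l+1)) / real (Q l)) / real (Q l)))"
    by (simp add: sum_distrib_left add.commute)
  moreover have "min H (Q J) = H" using H by simp
  ultimately show ?thesis using tele[of J] J by simp
qed

section \<open>Continued fractions\<close>

declare cf_rem.simps(2) [simp del]

locale irrational =
  fixes \<alpha> :: real
  assumes irrational: "\<alpha> \<notin> \<rat>"
begin

definition digit :: "nat \<Rightarrow> nat" where "digit k = nat (cf_digit \<alpha> k)"
definition q :: "nat \<Rightarrow> nat" where "q k = nat (cf_den \<alpha> k)"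
definition q' :: "nat \<Rightarrow> nat" where "q' k = (if k = 0 then 0 else q (k - 1))"

fun p :: "nat \<Rightarrow> int" where
  "p 0 = cf_digit \<alpha> 0"
| "p (Suc 0) = cf_digit \<alpha> 0 * cf_digit \<alpha> 1 + 1"
| "p (Suc (Suc k)) = cf_digit \<alpha> (k + 2) * p (Suc k) + p k"

definition \<delta> :: "nat \<Rightarrow> real" where "\<delta> k = (-1) ^ k * (real (q k) * \<alpha> - of_int (p k))"

lemma cf_rem_irrational: "cf_rem \<alpha> k \<notin> \<rat>"
proof (induction k)
  case (Suc k)
  show ?case
  proof
    assume "cf_rem \<alpha> (Suc k) \<in> \<rat>"
    hence "inverse (cf_rem \<alpha> (Suc k)) + of_int \<lfloor>cf_rem \<alpha> k\<rfloor> \<in> \<rat>" by (intro Rats_add Rats_inverse Rats_of_int)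
    thus False using Suc by (simp add: cf_rem.simps(2))
  qed
qed (use irrational in simp)

lemma cf_rem_frac: "0 < cf_rem \<alpha> k - of_int \<lfloor>cf_rem \<alpha> k\<rfloor>" "cf_rem \<alpha> k - of_int \<lfloor>cf_rem \<alpha> k\<rfloor> < 1"
proof -
  have "cf_rem \<alpha> k \<noteq> of_int \<lfloor>cf_rem \<alpha> k\<rfloor>" using cf_rem_irrational[of k] by (metis Rats_of_int)
  thus "0 < cf_rem \<alpha> k - of_int \<lfloor>cf_rem \<alpha> k\<rfloor>" by linarith
qed linarith

lemma cf_rem_gt_1: "cf_rem \<alpha> (Suc k) > 1"
  using cf_rem_frac[of k] by (simp add: cf_rem.simps(2))

lemma cf_digit_ge_1: "cf_digit \<alpha> (Suc k) \<ge> 1"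
  unfolding cf_digit_def using cf_rem_gt_1[of k] by simp

lemma digit_ge_1: "digit (Suc k) \<ge> 1"
  and int_digit: "int (digit (Suc k)) = cf_digit \<alpha> (Suc k)"
  using cf_digit_ge_1[of k] by (simp_all add: digit_def)

lemma real_digit: "real (digit (Suc k)) = of_int (cf_digit \<alpha> (Suc k))"
  using int_digit[of k] by (metis of_int_of_nat_eq)

lemma cf_den_ge_1: "cf_den \<alpha> k \<ge> 1"
proof (induction k rule: less_induct)
  case (less k)
  consider "k = 0" | "k = 1" | m where "k = Suc (Suc m)"
    by (metis One_nat_def not0_implies_Suc)
  thus ?case
  proof cases
    case 3
    have "1 * 1 \<le> cf_digit \<alpha> (m + 2) * cf_den \<alpha> (Suc m)"
      using cf_digit_ge_1[of "Suc m"] less[of "Suc m"] 3 by (intro mult_mono) auto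
    moreover have "cf_den \<alpha> m \<ge> 1" using less[of m] 3 by simp
    ultimately show ?thesis using 3 by simp
  qed (use cf_digit_ge_1[of 0] in auto)
qed

lemma int_q: "int (q k) = cf_den \<alpha> k" using cf_den_ge_1[of k] by (simp add: q_def)

lemma q_ge_1: "q k \<ge> 1" using cf_den_ge_1[of k] by (simp add: q_def)

lemma q_0 [simp]: "q 0 = 1" by (simp add: q_def)

lemma q_Suc: "q (Suc k) = digit (Suc k) * q k + q' k"
proof -
  have "int (q (Suc k)) = int (digit (Suc k) * q k + q' k)"
  proof (cases k)
    case (Suc m)
    thus ?thesis by (simp add: int_q int_digit q'_def)
  qed (simp add: int_q int_digit q'_def)
  thus ?thesis by (simp only: of_nat_eq_iff)
qed

lemma q'_Suc [simp]: "q' (Suc k) = q k" and q'_0 [simp]: "q' 0 = 0" by (simp_all add: q'_def)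

lemma q'_le: "q' k \<le> q k"
  by (cases k) (use digit_ge_1 in \<open>auto simp: q_Suc intro: trans_le_add1\<close>)

lemma \<delta>_0: "\<delta> 0 = \<alpha> - of_int \<lfloor>\<alpha>\<rfloor>" by (simp add: \<delta>_def cf_digit_def)

lemma \<delta>_Suc_Suc: "\<delta> k = real (digit (k+2)) * \<delta> (k+1) + \<delta> (k+2)"
proof -
  have 1: "real (q (k+2)) = real (digit (k+2)) * real (q (k+1)) + real (q k)"
    using q_Suc[of "k+1"] by (simp add: q'_def)
  have 2: "real_of_int (p (k+2)) = real (digit (k+2)) * of_int (p (k+1)) + of_int (p k)"
    using real_digit[of "k+1"] by simp
  show ?thesis unfolding \<delta>_def 1 2 by (simp add: algebra_simps)
qed

text \<open>The ratio of consecutive \<open>\<delta>\<close> is the complete quotient. Positivity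
  goes through the same induction because this quotient exceeds 1 and so hands the sign on to the
  next index.\<close>

lemma \<delta>_rem: "\<delta> k = cf_rem \<alpha> (k+2) * \<delta> (k+1)" and \<delta>_pos: "\<delta> k > 0"
proof -
  have "\<delta> k > 0 \<and> \<delta> k = cf_rem \<alpha> (k+2) * \<delta> (k+1)"
  proof (induction k)
    case 0
    define r where "r = \<alpha> - of_int \<lfloor>\<alpha>\<rfloor>"
    have r: "r > 0" using cf_rem_frac[of 0] by (simp add: r_def)
    have q1: "real (q 1) = of_int \<lfloor>1 / r\<rfloor>" using real_digit[of 0]
      by (simp add: q_Suc cf_digit_def r_def cf_rem.simps(2))
    have "\<delta> 1 = 1 - of_int \<lfloor>1 / r\<rfloor> * r"
    proof -
      have "real_of_int (p 1) = of_int \<lfloor>\<alpha>\<rfloor> * real (q 1) + 1"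
        using real_digit[of 0] by (simp add: q_Suc) (simp add: cf_digit_def)
      thus ?thesis unfolding \<delta>_def by (simp add: q1[unfolded One_nat_def] r_def algebra_simps)
    qed
    moreover have "cf_rem \<alpha> 2 = 1 / (1 / r - of_int \<lfloor>1 / r\<rfloor>)" by (simp add: numeral_2_eq_2 r_def cf_rem.simps(2))
    moreover have "1 / r - of_int \<lfloor>1 / r\<rfloor> > 0" using cf_rem_frac[of 1] by (simp add: r_def cf_rem.simps(2))
    ultimately show ?case using r by (simp add: \<delta>_0 numeral_2_eq_2 flip: r_def) (simp add: field_simps)
  next
    case (Suc k)
    have gt: "cf_rem \<alpha> (k+2) > 1" using cf_rem_gt_1[of "k+1"] by simp
    have pos: "\<delta> (k+1) > 0" 
      using Suc gt zero_less_mult_pos[of "cf_rem \<alpha> (k+2)" "\<delta> (k+1)"] by simp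
    have fr: "cf_rem \<alpha> (k+2) - real (digit (k+2)) = 1 / cf_rem \<alpha> (k+3)"
    proof -
      have "real (digit (k+2)) = of_int \<lfloor>cf_rem \<alpha> (k+2)\<rfloor>"
        using real_digit[of "k+1"] by (simp add: cf_digit_def)
      moreover have "cf_rem \<alpha> (k+3) = 1 / (cf_rem \<alpha> (k+2) - of_int \<lfloor>cf_rem \<alpha> (k+2)\<rfloor>)"
        using cf_rem.simps(2)[of \<alpha> "k+2"] by (simp add: numeral_eq_Suc)
      ultimately show ?thesis using cf_rem_frac[of "k+2"] by simp
    qed
    have "\<delta> (k+2) = (cf_rem \<alpha> (k+2) - real (digit (k+2))) * \<delta> (k+1)"
      using \<delta>_Suc_Suc[of k] Suc by (simp add: algebra_simps)
    hence "\<delta> (k+1) = cf_rem \<alpha> (k+3) * \<delta> (k+2)"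
      unfolding fr using cf_rem_gt_1[of "k+2"] by (simp add: numeral_eq_Suc field_simps)
    thus ?case using pos by (simp add: numeral_eq_Suc)
  qed
  thus "\<delta> k > 0" "\<delta> k = cf_rem \<alpha> (k+2) * \<delta> (k+1)" by auto
qed

lemma \<delta>_less: "\<delta> (Suc k) < \<delta> k"
  using \<delta>_rem[of k] \<delta>_pos[of "k+1"] cf_rem_gt_1[of "k+1"] by simp

lemma q_\<delta>: "real (q (Suc k)) * \<delta> k + real (q k) * \<delta> (Suc k) = 1"
proof (induction k)
  case 0
  have "real_of_int (cf_digit \<alpha> (Suc 0)) = real (q 1)" using real_digit[of 0] by (simp add: q_Suc)
  thus ?case by (simp add: \<delta>_def algebra_simps)
next
  case (Suc k)
  have "real (q (k+2)) = real (digit (k+2)) * real (q (k+1)) + real (q k)" using q_Suc[of "k+1"] by simp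
  moreover have "real (q (k+1)) * \<delta> k = real (q (k+1)) * (real (digit (k+2)) * \<delta> (k+1) + \<delta> (k+2))"
    using \<delta>_Suc_Suc[of k] by simp
  ultimately show ?case using Suc by (simp add: algebra_simps)
qed

text \<open>By the determinant of consecutive convergents, q_(k-1) is up to sign the inverse of p_k
  modulo q_k. This is why the residue i is reached from -i q_(k-1).\<close>

lemma p_q': "\<exists>r. p k * int (q' k) = - ((-1) ^ k) + r * int (q k)"
proof -
  have "p (Suc k) * int (q k) - p k * int (q (Suc k)) = (-1) ^ k" for k
  proof (induction k)
    case 0 thus ?case using int_digit[of 0] by (simp add: q_Suc algebra_simps)
  next
    case (Suc k)
    have "int (q (Suc (Suc k))) = cf_digit \<alpha> (k+2) * int (q (Suc k)) + int (q k)"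
      using q_Suc[of "Suc k"] int_digit[of "Suc k"] by simp
    thus ?case using Suc by (simp add: algebra_simps)
  qed
  from this[of "k-1"] show ?thesis
    by (cases k) (auto intro!: exI[of _ 1] exI[of _ "p (k-1)"] simp: algebra_simps)
qed

text \<open>The determinant identity \<open>q_\<delta>\<close> divided by q_k \<delta>_k. Both
  fractions lie between 0 and 1, which locates q_k \<delta>_k between 1/(a_(k+1) + 2) and
  1/a_(k+1).\<close>

lemma q\<delta>_inverse: "1 / (real (q k) * \<delta> k) = real (digit (Suc k)) + real (q' k) / real (q k) + \<delta> (Suc k) / \<delta> k"
proof -
  define u v w x where "u = real (q (Suc k))" and "v = real (q k)" and "w = \<delta> k" and "x = \<delta> (Suc k)"
  have pos: "v > 0" "w > 0" using q_ge_1[of k] \<delta>_pos[of k] by (auto simp: v_def w_def)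
  have "1 / (v * w) = (u * w + v * x) / (v * w)"
    using q_\<delta>[of k] by (simp add: u_def v_def w_def x_def)
  also have "\<dots> = u / v + x / w" using pos by (simp add: add_divide_distrib)
  also have "u / v = real (digit (Suc k)) + real (q' k) / v"
    using pos by (simp add: u_def q_Suc add_divide_distrib flip: v_def)
  finally show ?thesis by (simp add: v_def w_def x_def)
qed

end

section \<open>A cotangent sum over a window\<close>

lemma sum_fold_antisym:
  fixes f c :: "nat \<Rightarrow> real"
  assumes "\<And>i. 1 \<le> i \<Longrightarrow> i < n \<Longrightarrow> c (n - i) = - c i"
  shows "(\<Sum>i=1..<n. f i * c i) = (\<Sum>i=1..(n-1) div 2. c i * (f i - f (n - i)))"
proof -
  define H where "H = (n - 1) div 2"
  have "(\<Sum>i=1..<n. f i * c i) = (\<Sum>i\<in>{1..H} \<union> {n-H..<n}. f i * c i)"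
  proof (rule sum.mono_neutral_right)
    show "\<forall>i\<in>{1..<n} - ({1..H} \<union> {n - H..<n}). f i * c i = 0"
    proof
      fix i assume "i \<in> {1..<n} - ({1..H} \<union> {n - H..<n})"
      hence "1 \<le> i" "i < n" "n - i = i" unfolding H_def by auto
      thus "f i * c i = 0" using assms[of i] by simp
    qed
  qed (auto simp: H_def)
  also have "\<dots> = (\<Sum>i\<in>{1..H}. f i * c i) + (\<Sum>i\<in>{n-H..<n}. f i * c i)"
    by (rule sum.union_disjoint) (auto simp: H_def)
  also have "(\<Sum>i\<in>{n-H..<n}. f i * c i) = (\<Sum>i\<in>{1..H}. f (n - i) * c (n - i))"
    by (rule sum.reindex_bij_witness[of _ "\<lambda>i. n - i" "\<lambda>i. n - i"]) (auto simp: H_def)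
  also have "\<dots> = (\<Sum>i\<in>{1..H}. - (f (n - i) * c i))"
    by (rule sum.cong) (use assms in \<open>auto simp: H_def\<close>)
  finally show ?thesis by (simp add: H_def sum.distrib[symmetric] algebra_simps)
qed

section \<open>Elementary bounds for harmonic sums, sine and cotangent\<close>

lemma sum_inverse_le_ln: "(\<Sum>i=1..n. 1 / real i) \<le> 1 + ln (real n)" if "n \<ge> 1"
  using that
proof (induction n rule: dec_induct)
  case (step n)
  have "ln (real n / real (Suc n)) \<le> real n / real (Suc n) - 1" using step by (intro ln_le_minus_one) auto
  hence "1 / real (Suc n) \<le> ln (real (Suc n)) - ln (real n)" using step by (simp add: ln_div field_simps)
  thus ?case using step by simp
qed simp

lemma cot_le_inverse: "cot x \<le> 1 / x" if "0 < x" "x < pi" for x :: real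
proof -
  have s: "sin x > 0" using that sin_gt_zero by auto
  define f where "f y = sin y - y * cos y" for y :: real
  have "f 0 \<le> f x"
  proof (rule DERIV_nonneg_imp_nondecreasing[where f = f and a = 0 and b = x])
    fix y assume "0 \<le> y" "y \<le> x"
    hence "0 \<le> y * sin y" using that sin_ge_zero[of y] by auto
    moreover have "(f has_real_derivative y * sin y) (at y)"
      unfolding f_def by (auto intro!: derivative_eq_intros)
    ultimately show "\<exists>z. (f has_real_derivative z) (at y) \<and> 0 \<le> z" by blast
  qed (use that in simp)
  thus ?thesis using s that by (simp add: f_def cot_def field_simps)
qed

lemma sin_ge_half_pi: "sin x \<ge> 2 / pi * x" if "0 \<le> x" "x \<le> pi / 2"
proof -
  have conc: "concave_on {0..pi} sin"
    by (rule f''_le0_imp_concave[where f' = cos and f'' = "\<lambda>x. - sin x"])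
      (auto intro!: derivative_eq_intros sin_ge_zero)
  have "sin ((1 - 2/pi*x) *\<^sub>R 0 + (2/pi*x) *\<^sub>R (pi/2)) \<ge> (1 - 2/pi*x) * sin 0 + (2/pi*x) * sin (pi/2)"
    by (rule concave_onD[OF conc]) (use that in \<open>auto simp: field_simps\<close>)
  thus ?thesis by simp
qed

lemma sin_pi_ge: "sin (pi * x) \<ge> 2 * x" if "0 \<le> x" "x \<le> 1/2"
  using sin_ge_half_pi[of "pi * x"] that by simp

lemma sin_pi_ge_min: "sin (pi * x) \<ge> 2 * min x (1 - x)" if "0 \<le> x" "x \<le> 1"
proof (cases "x \<le> 1/2")
  case False
  have "sin (pi * x) = sin (pi * (1 - x))" by (simp add: right_diff_distrib sin_diff)
  thus ?thesis using sin_pi_ge[of "1 - x"] False that by simp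
qed (use sin_pi_ge[of x] that in auto)

context irrational begin

text \<open>The convergents of $q_{j-1}/q_j = [0; a_j, a_{j-1}, \<dots>, a_1]$; the recursions are meaningful for indices up to $j$.\<close>

fun rev_den :: "nat \<Rightarrow> nat \<Rightarrow> nat" where
  "rev_den j 0 = 1"
| "rev_den j (Suc 0) = digit j"
| "rev_den j (Suc (Suc l)) = digit (j - l - 1) * rev_den j (Suc l) + rev_den j l"

fun rev_num :: "nat \<Rightarrow> nat \<Rightarrow> nat" where
  "rev_num j 0 = 0"
| "rev_num j (Suc 0) = 1"
| "rev_num j (Suc (Suc l)) = digit (j - l - 1) * rev_num j (Suc l) + rev_num j l"

lemma digit_pos: "k \<ge> 1 \<Longrightarrow> digit k \<ge> 1" using digit_ge_1[of "k-1"] by simp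

lemma q_rec: "k \<ge> 1 \<Longrightarrow> q k = digit k * q' k + q' (k - 1)"
  using q_Suc[of "k-1"] by (cases k) auto

text \<open>The recursion of q run backwards: the remainders of the Euclidean algorithm on q_j and
  q_(j-1) are the earlier denominators.\<close>

lemma rev_den_q': "l \<le> j \<Longrightarrow> int (rev_den j l * q' j) - int (rev_num j l * q j) = (-1)^l * int (q' (j - l))"
proof (induction j l rule: rev_den.induct)
  case (2 j)
  thus ?case using q_rec[of j] by simp
next
  case (3 j l)
  define k where "k = j - l - 1"
  have k: "k \<ge> 1" "j - Suc l = k" "j - l = Suc k" "j - Suc (Suc l) = k - 1" using 3 by (auto simp: k_def)
  have "int (rev_den j (Suc (Suc l)) * q' j) - int (rev_num j (Suc (Suc l)) * q j)
     = int (digit k) * (int (rev_den j (Suc l) * q' j) - int (rev_num j (Suc l) * q j)) + (int (rev_den j l * q' j) - int (rev_num j l * q j))"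
    by (simp add: k_def algebra_simps)
  also have "\<dots> = int (digit k) * ((-1)^Suc l * int (q' k)) + (-1)^l * int (q' (Suc k))"
    using 3 k by simp
  also have "\<dots> = (-1)^l * int (q' (k - 1))" using q_rec[of k] k by (simp add: algebra_simps)
  finally show ?case using k by simp
qed simp

text \<open>Euler's identity for continuants, cutting a_1, ..., a_j between a_(j-l-1) and
  a_(j-l).\<close>

lemma q_rev_den: "l < j \<Longrightarrow> q j = rev_den j (Suc l) * q (j - l - 1) + rev_den j l * q' (j - l - 1)"
proof (induction l)
  case 0
  thus ?case using q_Suc[of "j-1"] by simp
next
  case (Suc l)
  define k where "k = j - l - 1"
  have k: "k \<ge> 1" "j - Suc l - 1 = k - 1" using Suc by (auto simp: k_def)
  have "q j = rev_den j (Suc l) * q k + rev_den j l * q' k" using Suc by (simp add: k_def)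
  also have "q k = digit k * q (k-1) + q' (k-1)" using q_Suc[of "k-1"] k by simp
  also have "q' k = q (k-1)" using k by (cases k) auto
  finally have "q j = rev_den j (Suc (Suc l)) * q (k-1) + rev_den j (Suc l) * q' (k-1)"
    by (simp add: k_def algebra_simps)
  thus ?case using k by simp
qed

lemma rev_den_ge_1: "l \<le> j \<Longrightarrow> rev_den j l \<ge> 1"
  by (induction j l rule: rev_den.induct) (auto simp: digit_pos[unfolded One_nat_def] intro: trans_le_add2)

lemma rev_den_mono: "l < j \<Longrightarrow> rev_den j l \<le> rev_den j (Suc l)"
proof (cases l)
  case 0 assume "l < j" thus ?thesis using digit_pos[of j] 0 by simp
next
  case (Suc m) assume "l < j" thus ?thesis using digit_pos[of "j - m - 1"] Suc by (simp add: trans_le_add1)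
qed

lemma rev_den_double:
  assumes "Suc (Suc l) \<le> j"
  shows "2 * rev_den j l \<le> rev_den j (Suc (Suc l))"
proof -
  have "rev_den j (Suc l) \<le> digit (j - l - 1) * rev_den j (Suc l)"
  proof -
    have "j - l - 1 \<ge> 1" using assms by simp
    from mult_le_mono1[OF digit_pos[OF this], of "rev_den j (Suc l)"] show ?thesis by (simp only: mult_1)
  qed
  moreover have "rev_den j l \<le> rev_den j (Suc l)" using rev_den_mono[of l j] assms by simp
  ultimately show ?thesis unfolding rev_den.simps(3) by linarith
qed

lemma rev_den_ratio: "l < j \<Longrightarrow> rev_den j (Suc l) \<le> (digit (j - l) + 1) * rev_den j l"
proof (cases l)
  case (Suc m) assume "l < j" thus ?thesis using rev_den_mono[of m j] Suc by simp
qed simp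

lemma rev_den_coprime: "l < j \<Longrightarrow> coprime (int (rev_num j l)) (int (rev_den j l))"
proof -
  have det: "int (rev_num j (Suc l) * rev_den j l) - int (rev_num j l * rev_den j (Suc l)) = (-1) ^ l" for l
    by (induction l) (auto simp: algebra_simps)
  show ?thesis
  proof (rule coprimeI)
    fix c assume "c dvd int (rev_num j l)" "c dvd int (rev_den j l)"
    hence "c dvd int (rev_num j (Suc l) * rev_den j l) - int (rev_num j l * rev_den j (Suc l))" by simp
    hence "c dvd (-1) ^ l" unfolding det .
    thus "is_unit c" by (cases "even l") auto
  qed
qed

text \<open>Continuants are invariant under reversal. The last scale is therefore q_j and exceeds
  every index of the folded cotangent sum.\<close>

lemma rev_den_full: "j \<ge> 1 \<Longrightarrow> rev_den j j = q j"
  using q_rev_den[of "j-1" j] by simp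

lemma rev_den_approx: 
  assumes "l < j"
  shows "\<bar>real (q' j) / real (q j) - real_of_int (int (rev_num j l)) / real (rev_den j l)\<bar> \<le> 1 / (real (rev_den j l))\<^sup>2"
proof -
  have pos: "real (rev_den j l) > 0" "real (q j) > 0" using rev_den_ge_1[of l j] q_ge_1[of j] assms by auto
  have "real_of_int (int (rev_den j l * q' j) - int (rev_num j l * q j)) = real_of_int ((-1)^l * int (q' (j - l)))"
    using rev_den_q'[of l j] assms by simp
  hence e: "real (rev_den j l) * real (q' j) - real (rev_num j l) * real (q j) = (-1)^l * real (q' (j - l))" by simp
  have "rev_den j l * q' (j - l) \<le> rev_den j (Suc l) * q (j - l - 1)"
    using rev_den_mono[OF assms] assms by (intro mult_mono) (auto simp: q'_def)
  also have "\<dots> \<le> q j" using q_rev_den[OF assms] by simp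
  finally have "real (rev_den j l * q' (j - l)) \<le> real (q j)" by (simp only: of_nat_le_iff)
  hence b: "real (rev_den j l) * real (q' (j - l)) \<le> real (q j)" by simp
  have "real (q' j) / real (q j) - real (rev_num j l) / real (rev_den j l) = ((-1)^l * real (q' (j - l))) / (real (rev_den j l) * real (q j))"
    unfolding e[symmetric] using pos by (simp add: field_simps)
  hence "\<bar>real (q' j) / real (q j) - real (rev_num j l) / real (rev_den j l)\<bar> = real (q' (j - l)) / (real (rev_den j l) * real (q j))"
    using pos by (simp add: abs_mult power_abs)
  also have "\<dots> \<le> 1 / (real (rev_den j l))\<^sup>2"
    using b pos by (simp add: field_simps power2_eq_square)
  finally show ?thesis by simp
qed

text \<open>The logarithmic part of \<open>sum_over_denominators\<close> for the scales of
  q_(j-1)/q_j, where the l-th ratio is at most a_(j-l) + 1. The scale l = 0, of length a_j, is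
  absent because it is treated separately.\<close>

definition \<tau> :: "nat \<Rightarrow> real" where
  "\<tau> j = (\<Sum>l=1..<j. ln (real (rev_den j (l+1)) / real (rev_den j l)) / real (rev_den j l))"

text \<open>The representative of $-i q_{j-1}$ modulo $q_j$ in the window from $M+1$ to $M+q_j$; up to sign, $p_j$ times it is $i$ modulo $q_j$.\<close>

definition rep :: "nat \<Rightarrow> nat \<Rightarrow> nat \<Rightarrow> nat" where
  "rep j M i = M + 1 + nat ((- int i * int (q' j) - int M - 1) mod int (q j))"

lemma rep_frac:
  "real (rep j M i) / real (q j) = (real M + 1) / real (q j)
     + frac (- ((real M + 1) / real (q j)) - real i * (real (q' j) / real (q j)))"
proof -
  have q: "int (q j) > 0" using q_ge_1[of j] by simp
  define z where "z = - int i * int (q' j) - int M - 1"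
  have "real_of_int (z mod int (q j)) / real (q j) = frac (real_of_int z / real (q j))"
    using q by (simp add: frac_def floor_divide_of_int_eq[of z "int (q j)", simplified] minus_div_mult_eq_mod[symmetric] diff_divide_distrib)
  moreover have "real (nat (z mod int (q j))) = real_of_int (z mod int (q j))" using q by simp
  moreover have "real_of_int z / real (q j) = - ((real M + 1) / real (q j)) - real i * (real (q' j) / real (q j))"
    by (simp add: z_def diff_divide_distrib add_divide_distrib)
  ultimately show ?thesis unfolding rep_def z_def[symmetric] by (simp add: add_divide_distrib)
qed

text \<open>The two bounds differ in the stretch i <= a_j only. In general |\<psi>| <= 1 leaves a
  harmonic sum and thus ln a_j. If M is in the middle part of the window, the base point x is away
  from the integers, so \<psi> i = -2 i \<beta> until the first wrap-around; the factor i cancels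
  the 1/i of the cotangent, and the stretch costs O(Q a_j \<beta>) = O(Q).\<close>

lemma cot_sum_bound:
  assumes M: "M < q j" and q2: "q j \<ge> 2"
  defines "S \<equiv> (\<Sum>i=1..<q j. real (rep j M i) / real (q j) * cot (pi * (real i / real (q j))))"
  shows "\<bar>S\<bar> \<le> real (q j) * (401 + 10 * \<tau> j + ln (real (digit j)))"
    and "real (q j) / 2 \<le> real M \<Longrightarrow> real M + 1 \<le> 19/20 * real (q j) \<Longrightarrow> \<bar>S\<bar> \<le> real (q j) * (440 + 10 * \<tau> j)"
proof -
  have j: "j \<ge> 1" using q2 by (cases j) auto
  define Q where "Q = real (q j)"
  define \<beta> where "\<beta> = real (q' j) / Q"
  define x where "x = - ((real M + 1) / Q)"
  \<comment> \<open>The part of the window position that is antisymmetric under i -> q_j - i; the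
    rest is annihilated by the oddness of cot.\<close>
  define \<psi> where "\<psi> i = frac (x - real i * \<beta>) - frac (x + real i * \<beta>)" for i :: nat
  define c where "c i = cot (pi * (real i / Q))" for i :: nat
  define H where "H = (q j - 1) div 2"
  have Q2: "Q \<ge> 2" using q2 by (simp add: Q_def)
  have nnf: "real (rep j M i) / Q = (real M + 1) / Q + frac (x - real i * \<beta>)" for i
    unfolding x_def \<beta>_def Q_def by (rule rep_frac)
  have S: "S = (\<Sum>i=1..H. c i * \<psi> i)"
  proof -
    have "S = (\<Sum>i=1..H. c i * (real (rep j M i) / Q - real (rep j M (q j - i)) / Q))"
      unfolding S_def c_def H_def Q_def
    proof (rule sum_fold_antisym)
      fix i assume i: "1 \<le> i" "i < q j"
      have "pi * (real (q j - i) / real (q j)) = pi - pi * (real i / real (q j))"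
        using i by (simp add: of_nat_diff field_simps)
      thus "cot (pi * (real (q j - i) / real (q j))) = - cot (pi * (real i / real (q j)))"
        by (simp add: cot_def sin_diff cos_diff)
    qed
    also have "\<dots> = (\<Sum>i=1..H. c i * \<psi> i)"
    proof (rule sum.cong)
      fix i assume i: "i \<in> {1..H}"
      have "real (q j - i) * \<beta> = real (q' j) - real i * \<beta>"
        using i Q2 by (auto simp: \<beta>_def Q_def H_def of_nat_diff field_simps)
      hence "x - real (q j - i) * \<beta> = (x + real i * \<beta>) - of_int (int (q' j))" by simp
      hence "frac (x - real (q j - i) * \<beta>) = frac (x + real i * \<beta>)"
        unfolding frac_def by (simp only: floor_diff_of_int of_int_diff)
      thus "c i * (real (rep j M i) / Q - real (rep j M (q j - i)) / Q) = c i * \<psi> i"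
        unfolding nnf by (simp add: \<psi>_def)
    qed simp
    finally show ?thesis .
  qed
  have iH: "2 * real i + 1 \<le> Q" if "i \<le> H" for i
  proof -
    have "2 * i + 1 \<le> q j" using that q2 by (auto simp: H_def)
    thus ?thesis unfolding Q_def by linarith
  qed
  have c0: "0 \<le> c i \<and> c i \<le> Q / real i" if "1 \<le> i" "i \<le> H" for i
  proof
    have ih: "real i / Q < 1/2" "real i / Q > 0" using iH[OF that(2)] that Q2 by (auto simp: field_simps)
    define y where "y = pi * (real i / Q)"
    have y: "0 < y" "y < pi / 2"
      using ih mult_strict_left_mono[OF ih(1) pi_gt_zero] mult_pos_pos[OF pi_gt_zero ih(2)]
      by (simp_all add: y_def)
    have "cos y \<ge> 0" "sin y > 0" using y by (auto intro: cos_ge_zero sin_gt_zero)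
    thus "0 \<le> c i" unfolding c_def cot_def y_def[symmetric] by simp
    have "c i \<le> 1 / y" unfolding c_def y_def[symmetric]
      using y by (intro cot_le_inverse) auto
    also have "1 / y = 1 / (pi * (real i / Q))" by (simp only: y_def)
    also have "\<dots> = (1 / pi) * (Q / real i)" by simp
    also have "\<dots> \<le> 1 * (Q / real i)" using pi_gt3 Q2 by (intro mult_right_mono) auto
    finally show "c i \<le> Q / real i" by simp
  qed
  have c1: "\<bar>c i - c (i+1)\<bar> \<le> Q / (real i * real (i+1))" if "1 \<le> i" "i < H" for i
  proof -
    have h: "2 * real (i+1) + 1 \<le> Q" using iH[of "i+1"] that by simp
    define A B N where "A = sin (pi * (real (i+1) / Q))" and "B = sin (pi * (real i / Q))" and "N = sin (pi / Q)"
    have s1: "B \<ge> 2 * (real i / Q)" unfolding B_def using h Q2 by (intro sin_pi_ge) (auto simp: field_simps)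
    have s2: "A \<ge> 2 * (real (i+1) / Q)" unfolding A_def using h Q2 by (intro sin_pi_ge) (auto simp: field_simps)
    have p1: "2 * (real i / Q) > 0" "2 * (real (i+1) / Q) > 0" using that Q2 by auto
    have AB: "A > 0" "B > 0" using s1 s2 p1 by linarith+
    have "pi * (real (i+1) / Q) - pi * (real i / Q) = pi / Q" by (simp add: add_divide_distrib algebra_simps)
    hence "c i - c (i+1) = N / (A * B)"
      unfolding c_def N_def using cot_diff[of "pi * (real (i+1) / Q)" "pi * (real i / Q)"] AB[unfolded A_def B_def]
      unfolding A_def B_def by simp
    moreover have "pi / Q \<ge> 0" "pi / Q \<le> pi" using Q2 by (simp_all add: field_simps)
    hence sp: "0 \<le> N" "N \<le> pi / Q" unfolding N_def by (auto intro: sin_ge_zero sin_x_le_x)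
    ultimately have "\<bar>c i - c (i+1)\<bar> = N / (A * B)" using AB by simp
    also have "\<dots> \<le> (pi / Q) / (2 * (real (i+1) / Q) * (2 * (real i / Q)))"
      using s1 s2 p1 sp by (intro frac_le mult_mono mult_pos_pos) linarith+
    also have "\<dots> = (pi / 4) * (Q / (real i * real (i+1)))" using Q2 that by (simp add: field_simps)
    also have "\<dots> \<le> 1 * (Q / (real i * real (i+1)))" using pi_less_4 Q2 by (intro mult_right_mono) auto
    finally show ?thesis by simp
  qed
  have psi1: "\<bar>\<psi> i\<bar> \<le> 1" for i
    unfolding \<psi>_def using frac_lt_1[of "x - real i * \<beta>"] frac_lt_1[of "x + real i * \<beta>"]
      frac_ge_0[of "x - real i * \<beta>"] frac_ge_0[of "x + real i * \<beta>"] unfolding abs_le_iff by linarith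
  \<comment> \<open>The rotations by \<beta> and by -\<beta> both have sum Q/2 up to 5 over a
    period, so the main terms cancel and 10 remains.\<close>
  have block: "\<bar>\<Sum>i=s+1..s+rev_den j l. \<psi> i\<bar> \<le> 10" if l: "l < j" for l s
  proof -
    have sh: "(\<Sum>i=s+1..s+rev_den j l. f i) = (\<Sum>i=1..rev_den j l. f (s + i))" for f :: "nat \<Rightarrow> real"
      by (rule sum.reindex_bij_witness[of _ "\<lambda>i. s + i" "\<lambda>i. i - s"]) auto
    have "(\<Sum>i=s+1..s+rev_den j l. \<psi> i) = (\<Sum>i=1..rev_den j l. frac ((x - real s * \<beta>) + real i * (-\<beta>)) - frac ((x + real s * \<beta>) + real i * \<beta>))"
      unfolding sh \<psi>_def by (simp add: algebra_simps)
    also have "\<dots> = (\<Sum>i=1..rev_den j l. frac ((x - real s * \<beta>) + real i * (-\<beta>))) - (\<Sum>i=1..rev_den j l. frac ((x + real s * \<beta>) + real i * \<beta>))"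
      by (rule sum_subtractf)
    finally have eq: "(\<Sum>i=s+1..s+rev_den j l. \<psi> i) = \<dots>" .
    have ap: "\<bar>\<beta> - real_of_int (int (rev_num j l)) / real (rev_den j l)\<bar> \<le> 1 / (real (rev_den j l))\<^sup>2"
      unfolding \<beta>_def Q_def by (rule rev_den_approx[OF l])
    have 1: "\<bar>(\<Sum>i=1..rev_den j l. frac ((x + real s * \<beta>) + real i * \<beta>)) - real (rev_den j l) / 2\<bar> \<le> 5"
      by (rule denjoy_koksma_frac[OF _ rev_den_coprime[OF l] ap]) (use rev_den_ge_1[of l j] l in simp)
    have ap': "\<bar>-\<beta> - real_of_int (- int (rev_num j l)) / real (rev_den j l)\<bar> \<le> 1 / (real (rev_den j l))\<^sup>2"
      using ap by (simp add: abs_minus_commute)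
    have 2: "\<bar>(\<Sum>i=1..rev_den j l. frac ((x - real s * \<beta>) + real i * (-\<beta>))) - real (rev_den j l) / 2\<bar> \<le> 5"
      by (rule denjoy_koksma_frac[OF _ _ ap']) (use rev_den_ge_1[of l j] rev_den_coprime[OF l] l in simp_all)
    show ?thesis unfolding eq using 1 2 by linarith
  qed
  have main: "\<bar>S\<bar> \<le> \<bar>\<Sum>i=1..min H (rev_den j 1). c i * \<psi> i\<bar> + Q * (400 + 10 * \<tau> j)"
    unfolding S \<tau>_def
  proof (rule sum_over_denominators)
    show "\<And>l. l < j \<Longrightarrow> rev_den j l \<le> rev_den j (l+1)" using rev_den_mono by simp
    show "\<And>l. l + 2 \<le> j \<Longrightarrow> 2 * rev_den j l \<le> rev_den j (l + 2)" using rev_den_double by simp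
    show "H < rev_den j j" using rev_den_full[OF j] q2 by (simp add: H_def)
    show "\<And>i. \<bar>\<psi> i\<bar> \<le> 10" using psi1 by (meson order_trans one_le_numeral)
  qed (use j Q2 c0 c1 block in auto)
  have dgj: "digit j \<ge> 1" using digit_pos[OF j] .
  {
    have "\<bar>\<Sum>i=1..min H (rev_den j 1). c i * \<psi> i\<bar> \<le> (\<Sum>i=1..min H (rev_den j 1). Q * (1 / real i))"
    proof (rule order_trans[OF sum_abs sum_mono])
      fix i assume "i \<in> {1..min H (rev_den j 1)}"
      hence "0 \<le> c i \<and> c i \<le> Q / real i" using c0 by auto
      hence "\<bar>c i\<bar> * \<bar>\<psi> i\<bar> \<le> Q / real i * 1" using psi1[of i] Q2 by (intro mult_mono) auto
      thus "\<bar>c i * \<psi> i\<bar> \<le> Q * (1 / real i)" by (simp add: abs_mult)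
    qed
    also have "\<dots> \<le> (\<Sum>i=1..digit j. Q * (1 / real i))" using Q2 by (intro sum_mono2) auto
    also have "\<dots> = Q * (\<Sum>i=1..digit j. 1 / real i)" by (rule sum_distrib_left[symmetric])
    also have "\<dots> \<le> Q * (1 + ln (real (digit j)))" using sum_inverse_le_ln[OF dgj] Q2 by (intro mult_left_mono) auto
    finally have "\<bar>S\<bar> \<le> Q * (1 + ln (real (digit j))) + Q * (400 + 10 * \<tau> j)" using main by linarith
    also have "\<dots> = Q * (401 + 10 * \<tau> j + ln (real (digit j)))" by (simp add: algebra_simps)
    finally show "\<bar>S\<bar> \<le> real (q j) * (401 + 10 * \<tau> j + ln (real (digit j)))" by (simp add: Q_def)
  }
  assume Mb: "real (q j) / 2 \<le> real M" "real M + 1 \<le> 19/20 * real (q j)"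
  \<comment> \<open>For i \<beta> <= 1/20 both x - i \<beta> and x + i \<beta> stay in [-1, 0).
    Beyond that the trivial bound 1 is below 40/20.\<close>
  have psi2: "\<bar>\<psi> i\<bar> \<le> 40 * (real i * \<beta>)" for i
  proof (cases "real i * \<beta> \<le> 1/20")
    case True
    have b0: "\<beta> \<ge> 0" using Q2 by (simp add: \<beta>_def)
    have i0: "real i * \<beta> \<ge> 0" using b0 by simp
    have x: "x \<le> - (1/2)" "x \<ge> - (19/20)" using Mb Q2 unfolding x_def Q_def by (auto simp: field_simps)
    have "frac (x - real i * \<beta>) = x - real i * \<beta> + 1" 
      using x i0 True by (subst frac_unique_iff) auto
    moreover have "frac (x + real i * \<beta>) = x + real i * \<beta> + 1" 
      using x i0 True by (subst frac_unique_iff) auto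
    ultimately have "\<psi> i = - 2 * (real i * \<beta>)" by (simp add: \<psi>_def)
    thus ?thesis using i0 by (simp only: abs_le_iff) linarith
  next
    case False
    thus ?thesis using psi1[of i] by linarith
  qed
  have bq: "real (digit j) * \<beta> \<le> 1"
  proof -
    have "digit j * q' j \<le> q j" using q_rec[OF j] by simp
    hence "real (digit j * q' j) \<le> Q" unfolding Q_def by (simp only: of_nat_le_iff)
    hence "real (digit j) * real (q' j) / Q \<le> 1" using Q2 by (simp add: divide_le_eq_1)
    thus ?thesis by (simp add: \<beta>_def)
  qed
  have "\<bar>\<Sum>i=1..min H (rev_den j 1). c i * \<psi> i\<bar> \<le> (\<Sum>i=1..min H (rev_den j 1). 40 * Q * \<beta>)"
  proof (rule order_trans[OF sum_abs sum_mono])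
    fix i assume i: "i \<in> {1..min H (rev_den j 1)}"
    hence "0 \<le> c i \<and> c i \<le> Q / real i" using c0 by auto
    hence "\<bar>c i\<bar> * \<bar>\<psi> i\<bar> \<le> Q / real i * (40 * (real i * \<beta>))" using psi2[of i] Q2 by (intro mult_mono) auto
    thus "\<bar>c i * \<psi> i\<bar> \<le> 40 * Q * \<beta>" using i by (simp add: abs_mult)
  qed
  also have "\<dots> \<le> 40 * Q * (real (digit j) * \<beta>)"
    using Q2 by (simp add: \<beta>_def mult_right_mono)
  also have "\<dots> \<le> 40 * Q * 1" using bq Q2 by (intro mult_left_mono) auto
  finally have "\<bar>S\<bar> \<le> 40 * Q + Q * (400 + 10 * \<tau> j)" using main by linarith
  also have "\<dots> = Q * (440 + 10 * \<tau> j)" by (simp add: algebra_simps)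
  finally show "\<bar>S\<bar> \<le> real (q j) * (440 + 10 * \<tau> j)" by (simp add: Q_def)
qed

end

section \<open>Blocks of the product\<close>

lemma sum_inverse_squares: "(\<Sum>i=1..<n. 1 / (real i)\<^sup>2) \<le> 2"
proof -
  have "(\<Sum>i=1..<Suc n. 1 / (real i)\<^sup>2) \<le> 2 - 1 / real n" if "n \<ge> 1" for n
    using that
  proof (induction n rule: dec_induct)
    case (step n)
    have n: "real n \<ge> 1" using step by simp
    have "1 / (real (Suc n))\<^sup>2 \<le> 1 / (real n * real (Suc n))"
      using n by (intro divide_left_mono) (auto simp: power2_eq_square)
    also have "\<dots> = 1 / real n - 1 / real (Suc n)" using n by (simp add: field_simps)
    finally show ?case using step by simp
  qed simp
  note * = this
  show ?thesis
  proof (cases "n \<ge> 2")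
    case True
    then obtain m where m: "n = Suc m" "m \<ge> 1" by (cases n) auto
    have "1 / real m \<ge> 0" by simp
    hence "2 - 1 / real m \<le> 2" by linarith
    thus ?thesis using *[OF m(2)] unfolding m(1) by (rule order_trans[rotated])
  next
    case False
    hence "n = 0 \<or> n = 1" by auto
    thus ?thesis by auto
  qed
qed

lemma sum_inverse_squares_sym: "(\<Sum>i=1..<n. 1 / (real (min i (n - i)))\<^sup>2) \<le> 4"
proof -
  have "(\<Sum>i=1..<n. 1 / (real (min i (n - i)))\<^sup>2) \<le> (\<Sum>i=1..<n. 1 / (real i)\<^sup>2 + 1 / (real (n - i))\<^sup>2)"
    by (intro sum_mono) (auto simp: min_def)
  also have "\<dots> = (\<Sum>i=1..<n. 1 / (real i)\<^sup>2) + (\<Sum>i=1..<n. 1 / (real (n - i))\<^sup>2)"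
    by (rule sum.distrib)
  also have "(\<Sum>i=1..<n. 1 / (real (n - i))\<^sup>2) = (\<Sum>i=1..<n. 1 / (real i)\<^sup>2)"
    by (rule sum.reindex_bij_witness[of _ "\<lambda>i. n - i" "\<lambda>i. n - i"]) auto
  finally show ?thesis using sum_inverse_squares[of n] by linarith
qed

text \<open>Oddness about n/2. It makes a displacement common to all points of a block cost nothing
  to first order.\<close>

lemma sum_cot_zero: "(\<Sum>i=1..<n. cot (pi * (real i / real n))) = 0"
proof -
  have "(\<Sum>i=1..<n. cot (pi * (real i / real n))) = (\<Sum>i=1..<n. cot (pi * (real (n - i) / real n)))"
    by (rule sum.reindex_bij_witness[of _ "\<lambda>i. n - i" "\<lambda>i. n - i"]) auto
  also have "\<dots> = (\<Sum>i=1..<n. - cot (pi * (real i / real n)))"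
  proof (rule sum.cong)
    fix i assume i: "i \<in> {1..<n}"
    have "pi * (real (n - i) / real n) = pi - pi * (real i / real n)"
      using i by (simp add: of_nat_diff field_simps)
    thus "cot (pi * (real (n - i) / real n)) = - cot (pi * (real i / real n))"
      by (simp add: cot_def sin_diff cos_diff)
  qed simp
  finally show ?thesis by (simp add: sum_negf)
qed

lemma abs_cot_le: "\<bar>cot (pi * v)\<bar> \<le> 1 / (2 * m)" if "0 < m" "m \<le> v" "m \<le> 1 - v"
proof -
  have "sin (pi * v) \<ge> 2 * min v (1 - v)" using that by (intro sin_pi_ge_min) auto
  hence s: "sin (pi * v) \<ge> 2 * m" using that by (auto simp: min_def split: if_splits)
  have "\<bar>cot (pi * v)\<bar> = \<bar>cos (pi * v)\<bar> / sin (pi * v)" using s that by (simp add: cot_def)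
  also have "\<dots> \<le> 1 / (2 * m)" using s that by (intro frac_le) auto
  finally show ?thesis .
qed

lemma cot_shift:
  assumes "0 < m" "m \<le> v" "m \<le> 1 - v" "0 < m'" "m' \<le> w" "m' \<le> 1 - w"
  shows "\<bar>cot (pi * v) - cot (pi * w)\<bar> \<le> pi * \<bar>v - w\<bar> / (4 * m * m')"
proof -
  define V W where "V = sin (pi * v)" and "W = sin (pi * w)"
  have "V \<ge> 2 * min v (1 - v)" "W \<ge> 2 * min w (1 - w)" unfolding V_def W_def using assms by (intro sin_pi_ge_min; simp)+
  hence s: "V \<ge> 2 * m" "W \<ge> 2 * m'" using assms by (auto simp: min_def split: if_splits)
  have pos: "V > 0" "W > 0" using s assms by linarith+
  have "cot (pi * v) - cot (pi * w) = sin (pi * w - pi * v) / (W * V)"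
    unfolding V_def W_def using cot_diff[of "pi * w" "pi * v"] pos by (simp add: V_def W_def)
  hence "\<bar>cot (pi * v) - cot (pi * w)\<bar> = \<bar>sin (pi * w - pi * v)\<bar> / (W * V)"
    using pos by simp
  also have "\<dots> \<le> (pi * \<bar>v - w\<bar>) / ((2 * m') * (2 * m))"
  proof (rule frac_le)
    have "\<bar>sin (pi * w - pi * v)\<bar> \<le> \<bar>pi * w - pi * v\<bar>" by (rule abs_sin_x_le_abs_x)
    also have "\<bar>pi * w - pi * v\<bar> = pi * \<bar>v - w\<bar>"
      by (simp add: abs_mult abs_minus_commute flip: right_diff_distrib)
    finally show "\<bar>sin (pi * w - pi * v)\<bar> \<le> pi * \<bar>v - w\<bar>" .
    show "2 * m' * (2 * m) \<le> W * V" using s assms by (intro mult_mono) auto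
  qed (use assms in auto)
  also have "\<dots> = pi * \<bar>v - w\<bar> / (4 * m * m')" by (simp add: mult_ac)
  finally show ?thesis .
qed

lemma ln_2_sin_tangent:
  assumes "0 < w" "w < 1" "0 < v" "v < 1"
  shows "ln \<bar>2 * sin (pi * w)\<bar> \<le> ln \<bar>2 * sin (pi * v)\<bar> + pi * (w - v) * cot (pi * v)"
proof -
  have w: "0 < pi * w" "pi * w < pi" and v: "0 < pi * v" "pi * v < pi" using assms by auto
  have "sin (pi * w) > 0" "sin (pi * v) > 0" using w v sin_gt_zero by blast+
  moreover have "pi * w - pi * v = pi * (w - v)" by (simp add: algebra_simps)
  ultimately show ?thesis using ln_sin_tangent[OF w v] by (simp add: ln_mult abs_mult)
qed

text \<open>In the application $A = a_{j+1}$, $\<beta> = q_{j-1}/q_j$, $\<theta> = \<delta>_{j+1}/\<delta>_j$, the shift $E$ comes from the digits above level $j$,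
  and $t$ lists the window divided by $q_j$.\<close>

locale perturbed_block =
  fixes q :: nat and \<delta> A \<beta> \<theta> b E L :: real and t :: "nat \<Rightarrow> real"
  assumes q: "q \<ge> 1" and \<delta>: "\<delta> > 0" and A: "A \<ge> 1" and \<beta>: "0 \<le> \<beta>" "\<beta> \<le> 1"
    and \<theta>: "0 < \<theta>" "\<theta> \<le> 1" and inv_q: "1 / real q = (A + \<beta> + \<theta>) * \<delta>"
    and b: "b \<ge> 0" and E: "- (5/6) * \<delta> \<le> E" "E \<le> 5/6 * (\<theta> * \<delta>)"
    and t: "\<And>i. i < q \<Longrightarrow> 0 \<le> t i \<and> t i \<le> 2" and t0: "t 0 = 1" and t1: "t (q - 1) \<le> 1 + \<beta>"
    and L: "\<bar>\<Sum>i=1..<q. t i * cot (pi * (real i / real q))\<bar> \<le> real q * L"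
begin

text \<open>The factor of residue i sits at i/q + \<open>x i\<close>. Replacing all
  \<open>x i\<close> by the common value \<open>z\<close> makes the product computable exactly, and
  the offset 1/2 keeps \<open>z\<close> at a distance from both 0 and 1/q for every digit b from 0
  to A - 1.\<close>

definition x :: "nat \<Rightarrow> real" where "x i = (t i + b) * \<delta> + E"
definition z :: real where "z = (b + 1/2) * \<delta>"

lemma q_pos: "real q > 0" using q by simp

lemma q\<delta>: "real q * \<delta> \<le> 1 / A"
proof -
  have "real q * ((A + \<beta> + \<theta>) * \<delta>) = 1" using inv_q q_pos by (simp add: field_simps)
  moreover have "real q * (A * \<delta>) \<le> real q * ((A + \<beta> + \<theta>) * \<delta>)"
    using \<delta> \<beta> \<theta> q by (intro mult_left_mono mult_right_mono) auto
  ultimately have "A * (real q * \<delta>) \<le> 1" by (simp add: mult_ac)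
  thus ?thesis using A by (simp add: field_simps)
qed

lemma \<delta>_le: "A * \<delta> \<le> 1 / real q" "1 / real q \<le> 3 * (A * \<delta>)"
proof -
  show "A * \<delta> \<le> 1 / real q" unfolding inv_q using \<delta> \<beta> \<theta> by (intro mult_right_mono) auto
  have "A + \<beta> + \<theta> \<le> 3 * A" using A \<beta> \<theta> by linarith
  thus "1 / real q \<le> 3 * (A * \<delta>)" unfolding inv_q using \<delta> mult_right_mono[of "A + \<beta> + \<theta>" "3 * A" \<delta>] by simp
qed

lemma E_bound: "\<bar>E\<bar> \<le> 5/6 * \<delta>"
proof -
  have "\<theta> * \<delta> \<le> 1 * \<delta>" using \<theta> \<delta> by (intro mult_right_mono) auto
  thus ?thesis using E by linarith
qed

lemma h_bound: "i < q \<Longrightarrow> \<bar>x i - z\<bar> \<le> 3 * \<delta>"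
proof -
  assume i: "i < q"
  have "x i - z = (t i - 1/2) * \<delta> + E" by (simp add: x_def z_def algebra_simps)
  moreover have "\<bar>t i - 1/2\<bar> \<le> 3/2" using t[OF i] by (simp only: abs_le_iff) linarith
  hence "\<bar>(t i - 1/2) * \<delta>\<bar> \<le> 3/2 * \<delta>" unfolding abs_mult using \<delta> by (intro mult_mono) auto
  ultimately show ?thesis using E_bound \<delta> by linarith
qed

lemma sum_ln_z:
  assumes "b + 1 \<le> A"
  shows "(\<Sum>i<q. ln \<bar>2 * sin (pi * (real i / real q + z))\<bar>) = ln (2 * sin (pi * (real q * z)))"
    and "0 < z" "z < 1 / real q" "(A - b) / 2 * \<delta> \<le> 1 / real q - z"
proof -
  show z0: "0 < z" unfolding z_def using b \<delta> by simp
  have "(A - b) / 2 * \<delta> \<le> (A + \<beta> + \<theta> - b - 1/2) * \<delta>"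
    using assms \<delta> \<beta> \<theta> by (intro mult_right_mono) auto
  thus *: "(A - b) / 2 * \<delta> \<le> 1 / real q - z" unfolding inv_q z_def by (simp add: algebra_simps)
  have "(A - b) / 2 * \<delta> > 0" using assms \<delta> by simp
  with * show z1: "z < 1 / real q" by linarith
  have "0 < real q * z" "real q * z < 1" using z0 z1 q_pos by (auto simp: field_simps)
  hence s: "sin (pi * (real q * z)) > 0" by (intro sin_gt_zero) auto
  have nz: "sin (pi * (real i / real q + z)) \<noteq> 0" if "i < q" for i
  proof -
    have "real i + 1 \<le> real q" using that by simp
    hence "(real i + 1) / real q \<le> 1" using q_pos by simp
    hence "real i / real q + z < 1" using z1 by (simp add: add_divide_distrib)
    moreover have "real i / real q + z > 0" using z0 by (intro add_nonneg_pos) auto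
    ultimately have "sin (pi * (real i / real q + z)) > 0" by (intro sin_gt_zero) auto
    thus ?thesis by simp
  qed
  have "(\<Sum>i<q. ln \<bar>2 * sin (pi * (real i / real q + z))\<bar>) = ln (\<Prod>i<q. \<bar>2 * sin (pi * (real i / real q + z))\<bar>)"
    by (rule ln_prod[symmetric]) (use nz in auto)
  also have "\<dots> = ln \<bar>2 * sin (pi * real q * z)\<bar>" using prod_abs_sin[of q z] q by simp
  also have "\<bar>2 * sin (pi * real q * z)\<bar> = 2 * sin (pi * (real q * z))" using s by (simp add: mult.assoc)
  finally show "(\<Sum>i<q. ln \<bar>2 * sin (pi * (real i / real q + z))\<bar>) = ln (2 * sin (pi * (real q * z)))" .
qed

text \<open>The shift E consumes at most 5/6 of a step \<delta> <= 1/q, so a sixth of the gap to 0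
  survives. For i = 0 this rests on \<open>t 0 = 1\<close>: the index of residue 0 in the window is
  q_j.\<close>

lemma x_pos: "i < q \<Longrightarrow> real i / real q + x i > 0"
  and x_ge: "1 \<le> i \<Longrightarrow> i < q \<Longrightarrow> real i / real q + x i \<ge> real i / (6 * real q)"
proof -
  have d: "\<delta> \<le> 1 / real q" using \<delta>_le(1) mult_right_mono[OF A, of \<delta>] \<delta> by linarith
  have ge: "real i / real q + x i \<ge> real i / (6 * real q)" if "1 \<le> i" "i < q" for i
  proof -
    have "(t i + b) * \<delta> \<ge> 0" using t[of i] b \<delta> that by simp
    hence "x i \<ge> - (5/6) * (1 / real q)" using E d by (simp add: x_def)
    moreover have "1 / real q \<le> real i / real q" using that by (intro divide_right_mono) auto
    moreover have "real i / (6 * real q) = (1/6) * (real i / real q)" by simp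
    ultimately show ?thesis by linarith
  qed
  show "1 \<le> i \<Longrightarrow> i < q \<Longrightarrow> real i / real q + x i \<ge> real i / (6 * real q)" by (rule ge)
  show "real i / real q + x i > 0" if "i < q"
  proof (cases "i = 0")
    case True
    have "b * \<delta> \<ge> 0" using b \<delta> by simp
    hence "(1 + b) * \<delta> + E > 0" using E \<delta> unfolding distrib_right by linarith
    thus ?thesis using True by (simp add: x_def t0)
  next
    case False
    have "real i / (6 * real q) > 0" using False q_pos by simp
    thus ?thesis using ge[of i] that False by linarith
  qed
qed

text \<open>The residue q - 1 is the one closest to 1. There t <= 1 + \<beta>, and this \<beta>
  cancels the one in 1/q = (A + \<beta> + \<theta>) \<delta>; since E <= 5/6 \<theta> \<delta>, a
  positive gap is left even for b = A - 1.\<close>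

lemma x_last: "1 / real q - x (q - 1) \<ge> (A - b - 1 + \<theta> / 6) * \<delta>"
proof -
  have "t (q - 1) * \<delta> \<le> (1 + \<beta>) * \<delta>" using t1 \<delta> by (intro mult_right_mono) auto
  moreover have "1 / real q - x (q - 1) = (A + \<beta> + \<theta>) * \<delta> - t (q-1) * \<delta> - b * \<delta> - E"
    unfolding inv_q x_def by (simp add: algebra_simps)
  ultimately have "1 / real q - x (q - 1) \<ge> (A + \<beta> + \<theta>) * \<delta> - (1 + \<beta>) * \<delta> - b * \<delta> - 5/6 * (\<theta> * \<delta>)"
    using E by linarith
  thus ?thesis by (simp add: algebra_simps)
qed

lemma x_le: "i < q \<Longrightarrow> x i \<le> (b + 2 + 5/6 * \<theta>) * \<delta>"
proof -
  assume "i < q"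
  hence "t i * \<delta> \<le> 2 * \<delta>" using t \<delta> by (intro mult_right_mono) auto
  thus ?thesis using E by (simp add: x_def algebra_simps)
qed

text \<open>By \<open>sum_cot_zero\<close> only the part t i * \<delta> of the displacement
  survives. It gives \<delta> times the sum bounded by q L, and q \<delta> <= 1/A.\<close>

lemma first_order: "\<bar>\<Sum>i=1..<q. pi * (x i - z) * cot (pi * (real i / real q))\<bar> \<le> 4 * L / A"
proof -
  define c where "c i = cot (pi * (real i / real q))" for i :: nat
  define S where "S = (\<Sum>i=1..<q. t i * c i)"
  have "(\<Sum>i=1..<q. pi * (x i - z) * c i) = (\<Sum>i=1..<q. pi * \<delta> * (t i * c i) + pi * (E - \<delta> / 2) * c i)"
    by (rule sum.cong) (auto simp: x_def z_def algebra_simps)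
  also have "\<dots> = pi * \<delta> * S + pi * (E - \<delta> / 2) * (\<Sum>i=1..<q. c i)"
    by (simp add: sum.distrib sum_distrib_left S_def)
  also have "(\<Sum>i=1..<q. c i) = 0" unfolding c_def by (rule sum_cot_zero)
  finally have eq: "(\<Sum>i=1..<q. pi * (x i - z) * c i) = pi * \<delta> * S" by simp
  have L0: "\<bar>S\<bar> \<le> real q * L" unfolding S_def c_def by (rule L)
  hence "L \<ge> 0" using q_pos by (metis abs_ge_zero order_trans zero_le_mult_iff not_less)
  have "\<bar>pi * \<delta> * S\<bar> = pi * (\<delta> * \<bar>S\<bar>)" using \<delta> by (simp add: abs_mult)
  also have "\<dots> \<le> 4 * (\<delta> * (real q * L))" using L0 \<delta> pi_less_4 by (intro mult_mono) auto
  also have "\<dots> = 4 * ((real q * \<delta>) * L)" by (simp add: mult_ac)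
  also have "\<dots> \<le> 4 * (1 / A * L)" using q\<delta> \<open>L \<ge> 0\<close> by (intro mult_left_mono mult_right_mono) auto
  finally show ?thesis using eq by (simp add: c_def)
qed

lemma L_nonneg: "L \<ge> 0"
  using L q_pos by (metis abs_ge_zero order_trans zero_le_mult_iff not_less)

lemma sum_split_0: "(\<Sum>i<q. f i) = f 0 + (\<Sum>i=1..<q. f i)" for f :: "nat \<Rightarrow> real"
  using q by (simp add: lessThan_atLeast0 sum.atLeast_Suc_lessThan)

text \<open>Concavity of $\ln \sin$: the tangents at the unperturbed points give the upper bound, those at the perturbed points the lower bound.\<close>

lemma sum_log_upper:
  assumes bA: "b + 1 \<le> A"
  shows "(\<Sum>i<q. ln \<bar>2 * sin (pi * (real i / real q + x i))\<bar>)
    \<le> ln (2 * sin (pi * (real q * z))) + 100 * (1 / (b + 1) + 1 / (A - b) + (1 + L) / A)"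
proof -
  note z = sum_ln_z[OF bA]
  define v where "v i = real i / real q + z" for i :: nat
  define w where "w i = real i / real q + x i" for i :: nat
  define r where "r i = pi * (x i - z) * cot (pi * v i)" for i :: nat
  define m where "m i = real (min i (q - i))" for i :: nat
  have q1: "1 / real q \<le> 1" using q by simp
  have gap: "1 - real i / real q = real (q - i) / real q" if "i < q" for i
    using that q_pos by (simp add: of_nat_diff diff_divide_distrib)
  have v01: "0 < v i" "v i < 1" if "i < q" for i
  proof -
    show "0 < v i" unfolding v_def using z by (intro add_nonneg_pos) auto
    have "1 / real q \<le> real (q - i) / real q" using that by (intro divide_right_mono) auto
    thus "v i < 1" using gap[OF that] z(3) by (simp add: v_def)
  qed
  have w01: "0 < w i" "w i < 1" if i: "i < q" for i
  proof -
    show "0 < w i" unfolding w_def by (rule x_pos[OF i])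
    show "w i < 1"
    proof (cases "i = q - 1")
      case True
      have "(A - b - 1 + \<theta> / 6) * \<delta> > 0" using bA \<theta> \<delta> by (intro mult_pos_pos) auto
      hence "1 / real q - x i > 0" using x_last True by simp
      moreover have "q - i = 1" using True q by simp
      ultimately show ?thesis using gap[OF i] by (simp add: w_def)
    next
      case False
      hence "2 / real q \<le> real (q - i) / real q" using i by (intro divide_right_mono) auto
      moreover have "x i < 2 / real q"
      proof -
        have "b + 2 + 5/6 * \<theta> < 2 * (A + \<beta> + \<theta>)" unfolding distrib_left using bA A \<beta> \<theta> by linarith
        hence "(b + 2 + 5/6 * \<theta>) * \<delta> < 2 * (A + \<beta> + \<theta>) * \<delta>" using \<delta> by simp
        also have "\<dots> = 2 * (1 / real q)" unfolding inv_q by (simp only: mult.assoc)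
        finally have "(b + 2 + 5/6 * \<theta>) * \<delta> < 2 / real q" by simp
        with x_le[OF i] show ?thesis by (rule order.strict_trans1)
      qed
      ultimately show ?thesis using gap[OF i] by (simp add: w_def)
    qed
  qed
  have tan: "ln \<bar>2 * sin (pi * w i)\<bar> \<le> ln \<bar>2 * sin (pi * v i)\<bar> + r i" if "i < q" for i
    using ln_2_sin_tangent[OF w01[OF that] v01[OF that]] by (simp add: r_def w_def v_def)
  have "(\<Sum>i<q. ln \<bar>2 * sin (pi * w i)\<bar>) \<le> (\<Sum>i<q. ln \<bar>2 * sin (pi * v i)\<bar> + r i)"
    by (rule sum_mono) (use tan in auto)
  also have "\<dots> = ln (2 * sin (pi * (real q * z))) + (\<Sum>i<q. r i)"
    using z(1) by (simp add: sum.distrib v_def)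
  \<comment> \<open>Residue 0 is split off because the comparison point i/q is then a pole of
    cot.\<close>
  also have "(\<Sum>i<q. r i) = r 0 + (\<Sum>i=1..<q. r i)" by (rule sum_split_0)
  also have "(\<Sum>i=1..<q. r i) = (\<Sum>i=1..<q. pi * (x i - z) * (cot (pi * v i) - cot (pi * (real i / real q))))
      + (\<Sum>i=1..<q. pi * (x i - z) * cot (pi * (real i / real q)))"
    by (simp add: r_def sum.distrib[symmetric] algebra_simps)
  finally have main: "(\<Sum>i<q. ln \<bar>2 * sin (pi * w i)\<bar>) \<le> ln (2 * sin (pi * (real q * z))) + (r 0 + (
     (\<Sum>i=1..<q. pi * (x i - z) * (cot (pi * v i) - cot (pi * (real i / real q))))
      + (\<Sum>i=1..<q. pi * (x i - z) * cot (pi * (real i / real q)))))" .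
  have h: "\<bar>pi * (x i - z)\<bar> \<le> 12 * \<delta>" if "i < q" for i
  proof -
    have "pi * \<bar>x i - z\<bar> \<le> 4 * (3 * \<delta>)" using h_bound[OF that] pi_less_4 by (intro mult_mono) auto
    thus ?thesis by (simp add: abs_mult)
  qed
  have Ab: "A - b > 0" "b + 1 > 0" using bA b by auto
  have r0: "\<bar>r 0\<bar> \<le> 12 * (1 / (b + 1) + 1 / (A - b))"
  proof -
    define m where "m = min ((b + 1) / 2 * \<delta>) ((A - b) / 2 * \<delta>)"
    have m: "m > 0" unfolding m_def using Ab \<delta> by simp
    have "(b + 1) / 2 * \<delta> \<le> z" unfolding z_def using b \<delta> by (intro mult_right_mono) auto
    hence "\<bar>cot (pi * v 0)\<bar> \<le> 1 / (2 * m)"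
      using m z(4) q1 by (intro abs_cot_le) (auto simp: v_def m_def min_def)
    also have "\<dots> \<le> 1 / ((b + 1) * \<delta>) + 1 / ((A - b) * \<delta>)"
      using Ab \<delta> by (auto simp: m_def min_def)
    finally have c: "\<bar>cot (pi * v 0)\<bar> \<le> 1 / ((b + 1) * \<delta>) + 1 / ((A - b) * \<delta>)" .
    have "\<bar>r 0\<bar> \<le> 12 * \<delta> * (1 / ((b + 1) * \<delta>) + 1 / ((A - b) * \<delta>))"
      unfolding r_def abs_mult[of "pi * (x 0 - z)"] using h[of 0] c q \<delta> by (intro mult_mono) auto
    also have "\<dots> = 12 * (1 / (b + 1) + 1 / (A - b))" using \<delta> Ab by (simp add: distrib_left)
    finally show ?thesis .
  qed
  \<comment> \<open>For the last residue \<open>v\<close> may come as close to 1 as (A - b)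
    \<delta>/2, far closer than i/q; this needs an error term of its own.\<close>
  define e where "e i = (if i = q - 1 then 24 / (A - b) else 0)" for i
  have z1: "pi * \<bar>z\<bar> \<le> 4 * (1 / real q)" using z pi_less_4 by (intro mult_mono) auto
  have mid: "\<bar>pi * (x i - z) * (cot (pi * v i) - cot (pi * (real i / real q)))\<bar> \<le> 24 * (real q * \<delta>) * (1 / (m i)\<^sup>2) + e i"
    if i: "i \<in> {1..<q}" for i
  proof -
    have mi: "m i \<ge> 1" "m i \<le> real i" "m i \<le> real (q - i)" using i by (auto simp: m_def)
    have vd: "v i - real i / real q = z" by (simp add: v_def)
    have mq: "m i / real q > 0" "m i / real q \<le> real i / real q" "m i / real q \<le> 1 - real i / real q"
      using mi gap[of i] i q_pos by (auto intro!: divide_right_mono)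
    show ?thesis
    proof (cases "i = q - 1")
      case False
      have "real (q - i) \<ge> 2" using False i by auto
      hence "1 / real q \<le> real (q - i) / real q / 2" using q_pos by (simp add: field_simps)
      hence "m i / (2 * real q) \<le> 1 - v i" using z(3) gap[of i] i divide_right_mono[OF mi(3), of "2 * real q"] by (simp add: v_def)
      moreover have "m i / (2 * real q) \<le> v i"
        using mq(2) z(2) mq(1) by (simp add: v_def)
      ultimately have "\<bar>cot (pi * v i) - cot (pi * (real i / real q))\<bar> \<le> pi * \<bar>v i - real i / real q\<bar> / (4 * (m i / (2 * real q)) * (m i / real q))"
        using mi(1) q_pos mq by (intro cot_shift) auto
      also have "\<dots> \<le> (4 * (1 / real q)) / (4 * (m i / (2 * real q)) * (m i / real q))"
        unfolding vd using z1 mi(1) by (intro divide_right_mono) auto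
      also have "\<dots> = 2 * real q * (1 / (m i)\<^sup>2)" using q_pos mi(1) by (simp add: field_simps power2_eq_square)
      finally have "\<bar>pi * (x i - z)\<bar> * \<bar>cot (pi * v i) - cot (pi * (real i / real q))\<bar> \<le> 12 * \<delta> * (2 * real q * (1 / (m i)\<^sup>2))"
        using h[of i] i \<delta> by (intro mult_mono) auto
      moreover have "e i = 0" using False by (simp add: e_def)
      ultimately show ?thesis by (simp add: abs_mult mult_ac)
    next
      case True
      hence qi: "q - i = 1" using q by simp
      have g: "1 - v i = 1 / real q - z" using gap[of i] i qi by (simp add: v_def)
      have "real i / real q \<ge> 1 / real q" using i by (intro divide_right_mono) auto
      moreover have "(A - b) / 2 * \<delta> \<le> 1 / real q" using z(2,4) by linarith
      ultimately have "(A - b) / 2 * \<delta> \<le> v i" using z(2) unfolding v_def by linarith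
      hence "\<bar>cot (pi * v i) - cot (pi * (real i / real q))\<bar> \<le> pi * \<bar>v i - real i / real q\<bar> / (4 * ((A - b) / 2 * \<delta>) * (m i / real q))"
        using g z(4) Ab \<delta> mq by (intro cot_shift) auto
      also have "\<dots> \<le> (4 * (1 / real q)) / (4 * ((A - b) / 2 * \<delta>) * (m i / real q))"
        unfolding vd using z1 mi(1) Ab \<delta> by (intro divide_right_mono) auto
      also have "\<dots> = (2 / ((A - b) * \<delta>)) / m i" using q_pos mi(1) Ab \<delta> by (simp add: field_simps)
      also have "\<dots> \<le> (2 / ((A - b) * \<delta>)) / 1" using mi(1) Ab \<delta> by (intro divide_left_mono) auto
      finally have "\<bar>pi * (x i - z)\<bar> * \<bar>cot (pi * v i) - cot (pi * (real i / real q))\<bar> \<le> 12 * \<delta> * (2 / ((A - b) * \<delta>))"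
        using h[of i] i \<delta> by (intro mult_mono) auto
      also have "\<dots> = e i" using True \<delta> by (simp add: e_def)
      also have "\<dots> \<le> 24 * (real q * \<delta>) * (1 / (m i)\<^sup>2) + e i" using \<delta> by simp
      finally show ?thesis by (simp add: abs_mult)
    qed
  qed
  have "\<bar>\<Sum>i=1..<q. pi * (x i - z) * (cot (pi * v i) - cot (pi * (real i / real q)))\<bar>
     \<le> (\<Sum>i=1..<q. 24 * (real q * \<delta>) * (1 / (m i)\<^sup>2) + e i)"
    by (rule order_trans[OF sum_abs sum_mono]) (rule mid)
  also have "\<dots> = 24 * (real q * \<delta>) * (\<Sum>i=1..<q. 1 / (m i)\<^sup>2) + (\<Sum>i=1..<q. e i)"
    by (simp only: sum.distrib sum_distrib_left)
  also have "(\<Sum>i=1..<q. e i) \<le> 24 / (A - b)"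
  proof -
    have "(\<Sum>i=1..<q. e i) \<le> (\<Sum>i<q. e i)" using Ab by (intro sum_mono2) (auto simp: e_def)
    also have "\<dots> = 24 / (A - b)" unfolding e_def using q by simp
    finally show ?thesis .
  qed
  also have "24 * (real q * \<delta>) * (\<Sum>i=1..<q. 1 / (m i)\<^sup>2) \<le> 24 * (1 / A) * 4"
    unfolding m_def using q\<delta> A \<delta> sum_inverse_squares_sym[of q] by (intro mult_mono sum_nonneg) auto
  finally have M: "\<bar>\<Sum>i=1..<q. pi * (x i - z) * (cot (pi * v i) - cot (pi * (real i / real q)))\<bar>
     \<le> 96 / A + 24 / (A - b)" by simp
  have "ln (2 * sin (pi * (real q * z))) + (12 * (1 / (b + 1) + 1 / (A - b)) + (96 / A + 24 / (A - b) + 4 * L / A))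
     \<le> ln (2 * sin (pi * (real q * z))) + 100 * (1 / (b + 1) + 1 / (A - b) + (1 + L) / A)"
  proof -
    have "1 / (b + 1) \<ge> 0" "1 / (A - b) \<ge> 0" "L / A \<ge> 0" "1 / A \<ge> 0" using Ab A L_nonneg by auto
    moreover have "24 / (A - b) = 24 * (1 / (A - b))" "96 / A = 96 * (1 / A)" "4 * L / A = 4 * (L / A)" "(1 + L) / A = 1 / A + L / A"
      by (auto simp: add_divide_distrib)
    ultimately show ?thesis unfolding distrib_left by linarith
  qed
  thus ?thesis using main r0 M first_order unfolding w_def by linarith
qed

text \<open>The cotangents are now taken at the perturbed points, which must keep a distance from 1
  comparable to that of i/q. The restriction to 11/12 A ensures this and still leaves room for
  digits up to 5/6 A + A/20.\<close>

lemma sum_log_lower: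
  assumes bA: "b + 1 \<le> 11/12 * A"
  shows "(\<Sum>i<q. ln \<bar>2 * sin (pi * (real i / real q + x i))\<bar>)
    \<ge> ln (2 * sin (pi * (real q * z))) - 6000 * (1 / (b + 1) + (1 + L) / A)"
proof -
  have bA': "b + 1 \<le> A" using bA A by linarith
  have A1: "A \<ge> 12/11" using bA b by linarith
  note z = sum_ln_z[OF bA']
  define v where "v i = real i / real q + z" for i :: nat
  define w where "w i = real i / real q + x i" for i :: nat
  define r where "r i = pi * (x i - z) * cot (pi * w i)" for i :: nat
  define m where "m i = real (min i (q - i))" for i :: nat
  have q1: "1 / real q \<le> 1" using q by simp
  have gap: "1 - real i / real q = real (q - i) / real q" if "i < q" for i
    using that q_pos by (simp add: of_nat_diff diff_divide_distrib)
  have v01: "0 < v i" "v i < 1" if "i < q" for i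
  proof -
    show "0 < v i" unfolding v_def using z by (intro add_nonneg_pos) auto
    have "1 / real q \<le> real (q - i) / real q" using that by (intro divide_right_mono) auto
    thus "v i < 1" using gap[OF that] z(3) by (simp add: v_def)
  qed
  \<comment> \<open>36 = 12 * 3: at the last residue the gap is at least A \<delta>/12, and 1/q <= 3
    A \<delta>.\<close>
  have w_up: "1 - w i \<ge> real (q - i) / (36 * real q)" if i: "i < q" for i
  proof (cases "i = q - 1")
    case True
    have qi: "q - i = 1" using True q by simp
    have "A / 12 * \<delta> \<le> (A - b - 1 + \<theta> / 6) * \<delta>" using bA \<theta> \<delta> by (intro mult_right_mono) auto
    hence "1 / real q - x i \<ge> A / 12 * \<delta>" using x_last True by simp
    hence "1 / real q - x i \<ge> 1 / real q / 36" using \<delta>_le(2) by simp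
    thus ?thesis using gap[OF i] qi by (simp add: w_def)
  next
    case False
    define k where "k = real (q - i)"
    have k: "k \<ge> 2" using False i by (auto simp: k_def)
    have "b + 2 + 5/6 * \<theta> \<le> 35/36 * 2 * (A + \<beta> + \<theta>)" unfolding distrib_left using bA A1 \<beta> \<theta> by linarith
    also have "\<dots> \<le> 35/36 * k * (A + \<beta> + \<theta>)" using k A \<beta> \<theta> by (intro mult_right_mono) auto
    finally have "(b + 2 + 5/6 * \<theta>) * \<delta> \<le> 35/36 * k * (A + \<beta> + \<theta>) * \<delta>" using \<delta> by (intro mult_right_mono) auto
    also have "\<dots> = 35/36 * (k * (1 / real q))" unfolding inv_q by (simp only: mult.assoc)
    finally have "(b + 2 + 5/6 * \<theta>) * \<delta> \<le> 35/36 * (k / real q)" by simp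
    with x_le[OF i] have "x i \<le> 35/36 * (k / real q)" by (rule order_trans)
    moreover have "1 - w i = k / real q - x i" using gap[OF i] by (simp add: w_def k_def)
    ultimately show ?thesis unfolding k_def[symmetric] by simp
  qed
  have w01: "0 < w i" "w i < 1" if i: "i < q" for i
  proof -
    show "0 < w i" unfolding w_def by (rule x_pos[OF i])
    have "real (q - i) / (36 * real q) > 0" using i q_pos by simp
    thus "w i < 1" using w_up[OF i] by linarith
  qed
  have tan: "ln \<bar>2 * sin (pi * v i)\<bar> + r i \<le> ln \<bar>2 * sin (pi * w i)\<bar>" if "i < q" for i
    using ln_2_sin_tangent[OF v01[OF that] w01[OF that]] by (simp add: r_def w_def v_def algebra_simps)
  have "(\<Sum>i<q. ln \<bar>2 * sin (pi * v i)\<bar> + r i) \<le> (\<Sum>i<q. ln \<bar>2 * sin (pi * w i)\<bar>)"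
    by (rule sum_mono) (use tan in auto)
  moreover have "(\<Sum>i<q. ln \<bar>2 * sin (pi * v i)\<bar> + r i) = ln (2 * sin (pi * (real q * z))) + (\<Sum>i<q. r i)"
    using z(1) by (simp add: sum.distrib v_def)
  moreover have "(\<Sum>i<q. r i) = r 0 + (\<Sum>i=1..<q. r i)" by (rule sum_split_0)
  moreover have "(\<Sum>i=1..<q. r i) = (\<Sum>i=1..<q. pi * (x i - z) * (cot (pi * w i) - cot (pi * (real i / real q))))
      + (\<Sum>i=1..<q. pi * (x i - z) * cot (pi * (real i / real q)))"
    by (simp add: r_def sum.distrib[symmetric] algebra_simps)
  ultimately have main: "(\<Sum>i<q. ln \<bar>2 * sin (pi * w i)\<bar>) \<ge> ln (2 * sin (pi * (real q * z))) + (r 0 + (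
     (\<Sum>i=1..<q. pi * (x i - z) * (cot (pi * w i) - cot (pi * (real i / real q))))
      + (\<Sum>i=1..<q. pi * (x i - z) * cot (pi * (real i / real q)))))" by linarith
  have h: "\<bar>pi * (x i - z)\<bar> \<le> 12 * \<delta>" if "i < q" for i
  proof -
    have "pi * \<bar>x i - z\<bar> \<le> 4 * (3 * \<delta>)" using h_bound[OF that] pi_less_4 by (intro mult_mono) auto
    thus ?thesis by (simp add: abs_mult)
  qed
  have r0: "\<bar>r 0\<bar> \<le> 72 / (b + 1)"
  proof -
    have x0: "x 0 = (1 + b) * \<delta> + E" by (simp add: x_def t0)
    have lo: "(b + 1) / 12 * \<delta> \<le> x 0"
    proof -
      have "(b + 1) / 12 * \<delta> \<le> (1 + b - 5/6) * \<delta>" using b \<delta> by (intro mult_right_mono) auto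
      thus ?thesis using E(1) unfolding x0 by (simp add: algebra_simps)
    qed
    have hi: "(b + 1) / 12 * \<delta> \<le> 1 - x 0"
    proof -
      have "(b + 1) / 12 * \<delta> \<le> (A + \<beta> + \<theta> - 1 - b - 5/6 * \<theta>) * \<delta>"
        using b bA A1 \<beta> \<theta> \<delta> by (intro mult_right_mono) auto
      also have "\<dots> \<le> 1 / real q - x 0" using E(2) unfolding inv_q x0 by (simp add: algebra_simps)
      finally show ?thesis using q1 by linarith
    qed
    have "\<bar>cot (pi * w 0)\<bar> \<le> 1 / (2 * ((b + 1) / 12 * \<delta>))"
      using lo hi b \<delta> by (intro abs_cot_le) (auto simp: w_def)
    hence "\<bar>r 0\<bar> \<le> 12 * \<delta> * (1 / (2 * ((b + 1) / 12 * \<delta>)))"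
      unfolding r_def abs_mult[of "pi * (x 0 - z)"] using h[of 0] q \<delta> by (intro mult_mono) auto
    also have "\<dots> = 72 / (b + 1)"
    proof -
      have "12 * d * (1 / (2 * (c / 12 * d))) = 72 / c" if "d > 0" "c > 0" for c d :: real
        using that by (simp add: field_simps)
      thus ?thesis using \<delta> b by simp
    qed
    finally show ?thesis .
  qed
  have xb: "pi * \<bar>x i\<bar> \<le> 4 * (3 / real q)" if i: "i < q" for i
  proof -
    have "b + 2 + 5/6 * \<theta> \<le> 3 * A" using bA A1 \<theta> by linarith
    hence "(b + 2 + 5/6 * \<theta>) * \<delta> \<le> 3 * A * \<delta>" using \<delta> by (intro mult_right_mono) auto
    with x_le[OF i] have "x i \<le> 3 * A * \<delta>" by (rule order_trans)
    also have "3 * A * \<delta> = 3 * (A * \<delta>)" by simp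
    also have "\<dots> \<le> 3 * (1 / real q)" using \<delta>_le(1) by (intro mult_left_mono) auto
    finally have 1: "x i \<le> 3 / real q" by simp
    have "\<delta> \<le> 1 / real q" using \<delta>_le(1) mult_right_mono[OF A, of \<delta>] \<delta> by linarith
    moreover have "(t i + b) * \<delta> \<ge> 0" using t[OF i] b \<delta> by simp
    ultimately have 2: "- x i \<le> 3 / real q" using E(1) \<delta> unfolding x_def by simp
    have "\<bar>x i\<bar> \<le> 3 / real q" using 1 2 by (simp only: abs_le_iff)
    thus ?thesis using pi_less_4 by (intro mult_mono) auto
  qed
  have mid: "\<bar>pi * (x i - z) * (cot (pi * w i) - cot (pi * (real i / real q)))\<bar> \<le> 1296 * (real q * \<delta>) * (1 / (m i)\<^sup>2)"
    if i: "i \<in> {1..<q}" for i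
  proof -
    have mi: "m i \<ge> 1" "m i \<le> real i" "m i \<le> real (q - i)" using i by (auto simp: m_def)
    have vd: "w i - real i / real q = x i" by (simp add: w_def)
    have mq: "m i / real q > 0" "m i / real q \<le> real i / real q" "m i / real q \<le> 1 - real i / real q"
      using mi gap[of i] i q_pos by (auto intro!: divide_right_mono)
    have "m i / (36 * real q) \<le> real i / (6 * real q)" using mi by (intro frac_le) (use q_pos in auto)
    hence 1: "m i / (36 * real q) \<le> w i" using x_ge[of i] i by (simp add: w_def)
    have "m i / (36 * real q) \<le> real (q - i) / (36 * real q)" using mi by (intro divide_right_mono) auto
    hence 2: "m i / (36 * real q) \<le> 1 - w i" using w_up[of i] i by simp
    have "\<bar>cot (pi * w i) - cot (pi * (real i / real q))\<bar> \<le> pi * \<bar>w i - real i / real q\<bar> / (4 * (m i / (36 * real q)) * (m i / real q))"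
      using 1 2 mi(1) q_pos mq by (intro cot_shift) auto
    also have "\<dots> \<le> (4 * (3 / real q)) / (4 * (m i / (36 * real q)) * (m i / real q))"
      unfolding vd using xb[of i] i mi(1) by (intro divide_right_mono) auto
    also have "\<dots> = 108 * real q * (1 / (m i)\<^sup>2)" using q_pos mi(1) by (simp add: field_simps power2_eq_square)
    finally have "\<bar>pi * (x i - z)\<bar> * \<bar>cot (pi * w i) - cot (pi * (real i / real q))\<bar> \<le> 12 * \<delta> * (108 * real q * (1 / (m i)\<^sup>2))"
      using h[of i] i \<delta> by (intro mult_mono) auto
    thus ?thesis by (simp add: abs_mult mult_ac)
  qed
  have "\<bar>\<Sum>i=1..<q. pi * (x i - z) * (cot (pi * w i) - cot (pi * (real i / real q)))\<bar>
     \<le> (\<Sum>i=1..<q. 1296 * (real q * \<delta>) * (1 / (m i)\<^sup>2))"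
    by (rule order_trans[OF sum_abs sum_mono]) (rule mid)
  also have "\<dots> = 1296 * (real q * \<delta>) * (\<Sum>i=1..<q. 1 / (m i)\<^sup>2)"
    by (simp only: sum_distrib_left)
  also have "\<dots> \<le> 1296 * (1 / A) * 4"
    unfolding m_def using q\<delta> A \<delta> sum_inverse_squares_sym[of q] by (intro mult_mono sum_nonneg) auto
  finally have M: "\<bar>\<Sum>i=1..<q. pi * (x i - z) * (cot (pi * w i) - cot (pi * (real i / real q)))\<bar>
     \<le> 5184 / A" by simp
  have "72 / (b + 1) + (5184 / A + 4 * L / A) \<le> 6000 * (1 / (b + 1) + (1 + L) / A)"
  proof -
    have "1 / (b + 1) \<ge> 0" "L / A \<ge> 0" "1 / A \<ge> 0" using b A L_nonneg by auto
    moreover have "72 / (b + 1) = 72 * (1 / (b + 1))" "5184 / A = 5184 * (1 / A)" "4 * L / A = 4 * (L / A)" "(1 + L) / A = 1 / A + L / A"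
      by (auto simp: add_divide_distrib)
    ultimately show ?thesis unfolding distrib_left by linarith
  qed
  thus ?thesis using main r0 M first_order unfolding w_def by linarith
qed

end

definition \<phi> :: "real \<Rightarrow> real" where "\<phi> x = ln (2 * sin (pi * x))"

lemma abs_sin_pi_add_int: "\<bar>sin (pi * (x + of_int k))\<bar> = \<bar>sin (pi * x)\<bar>"
proof -
  have "sin (pi * (x + of_int k)) = sin (pi * x) * cos (pi * of_int k) + cos (pi * x) * sin (pi * of_int k)"
    by (simp add: distrib_left sin_add)
  moreover have "sin (pi * of_int k) = 0" by (metis mult.commute sin_npi_int)
  moreover have "\<bar>cos (pi * of_int k)\<bar> = 1" 
    using calculation(2) sin_cos_squared_add[of "pi * of_int k"] by (simp add: abs_square_eq_1)
  ultimately show ?thesis by (simp add: abs_mult)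
qed

context irrational begin

text \<open>Logarithm of the q_j factors following M when the rotation is displaced by y. The sign
  (-1)^j orients y along q_j \<alpha> - p_j, so that b earlier steps of level j appear as + b
  \<delta>_j.\<close>

definition block_log :: "nat \<Rightarrow> nat \<Rightarrow> real \<Rightarrow> real" where
  "block_log j M y = (\<Sum>n=M+1..M+q j. ln \<bar>2 * sin (pi * (real n * \<alpha> + (-1)^j * y))\<bar>)"

text \<open>The range of M in the second bound of \<open>cot_sum_bound\<close>. Level 0 always
  belongs to it: there q_0 = 1 and the cotangent sum is empty.\<close>

definition bulk :: "nat \<Rightarrow> nat \<Rightarrow> bool" where
  "bulk j M \<longleftrightarrow> j = 0 \<or> real (q j) / 2 \<le> real M \<and> real M + 1 \<le> 19/20 * real (q j)"

text \<open>441 exceeds the constants 401 and 440 of the two cases. \<open>max 1\<close> keeps the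
  logarithm nonnegative at \<open>digit 0\<close>, the only digit that can be zero.\<close>

definition cot_const :: "nat \<Rightarrow> nat \<Rightarrow> real" where
  "cot_const j M = 441 + 10 * \<tau> j + (if bulk j M then 0 else ln (max 1 (real (digit j))))"

lemma \<tau>_nonneg: "\<tau> j \<ge> 0"
  unfolding \<tau>_def
proof (intro sum_nonneg divide_nonneg_nonneg ln_ge_zero)
  fix l assume "l \<in> {1..<j}"
  thus "real (rev_den j (l + 1)) / real (rev_den j l) \<ge> 1" using rev_den_mono[of l j] rev_den_ge_1[of l j] by simp
qed auto

lemma cot_const_nonneg: "cot_const j M \<ge> 0"
proof -
  have "ln (max 1 (real (digit j))) \<ge> 0" by simp
  thus ?thesis unfolding cot_const_def using \<tau>_nonneg[of j] by auto
qed

lemma int_rep: "int (rep j M i) = int M + 1 + (- int i * int (q' j) - int M - 1) mod int (q j)"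
  using q_ge_1[of j] by (simp add: rep_def)

lemma rep_range: "rep j M i \<in> {M+1..M+q j}"
proof -
  have "0 \<le> (- int i * int (q' j) - int M - 1) mod int (q j)" "(- int i * int (q' j) - int M - 1) mod int (q j) < int (q j)"
    using q_ge_1[of j] by auto
  thus ?thesis using int_rep[of j M i] by auto
qed

lemma rep_cong: "\<exists>t. int (rep j M i) = - int i * int (q' j) + int (q j) * t"
proof -
  define z where "z = - int i * int (q' j) - int M - 1"
  have "z mod int (q j) = z - int (q j) * (z div int (q j))" by (simp add: minus_mult_div_eq_mod)
  hence "int (rep j M i) = - int i * int (q' j) + int (q j) * (- (z div int (q j)))"
    unfolding int_rep z_def[symmetric] by (simp add: z_def)
  thus ?thesis by blast
qed

lemma coprime_q_q': "coprime (int (q' j)) (int (q j))"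
proof (rule coprimeI)
  fix c assume c: "c dvd int (q' j)" "c dvd int (q j)"
  obtain r where "p j * int (q' j) = - ((-1) ^ j) + r * int (q j)" using p_q' by blast
  hence "(-1) ^ j = r * int (q j) - p j * int (q' j)" by simp
  hence "c dvd (-1) ^ j" using c by simp
  thus "is_unit c" by (cases "even j") auto
qed

lemma rep_bij: "bij_betw (rep j M) {..<q j} {M+1..M+q j}"
proof -
  have "inj_on (rep j M) {..<q j}"
  proof (rule inj_onI)
    fix i i' assume ii: "i \<in> {..<q j}" "i' \<in> {..<q j}" "rep j M i = rep j M i'"
    hence "(- int i * int (q' j) - int M - 1) mod int (q j) = (- int i' * int (q' j) - int M - 1) mod int (q j)"
      using int_rep[of j M i] int_rep[of j M i'] by simp
    hence "int (q j) dvd (- int i * int (q' j) - int M - 1) - (- int i' * int (q' j) - int M - 1)"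
      by (simp only: mod_eq_dvd_iff)
    hence "int (q j) dvd (int i' - int i) * int (q' j)" by (simp add: algebra_simps)
    hence "int (q j) dvd int i' - int i" using coprime_q_q'[of j]
      by (metis coprime_commute coprime_dvd_mult_left_iff)
    moreover have "\<bar>int i' - int i\<bar> < int (q j)" using ii by auto
    ultimately show "i = i'" by (metis abs_of_nat dvd_imp_le_int eq_iff_diff_eq_0 linorder_not_less of_nat_eq_iff)
  qed
  moreover from card_image[OF this] have "rep j M ` {..<q j} = {M+1..M+q j}"
    using rep_range by (intro card_subset_eq) auto
  ultimately show ?thesis by (simp add: bij_betw_def)
qed

lemma rep_0: "M < q j \<Longrightarrow> rep j M 0 = q j"
proof -
  assume M: "M < q j"
  have "(- int M - 1) mod int (q j) = (- int M - 1 + int (q j)) mod int (q j)" by simp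
  also have "\<dots> = - int M - 1 + int (q j)" using M by (intro mod_pos_pos_trivial) auto
  finally have "int (rep j M 0) = int (q j)" unfolding int_rep by simp
  thus ?thesis by simp
qed

text \<open>Modulo q_j this representative is congruent to q_(j-1). Exceeding q_j + q_(j-1) would
  force it to be at least 2 q_j, beyond the end M + q_j of the window.\<close>

lemma rep_last: "M < q j \<Longrightarrow> rep j M (q j - 1) \<le> q j + q' j"
proof (rule ccontr)
  assume M: "M < q j" and "\<not> rep j M (q j - 1) \<le> q j + q' j"
  hence gt: "int (rep j M (q j - 1)) > int (q j) + int (q' j)" by simp
  obtain t where t: "int (rep j M (q j - 1)) = - int (q j - 1) * int (q' j) + int (q j) * t" using rep_cong by blast
  have "int (q j - 1) = int (q j) - 1" using q_ge_1[of j] by simp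
  hence "int (rep j M (q j - 1)) = int (q' j) + int (q j) * (t - int (q' j))" unfolding t by (simp add: algebra_simps)
  moreover from this gt have "int (q j) * 1 < int (q j) * (t - int (q' j))" by simp
  hence "t - int (q' j) \<ge> 2" using q_ge_1[of j] by (simp add: mult_less_cancel_left)
  hence "int (q j) * 2 \<le> int (q j) * (t - int (q' j))" by (intro mult_left_mono) auto
  ultimately have "int (rep j M (q j - 1)) \<ge> 2 * int (q j)" by simp
  moreover have "rep j M (q j - 1) \<le> M + q j" using rep_range[of j M "q j - 1"] by simp
  ultimately show False using M by simp
qed

text \<open>Since \<alpha> = (p_j + (-1)^j \<delta>_j)/q_j, the point n \<alpha> is n p_j/q_j plus a
  drift (-1)^j n \<delta>_j/q_j, and for n = \<open>rep j M i\<close> the number n p_j is congruent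
  to (-1)^j i. The common sign disappears inside |sin|.\<close>

lemma block_log_reindex: "block_log j M y = (\<Sum>i<q j. ln \<bar>2 * sin (pi * (real i / real (q j) + (real (rep j M i) / real (q j) * \<delta> j + y)))\<bar>)"
proof -
  have "block_log j M y = (\<Sum>i<q j. ln \<bar>2 * sin (pi * (real (rep j M i) * \<alpha> + (-1)^j * y))\<bar>)"
    unfolding block_log_def by (rule sum.reindex_bij_betw[OF rep_bij, symmetric])
  also have "\<dots> = (\<Sum>i<q j. ln \<bar>2 * sin (pi * (real i / real (q j) + (real (rep j M i) / real (q j) * \<delta> j + y)))\<bar>)"
  proof (rule sum.cong)
    fix i
    define n s Q where "n = rep j M i" and "s = (-1 :: real) ^ j" and "Q = real (q j)"
    have Q: "Q > 0" using q_ge_1[of j] by (simp add: Q_def)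
    have ss: "s * s = 1" unfolding s_def by (simp flip: power_mult_distrib)
    obtain t where t: "int n = - int i * int (q' j) + int (q j) * t" using rep_cong n_def by blast
    obtain r where r: "p j * int (q' j) = - ((-1) ^ j) + r * int (q j)" using p_q' by blast
    have "int n * p j = - int i * (p j * int (q' j)) + int (q j) * (t * p j)" unfolding t by (simp add: algebra_simps)
    also have "\<dots> = int i * (-1)^j + int (q j) * (t * p j - int i * r)" unfolding r by (simp add: algebra_simps)
    finally have "real_of_int (int n * p j) = real_of_int (int i * (-1)^j + int (q j) * (t * p j - int i * r))" by simp
    hence np: "real n * of_int (p j) = real i * s + Q * of_int (t * p j - int i * r)" by (simp add: s_def Q_def)
    have "s * \<delta> j = Q * \<alpha> - of_int (p j)" unfolding \<delta>_def s_def[symmetric] Q_def[symmetric] using ss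
      by (simp add: mult.assoc[symmetric])
    hence "\<alpha> = (of_int (p j) + s * \<delta> j) / Q" using Q by (simp add: field_simps)
    hence "real n * \<alpha> = real n * ((of_int (p j) + s * \<delta> j) / Q)" by (rule arg_cong)
    also have "\<dots> = (real n * of_int (p j)) / Q + s * (real n / Q * \<delta> j)"
      by (simp add: add_divide_distrib ring_distribs)
    also have "(real n * of_int (p j)) / Q = s * (real i / Q) + of_int (t * p j - int i * r)" unfolding np using Q by (simp add: add_divide_distrib)
    finally have "real n * \<alpha> + s * y = s * (real i / Q + (real n / Q * \<delta> j + y)) + of_int (t * p j - int i * r)"
      by (simp add: algebra_simps)
    hence "\<bar>sin (pi * (real n * \<alpha> + s * y))\<bar> = \<bar>sin (pi * (s * (real i / Q + (real n / Q * \<delta> j + y))))\<bar>"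
      by (simp only: abs_sin_pi_add_int)
    also have "\<dots> = \<bar>sin (pi * (real i / Q + (real n / Q * \<delta> j + y)))\<bar>"
    proof -
      have "s = 1 \<or> s = -1" unfolding s_def by (cases "even j") auto
      hence "\<bar>sin (pi * (s * W))\<bar> = \<bar>sin (pi * W)\<bar>" for W by auto
      thus ?thesis .
    qed
    finally show "ln \<bar>2 * sin (pi * (real (rep j M i) * \<alpha> + (-1)^j * y))\<bar> = ln \<bar>2 * sin (pi * (real i / real (q j) + (real (rep j M i) / real (q j) * \<delta> j + y)))\<bar>"
      by (simp add: abs_mult n_def s_def Q_def)
  qed simp
  finally show ?thesis .
qed

lemma cot_sum_le:
  assumes "M < q j"
  shows "\<bar>\<Sum>i=1..<q j. real (rep j M i) / real (q j) * cot (pi * (real i / real (q j)))\<bar> \<le> real (q j) * cot_const j M"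
proof (cases "q j \<ge> 2")
  case True
  hence j: "j \<ge> 1" by (cases j) auto
  show ?thesis
  proof (cases "bulk j M")
    case bulk: True
    have "\<bar>\<Sum>i=1..<q j. real (rep j M i) / real (q j) * cot (pi * (real i / real (q j)))\<bar> \<le> real (q j) * (440 + 10 * \<tau> j)"
      using bulk j unfolding bulk_def by (intro cot_sum_bound(2)[OF assms True]) auto
    also have "\<dots> \<le> real (q j) * cot_const j M" using bulk by (intro mult_left_mono) (auto simp: cot_const_def)
    finally show ?thesis .
  next
    case False
    have "digit j \<ge> 1" using j by (rule digit_pos)
    have "\<bar>\<Sum>i=1..<q j. real (rep j M i) / real (q j) * cot (pi * (real i / real (q j)))\<bar> \<le> real (q j) * (401 + 10 * \<tau> j + ln (real (digit j)))"
      by (intro cot_sum_bound(1)[OF assms True])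
    also have "\<dots> \<le> real (q j) * cot_const j M" using False \<open>digit j \<ge> 1\<close> by (intro mult_left_mono) (auto simp: cot_const_def max_def)
    finally show ?thesis .
  qed
next
  case False
  hence "{1..<q j} = {}" by auto
  thus ?thesis using cot_const_nonneg[of j M] by simp
qed

lemma perturbed_block_rep:
  assumes "M < q j" "- (5/6) * \<delta> j \<le> E" "E \<le> 5/6 * \<delta> (Suc j)"
  shows "perturbed_block (q j) (\<delta> j) (real (digit (Suc j))) (real (q' j) / real (q j)) (\<delta> (Suc j) / \<delta> j)
    (real b) E (cot_const j M) (\<lambda>i. real (rep j M i) / real (q j))"
proof
  have qp: "real (q j) > 0" using q_ge_1[of j] by simp
  have dp: "\<delta> j > 0" "\<delta> (Suc j) > 0" by (rule \<delta>_pos)+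
  show "1 \<le> q j" by (rule q_ge_1)
  show "0 < \<delta> j" by (rule \<delta>_pos)
  show "1 \<le> real (digit (Suc j))" using digit_ge_1[of j] by simp
  show "0 \<le> real (q' j) / real (q j)" "real (q' j) / real (q j) \<le> 1" using qp q'_le[of j] by auto
  show "0 < \<delta> (Suc j) / \<delta> j" "\<delta> (Suc j) / \<delta> j \<le> 1" using dp \<delta>_less[of j] by auto
  show "1 / real (q j) = (real (digit (Suc j)) + real (q' j) / real (q j) + \<delta> (Suc j) / \<delta> j) * \<delta> j"
    unfolding q\<delta>_inverse[symmetric] using dp qp by simp
  show "0 \<le> real b" by simp
  show "- (5/6) * \<delta> j \<le> E" by fact
  show "E \<le> 5/6 * (\<delta> (Suc j) / \<delta> j * \<delta> j)" using assms dp by simp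
  show "0 \<le> real (rep j M i) / real (q j) \<and> real (rep j M i) / real (q j) \<le> 2" for i
  proof -
    have "rep j M i \<le> 2 * q j" using rep_range[of j M i] assms(1) by simp
    hence "real (rep j M i) \<le> real (2 * q j)" by (simp only: of_nat_le_iff)
    thus ?thesis using qp by (simp add: divide_le_eq)
  qed
  show "real (rep j M 0) / real (q j) = 1" using rep_0[OF assms(1)] qp by simp
  show "real (rep j M (q j - 1)) / real (q j) \<le> 1 + real (q' j) / real (q j)"
  proof -
    have "real (rep j M (q j - 1)) \<le> real (q j + q' j)" using rep_last[OF assms(1)] by (simp only: of_nat_le_iff)
    hence "real (rep j M (q j - 1)) / real (q j) \<le> real (q j + q' j) / real (q j)" using qp by (intro divide_right_mono) auto
    thus ?thesis using qp by (simp add: add_divide_distrib)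
  qed
  show "\<bar>\<Sum>i=1..<q j. real (rep j M i) / real (q j) * cot (pi * (real i / real (q j)))\<bar> \<le> real (q j) * cot_const j M"
    by (rule cot_sum_le[OF assms(1)])
qed

lemma block_log_bounds:
  assumes "M < q j" "- (5/6) * \<delta> j \<le> E" "E \<le> 5/6 * \<delta> (Suc j)"
  shows "b + 1 \<le> digit (Suc j) \<Longrightarrow> block_log j M (real b * \<delta> j + E) \<le> \<phi> ((real b + 1/2) * (real (q j) * \<delta> j))
      + 100 * (1 / (real b + 1) + 1 / (real (digit (Suc j)) - real b) + (1 + cot_const j M) / real (digit (Suc j)))"
    and "real b + 1 \<le> 11/12 * real (digit (Suc j)) \<Longrightarrow> block_log j M (real b * \<delta> j + E) \<ge> \<phi> ((real b + 1/2) * (real (q j) * \<delta> j))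
      - 6000 * (1 / (real b + 1) + (1 + cot_const j M) / real (digit (Suc j)))"
proof -
  interpret pb: perturbed_block "q j" "\<delta> j" "real (digit (Suc j))" "real (q' j) / real (q j)" "\<delta> (Suc j) / \<delta> j"
    "real b" E "cot_const j M" "\<lambda>i. real (rep j M i) / real (q j)"
    by (rule perturbed_block_rep[OF assms])
  have block_log: "block_log j M (real b * \<delta> j + E) = (\<Sum>i<q j. ln \<bar>2 * sin (pi * (real i / real (q j) + pb.x i))\<bar>)"
    unfolding block_log_reindex pb.x_def by (simp add: algebra_simps)
  have z: "\<phi> ((real b + 1/2) * (real (q j) * \<delta> j)) = ln (2 * sin (pi * (real (q j) * pb.z)))"
    unfolding \<phi>_def pb.z_def by (simp add: mult_ac)
  show "b + 1 \<le> digit (Suc j) \<Longrightarrow> block_log j M (real b * \<delta> j + E) \<le> \<phi> ((real b + 1/2) * (real (q j) * \<delta> j))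
      + 100 * (1 / (real b + 1) + 1 / (real (digit (Suc j)) - real b) + (1 + cot_const j M) / real (digit (Suc j)))"
    unfolding block_log z by (rule pb.sum_log_upper) linarith
  show "real b + 1 \<le> 11/12 * real (digit (Suc j)) \<Longrightarrow> block_log j M (real b * \<delta> j + E) \<ge> \<phi> ((real b + 1/2) * (real (q j) * \<delta> j))
      - 6000 * (1 / (real b + 1) + (1 + cot_const j M) / real (digit (Suc j)))"
    unfolding block_log z by (rule pb.sum_log_lower)
qed

end

section \<open>Summing one digit\<close>

lemma sin_pi_pos: "0 < x \<Longrightarrow> x < 1 \<Longrightarrow> sin (pi * x) > 0"
  by (intro sin_gt_zero) auto

lemma sin_5pi6: "sin (pi * (5/6)) = 1/2" and cot_5pi6: "cot (pi * (5/6)) = - sqrt 3"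
proof -
  have "pi * (5/6) = pi - pi / 6" by simp
  hence s: "sin (pi * (5/6)) = sin (pi / 6)" and c: "cos (pi * (5/6)) = - cos (pi / 6)"
    by (simp_all only: sin_pi_minus cos_pi_minus)
  show "sin (pi * (5/6)) = 1/2" unfolding s by (rule sin_30)
  show "cot (pi * (5/6)) = - sqrt 3" unfolding cot_def s c sin_30 cos_30 by simp
qed

lemma \<phi>_le_tangent: "0 < x \<Longrightarrow> x < 1 \<Longrightarrow> \<phi> x \<le> pi * sqrt 3 * (5/6 - x)"
proof -
  assume x: "0 < x" "x < 1"
  have s: "sin (pi * x) > 0" using x by (intro sin_gt_zero) auto
  have "ln \<bar>2 * sin (pi * x)\<bar> \<le> ln \<bar>2 * sin (pi * (5/6))\<bar> + pi * (x - 5/6) * cot (pi * (5/6))"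
    using x by (intro ln_2_sin_tangent) auto
  thus ?thesis unfolding sin_5pi6 cot_5pi6 using s by (simp add: \<phi>_def abs_mult algebra_simps)
qed

text \<open>The tangent inequality is used at x instead of 5/6, and \<open>cot_shift\<close>
  compares the two slopes. The constant is 288 = 18 * 16, with pi^2 < 16.\<close>

lemma \<phi>_ge_tangent: "3/4 \<le> x \<Longrightarrow> x \<le> 11/12 \<Longrightarrow> \<phi> x \<ge> pi * sqrt 3 * (5/6 - x) - 288 * (x - 5/6)\<^sup>2"
proof -
  assume x: "3/4 \<le> x" "x \<le> 11/12"
  have s: "sin (pi * x) > 0" using x by (intro sin_gt_zero) auto
  have "ln \<bar>2 * sin (pi * (5/6))\<bar> \<le> ln \<bar>2 * sin (pi * x)\<bar> + pi * (5/6 - x) * cot (pi * x)"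
    using x by (intro ln_2_sin_tangent) auto
  hence 1: "\<phi> x \<ge> - (pi * (5/6 - x) * cot (pi * x))"
    unfolding sin_5pi6 using s by (simp add: \<phi>_def abs_mult)
  have "\<bar>cot (pi * x) - cot (pi * (5/6))\<bar> \<le> pi * \<bar>x - 5/6\<bar> / (4 * (1/12) * (1/6))"
    using x by (intro cot_shift) auto
  hence "\<bar>pi * (5/6 - x)\<bar> * \<bar>cot (pi * x) - cot (pi * (5/6))\<bar> \<le> \<bar>pi * (5/6 - x)\<bar> * (pi * \<bar>x - 5/6\<bar> / (4 * (1/12) * (1/6)))"
    by (intro mult_left_mono) auto
  also have "\<dots> = 18 * (pi * pi) * (x - 5/6)\<^sup>2"
    by (simp add: abs_mult abs_minus_commute power2_eq_square)
  also have "\<dots> \<le> 18 * (4 * 4) * (x - 5/6)\<^sup>2"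
    using pi_less_4 by (intro mult_right_mono mult_left_mono mult_mono) auto
  finally have "\<bar>pi * (5/6 - x) * (cot (pi * x) + sqrt 3)\<bar> \<le> 288 * (x - 5/6)\<^sup>2"
    unfolding cot_5pi6 abs_mult by simp
  hence "pi * (5/6 - x) * (cot (pi * x) + sqrt 3) \<le> 288 * (x - 5/6)\<^sup>2" by linarith
  hence "pi * (5/6 - x) * cot (pi * x) + pi * sqrt 3 * (5/6 - x) \<le> 288 * (x - 5/6)\<^sup>2"
    by (simp add: algebra_simps)
  thus ?thesis using 1 by linarith
qed

lemma sin_scale: "0 \<le> y \<Longrightarrow> y \<le> pi \<Longrightarrow> 0 \<le> l \<Longrightarrow> l \<le> 1 \<Longrightarrow> sin (l * y) \<ge> l * sin y"
proof -
  assume a: "0 \<le> y" "y \<le> pi" "0 \<le> l" "l \<le> 1"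
  have conc: "concave_on {0..pi} sin"
    by (rule f''_le0_imp_concave[where f' = cos and f'' = "\<lambda>x. - sin x"])
      (auto intro!: derivative_eq_intros sin_ge_zero)
  have "sin ((1 - l) *\<^sub>R 0 + l *\<^sub>R y) \<ge> (1 - l) * sin 0 + l * sin y"
    by (rule concave_onD[OF conc]) (use a in auto)
  thus ?thesis by simp
qed

text \<open>Replaces the true step r = q_j \<delta>_j by 1/A. For l = r A in [A/(A+2), 1], concavity
  gives sin (l y) >= l sin y, and ln l >= -2/A.\<close>

lemma \<phi>_rescale:
  assumes A: "A \<ge> 1" and y: "0 < y" "y < A" and r: "1 / (A + 2) \<le> r" "r \<le> 1 / A"
  shows "\<phi> (y * r) \<ge> \<phi> (y / A) - 2 / A"
proof -
  define l where "l = r * A"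
  have "1 / (A + 2) * A \<le> r * A" using r(1) A by (intro mult_right_mono) auto
  hence l: "A / (A + 2) \<le> l" "l \<le> 1" using r A by (auto simp: l_def field_simps)
  have "A / (A + 2) > 0" using A by simp
  hence l0: "l > 0" using l(1) by linarith
  have yA: "0 < y / A" "y / A < 1" using y A by auto
  have s: "sin (pi * (y / A)) > 0" using yA by (rule sin_pi_pos)
  have "l * sin (pi * (y / A)) \<le> sin (l * (pi * (y / A)))"
  proof (rule sin_scale)
    show "0 \<le> pi * (y / A)" using yA(1) by (intro mult_nonneg_nonneg) auto
    show "pi * (y / A) \<le> pi" using mult_left_mono[OF less_imp_le[OF yA(2)], of pi] by simp
  qed (use l l0 in auto)
  also have "l * (pi * (y / A)) = pi * (y * r)" using A by (simp add: l_def)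
  finally have "ln (l * (2 * sin (pi * (y / A)))) \<le> \<phi> (y * r)"
    unfolding \<phi>_def using s l0 by (subst ln_le_cancel_iff) (auto intro: order.strict_trans2[of 0 "l * sin (pi * (y / A))"])
  moreover have "ln (l * (2 * sin (pi * (y / A)))) = ln l + \<phi> (y / A)"
    unfolding \<phi>_def using s l0 by (subst ln_mult) auto
  moreover have "ln l \<ge> - (2 / A)"
  proof -
    have "ln (1 + 2 / A) \<le> 2 / A" using A by (intro ln_add_one_self_le_self) auto
    moreover have "1 / l \<le> 1 + 2 / A" using l l0 A by (simp add: field_simps)
    hence "ln (1 / l) \<le> ln (1 + 2 / A)" using l0 A by (subst ln_le_cancel_iff) (auto simp: add_pos_nonneg)
    ultimately show ?thesis using l0 by (simp add: ln_div)
  qed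
  ultimately show ?thesis by linarith
qed

text \<open>The difference of the two sides is concave, zero at 5/6, and equal to ln 2 - 2/3 >= 0 at
  1/2; this last value is the origin of the slope 2.\<close>

lemma \<phi>_chord: "1/2 \<le> x \<Longrightarrow> x \<le> 5/6 \<Longrightarrow> \<phi> x \<ge> 2 * (5/6 - x)"
proof -
  assume x: "1/2 \<le> x" "x \<le> 5/6"
  define f where "f x = \<phi> x - 2 * (5/6 - x)" for x
  have conc: "concave_on {1/2..5/6} f"
  proof (rule f''_le0_imp_concave[where f' = "\<lambda>x. pi * cot (pi * x) + 2" and f'' = "\<lambda>x. - (pi\<^sup>2 * (1 / (sin (pi * x))\<^sup>2))"])
    fix y :: real assume y: "y \<in> {1/2..5/6}"
    hence s: "sin (pi * y) > 0" by (intro sin_gt_zero) auto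
    show "(f has_real_derivative pi * cot (pi * y) + 2) (at y)"
      unfolding f_def \<phi>_def using s by (auto intro!: derivative_eq_intros simp: cot_def field_simps)
    show "((\<lambda>x. pi * cot (pi * x) + 2) has_real_derivative - (pi\<^sup>2 * (1 / (sin (pi * y))\<^sup>2))) (at y)"
    proof -
      have "((\<lambda>x. cot (pi * x)) has_real_derivative - inverse ((sin (pi * y))\<^sup>2) * pi) (at y)"
        using s by (intro DERIV_chain2[OF DERIV_cot] derivative_eq_intros) auto
      from DERIV_add[OF DERIV_cmult[OF this, of pi] DERIV_const[of 2]] show ?thesis
        by (simp add: power2_eq_square divide_inverse mult_ac)
    qed
  qed (auto)
  have f1: "f (5/6) = 0" unfolding f_def \<phi>_def sin_5pi6 by simp
  have f0: "f (1/2) \<ge> 0" using ln2_ge_two_thirds by (simp add: f_def \<phi>_def)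
  define u where "u = (x - 1/2) * 3"
  have "0 \<le> u" "u \<le> 1" using x by (auto simp: u_def)
  moreover have "x = (1 - u) *\<^sub>R (1/2) + u *\<^sub>R (5/6)" by (simp add: u_def field_simps)
  ultimately have u: "0 \<le> u" "u \<le> 1" "x = (1 - u) *\<^sub>R (1/2) + u *\<^sub>R (5/6)" by auto
  have "f x \<ge> (1 - u) * f (1/2) + u * f (5/6)"
    unfolding u(3) by (rule concave_onD[OF conc]) (use u in auto)
  also have "(1 - u) * f (1/2) + u * f (5/6) \<ge> 0" using f1 f0 u by simp
  finally show ?thesis by (simp add: f_def)
qed

lemma \<phi>_nonneg: "1/6 \<le> x \<Longrightarrow> x \<le> 5/6 \<Longrightarrow> \<phi> x \<ge> 0"
proof -
  assume x: "1/6 \<le> x" "x \<le> 5/6"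
  have "sin (pi * x) \<ge> 1/2"
  proof (cases "x \<le> 1/2")
    case True
    have "sin (pi / 6) \<le> sin (pi * x)"
      using x True by (intro sin_monotone_2pi_le) auto
    thus ?thesis by (simp add: sin_30)
  next
    case False
    have "sin (pi / 6) \<le> sin (pi * (1 - x))"
      using x False by (intro sin_monotone_2pi_le) auto
    also have "pi * (1 - x) = pi - pi * x" by (simp add: algebra_simps)
    finally show ?thesis by (simp add: sin_30)
  qed
  thus ?thesis by (simp add: \<phi>_def)
qed

lemma \<phi>_nonpos: "0 < x \<Longrightarrow> x \<le> 1/6 \<Longrightarrow> \<phi> x \<le> 0"
proof -
  assume x: "0 < x" "x \<le> 1/6"
  have "pi * x > 0" "pi * x \<le> pi / 6" using x by (auto simp: field_simps)
  hence "sin (pi * x) \<le> sin (pi / 6)"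
    using pi_gt_zero by (intro sin_monotone_2pi_le; linarith)
  moreover have "sin (pi * x) > 0" using x by (intro sin_gt_zero) auto
  ultimately show ?thesis by (simp add: \<phi>_def sin_30)
qed

text \<open>The sine product at z = 1/(2A) is 2 sin (pi/2) = 2.\<close>

lemma sum_\<phi>_full: "A \<ge> 1 \<Longrightarrow> (\<Sum>b<A. \<phi> ((real b + 1/2) / real A)) = ln 2"
proof -
  assume A: "A \<ge> 1"
  have s: "sin (pi * (real b / real A + 1 / (2 * real A))) > 0" if "b < A" for b
  proof (rule sin_gt_zero)
    have "real b + 1/2 < real A" using that by linarith
    hence "(real b + 1/2) / real A < 1" using A by simp
    hence "real b / real A + 1 / (2 * real A) < 1" by (simp add: add_divide_distrib)
    thus "pi * (real b / real A + 1 / (2 * real A)) < pi" by simp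
    have "real b / real A + 1 / (2 * real A) > 0" using A by (intro add_nonneg_pos) auto
    thus "pi * (real b / real A + 1 / (2 * real A)) > 0" by simp
  qed
  have "(\<Sum>b<A. \<phi> ((real b + 1/2) / real A)) = (\<Sum>b<A. ln \<bar>2 * sin (pi * (real b / real A + 1 / (2 * real A)))\<bar>)"
  proof (rule sum.cong)
    fix b assume "b \<in> {..<A}"
    hence "sin (pi * (real b / real A + 1 / (2 * real A))) > 0" using s by blast
    thus "\<phi> ((real b + 1/2) / real A) = ln \<bar>2 * sin (pi * (real b / real A + 1 / (2 * real A)))\<bar>"
      by (simp add: \<phi>_def abs_mult add_divide_distrib)
  qed simp
  also have "\<dots> = ln (\<Prod>b<A. \<bar>2 * sin (pi * (real b / real A + 1 / (2 * real A)))\<bar>)"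
    by (rule ln_prod[symmetric]) (use s in force)+
  also have "\<dots> = ln \<bar>2 * sin (pi * real A * (1 / (2 * real A)))\<bar>"
    using prod_abs_sin[of A "1 / (2 * real A)"] A by simp
  also have "pi * real A * (1 / (2 * real A)) = pi / 2" using A by simp
  finally show ?thesis by simp
qed

text \<open>A logarithm is traded for a small multiple of A, to be paid by a quadratic loss at
  distance of order A. The finitely many A where this fails go into C/A, the error a level is
  allowed.\<close>

lemma ln_le_linear_plus_inverse: "\<epsilon> > 0 \<Longrightarrow> \<exists>C\<ge>0. \<forall>A\<ge>1. K * (1 + ln (real A)) \<le> \<epsilon> * real A + C / real A"
proof -
  assume e: "\<epsilon> > 0"
  have "eventually (\<lambda>A. K * (1 + ln (real A)) \<le> \<epsilon> * real A) sequentially"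
    using e by real_asymp
  then obtain N where N: "\<And>A. A \<ge> N \<Longrightarrow> K * (1 + ln (real A)) \<le> \<epsilon> * real A"
    by (auto simp: eventually_sequentially)
  define C where "C = real N * (\<bar>K\<bar> * (1 + ln (real (max 1 N))))"
  have C0: "C \<ge> 0" unfolding C_def by (intro mult_nonneg_nonneg add_nonneg_nonneg) auto
  have "K * (1 + ln (real A)) \<le> \<epsilon> * real A + C / real A" if A: "A \<ge> 1" for A
  proof (cases "A \<ge> N")
    case True
    have "C / real A \<ge> 0" using C0 by simp
    thus ?thesis using N[OF True] by linarith
  next
    case False
    have l: "0 \<le> 1 + ln (real A)" "ln (real A) \<le> ln (real (max 1 N))" using A False by auto
    have "K * (1 + ln (real A)) \<le> \<bar>K\<bar> * (1 + ln (real (max 1 N)))" using l by (intro mult_mono) auto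
    also have "\<dots> = 1 * \<dots>" by simp
    also have "\<dots> \<le> (real N / real A) * (\<bar>K\<bar> * (1 + ln (real (max 1 N))))"
      using A False l by (intro mult_right_mono) auto
    also have "\<dots> = C / real A" by (simp add: C_def)
    also have "\<dots> \<le> \<epsilon> * real A + C / real A" using e by simp
    finally show ?thesis .
  qed
  thus ?thesis using C0 by blast
qed

lemma sum_half_odd: "n \<le> B \<Longrightarrow> (\<Sum>b=n..<B. real B - real b - 1/2) = (real B - real n)\<^sup>2 / 2"
proof (induction B rule: dec_induct)
  case (step B)
  have "(\<Sum>b=n..<B. real (Suc B) - real b - 1/2) = (\<Sum>b=n..<B. (real B - real b - 1/2) + 1)"
    by (rule sum.cong) auto
  also have "\<dots> = (\<Sum>b=n..<B. real B - real b - 1/2) + (real B - real n)"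
    unfolding sum.distrib using step by simp
  finally show ?case using step by (simp add: power2_eq_square field_simps)
qed simp

lemma sum_half_odd': "B \<le> n \<Longrightarrow> (\<Sum>b=B..<n. real b + 1/2 - real B) = (real n - real B)\<^sup>2 / 2"
proof (induction n rule: dec_induct)
  case (step n)
  thus ?case by (simp add: power2_eq_square field_simps)
qed simp

lemma sum_bound_const: "n \<le> m \<Longrightarrow> (\<And>b. n \<le> b \<Longrightarrow> b < m \<Longrightarrow> f b \<le> c) \<Longrightarrow> (\<Sum>b=n..<m. f b) \<le> c * (real m - real n)" for f :: "nat \<Rightarrow> real"
  using sum_bounded_above[of "{n..<m}" f c] by (simp add: of_nat_diff mult.commute)

lemma sum_inverse_Suc: "(\<Sum>b=n..<m. 1 / (real b + 1)) \<le> 1 + ln (real A)" if "A \<ge> 1" "m \<le> A"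
proof -
  have "(\<Sum>b=n..<m. 1 / (real b + 1)) \<le> (\<Sum>b=0..<A. 1 / (real b + 1))"
    using that by (intro sum_mono2) auto
  also have "\<dots> = (\<Sum>i=1..A. 1 / real i)"
    by (rule sum.reindex_bij_witness[of _ "\<lambda>i. i - 1" Suc]) auto
  finally show ?thesis using sum_inverse_le_ln[OF that(1)] by linarith
qed

lemma sum_inverse_diff: "(\<Sum>b=n..<m. 1 / (real A - real b)) \<le> 1 + ln (real A)" if "A \<ge> 1" "m \<le> A"
proof -
  have "(\<Sum>b=n..<m. 1 / (real A - real b)) \<le> (\<Sum>b=0..<A. 1 / (real A - real b))"
    using that by (intro sum_mono2) auto
  also have "\<dots> = (\<Sum>i=1..A. 1 / real i)"
    by (rule sum.reindex_bij_witness[of _ "\<lambda>i. A - i" "\<lambda>i. A - i"]) (auto simp: of_nat_diff)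
  finally show ?thesis using sum_inverse_le_ln[OF that(1)] by linarith
qed

text \<open>One level in isolation: A is the partial quotient, B = floor (5A/6) the digit of N*, and
  r stands for q_j \<delta>_j.\<close>

locale digit_sum =
  fixes A B :: nat and r :: real
  assumes A: "A \<ge> 1" and B: "real B \<le> 5/6 * real A" "5/6 * real A - 1 < real B"
    and r: "1 / (real A + 2) \<le> r" "r \<le> 1 / real A"
begin

definition S :: "nat \<Rightarrow> nat \<Rightarrow> real" where
  "S n m = (\<Sum>b=n..<m. \<phi> ((real b + 1/2) / real A))"

lemma Apos: "real A > 0" and A1: "real A \<ge> 1" using A by auto

lemma BA: "B < A"
proof -
  have "real B < real A" using B Apos by linarith
  thus ?thesis by simp
qed

lemma arg01: "b < A \<Longrightarrow> 0 < (real b + 1/2) * r \<and> (real b + 1/2) * r < 1"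
proof -
  assume "b < A"
  hence b: "real b + 1/2 < real A" by linarith
  have "1 / (real A + 2) > 0" using A1 by simp
  hence r0: "r > 0" using r(1) by linarith
  have "(real b + 1/2) * r \<le> (real b + 1/2) * (1 / real A)" using r by (intro mult_left_mono) auto
  also have "\<dots> < 1" using b Apos by simp
  finally show ?thesis using r0 by simp
qed

lemma arg_lower: "b < A \<Longrightarrow> (real b + 1/2) * r \<ge> (real b + 1/2) / real A - 2 / real A"
proof -
  assume "b < A"
  hence b: "real b + 1/2 \<le> real A" by linarith
  have "(real b + 1/2) * (1 / real A - 1 / (real A + 2)) = (real b + 1/2) / (real A + 2) * (2 / real A)"
    using A1 by (simp add: field_simps)
  also have "\<dots> \<le> 1 * (2 / real A)" using b A1 by (intro mult_right_mono) auto
  finally have "(real b + 1/2) / real A - 2 / real A \<le> (real b + 1/2) * (1 / (real A + 2))"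
    by (simp add: right_diff_distrib)
  also have "\<dots> \<le> (real b + 1/2) * r" using r by (intro mult_left_mono) auto
  finally show ?thesis .
qed

lemma S_rescale:
  assumes "n \<le> m" "m \<le> A"
  shows "(\<Sum>b=n..<m. \<phi> ((real b + 1/2) * r)) \<ge> S n m - 2 * (real m - real n) / real A"
proof -
  have "(\<Sum>b=n..<m. \<phi> ((real b + 1/2) / real A) - 2 / real A) \<le> (\<Sum>b=n..<m. \<phi> ((real b + 1/2) * r))"
  proof (rule sum_mono)
    fix b assume "b \<in> {n..<m}"
    hence "real b + 1/2 < real A" using assms by auto
    thus "\<phi> ((real b + 1/2) / real A) - 2 / real A \<le> \<phi> ((real b + 1/2) * r)"
      using A1 r by (intro \<phi>_rescale) auto
  qed
  thus ?thesis using assms by (simp add: S_def sum_subtractf of_nat_diff mult.commute)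
qed

text \<open>The distances B - b - 1/2 in the tangent bound add up to D^2/2, and rounding B down acts
  in the right direction. 1152 = 288 * 4, because |5/6 - x| <= 2 D/A.\<close>

lemma S_ge_local:
  assumes "n \<le> B" "3/4 * real A \<le> real n"
  shows "S n B \<ge> pi * sqrt 3 / 2 * (real B - real n)\<^sup>2 / real A - 1152 * (real B - real n)^3 / (real A)\<^sup>2"
proof (cases "n = B")
  case False
  define D where "D = real B - real n"
  have D1: "D \<ge> 1" using False assms(1) by (auto simp: D_def)
  have "(\<Sum>b=n..<B. pi * sqrt 3 / real A * (real B - real b - 1/2) - 1152 * D\<^sup>2 / (real A)\<^sup>2) \<le> S n B"
    unfolding S_def
  proof (rule sum_mono)
    fix b assume b: "b \<in> {n..<B}"
    define x where "x = (real b + 1/2) / real A"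
    have bB: "real b + 1 \<le> real B" "real n \<le> real b" using b by auto
    have x1: "5/6 - x \<ge> (real B - real b - 1/2) / real A"
      using B Apos by (simp add: x_def field_simps)
    have x2: "5/6 - x \<le> (2 * D) / real A"
    proof -
      have "5/6 * real A - (real b + 1/2) \<le> 2 * D" using B(2) bB D1 D_def by linarith
      hence "(5/6 * real A - (real b + 1/2)) / real A \<le> 2 * D / real A" using Apos by (intro divide_right_mono) auto
      thus ?thesis using Apos by (simp add: x_def diff_divide_distrib)
    qed
    have "(real B - real b - 1/2) / real A \<ge> 0" using bB Apos by simp
    hence x3: "5/6 - x \<ge> 0" using x1 by linarith
    have x4: "x \<ge> 3/4" using bB(2) assms(2) Apos by (simp add: x_def field_simps)
    have "(x - 5/6)\<^sup>2 = (5/6 - x)\<^sup>2" by (rule power2_commute)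
    also have "\<dots> \<le> (2 * D / real A)\<^sup>2" using x2 x3 by (intro power_mono) auto
    also have "\<dots> = 4 * D\<^sup>2 / (real A)\<^sup>2" by (simp add: power_divide power_mult_distrib)
    finally have "(x - 5/6)\<^sup>2 \<le> 4 * D\<^sup>2 / (real A)\<^sup>2" .
    moreover have "pi * sqrt 3 * ((real B - real b - 1/2) / real A) \<le> pi * sqrt 3 * (5/6 - x)"
      using x1 by (intro mult_left_mono) auto
    moreover have "\<phi> x \<ge> pi * sqrt 3 * (5/6 - x) - 288 * (x - 5/6)\<^sup>2"
      using x3 x4 by (intro \<phi>_ge_tangent) auto
    ultimately show "pi * sqrt 3 / real A * (real B - real b - 1/2) - 1152 * D\<^sup>2 / (real A)\<^sup>2 \<le> \<phi> ((real b + 1/2) / real A)"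
      unfolding x_def[symmetric] by simp
  qed
  moreover have "(\<Sum>b=n..<B. pi * sqrt 3 / real A * (real B - real b - 1/2) - 1152 * D\<^sup>2 / (real A)\<^sup>2)
     = pi * sqrt 3 / real A * (D\<^sup>2 / 2) - D * (1152 * D\<^sup>2 / (real A)\<^sup>2)"
  proof -
    have "(\<Sum>b=n..<B. pi * sqrt 3 / real A * (real B - real b - 1/2) - 1152 * D\<^sup>2 / (real A)\<^sup>2)
      = (\<Sum>b=n..<B. pi * sqrt 3 / real A * (real B - real b - 1/2)) - (\<Sum>b=n..<B. 1152 * D\<^sup>2 / (real A)\<^sup>2)"
      by (rule sum_subtractf)
    also have "(\<Sum>b=n..<B. pi * sqrt 3 / real A * (real B - real b - 1/2)) = pi * sqrt 3 / real A * (D\<^sup>2 / 2)"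
      unfolding D_def by (simp only: sum_distrib_left[symmetric] sum_half_odd[OF assms(1)])
    also have "(\<Sum>b=n..<B. 1152 * D\<^sup>2 / (real A)\<^sup>2) = D * (1152 * D\<^sup>2 / (real A)\<^sup>2)"
      using assms(1) by (simp add: D_def of_nat_diff)
    finally show ?thesis .
  qed
  moreover have "D * (1152 * D\<^sup>2 / (real A)\<^sup>2) = 1152 * D^3 / (real A)\<^sup>2" by (simp add: power2_eq_square power3_eq_cube)
  moreover have "pi * sqrt 3 / real A * (D\<^sup>2 / 2) = pi * sqrt 3 / 2 * D\<^sup>2 / real A" by simp
  ultimately show ?thesis unfolding D_def[symmetric] by linarith
qed (simp add: S_def)

lemma S_ge_chord:
  assumes "n \<le> B" "real A / 2 \<le> real n"
  shows "S n B \<ge> (real B - real n)\<^sup>2 / real A"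
proof -
  have "(\<Sum>b=n..<B. 2 / real A * (real B - real b - 1/2)) \<le> S n B"
    unfolding S_def
  proof (rule sum_mono)
    fix b assume b: "b \<in> {n..<B}"
    define x where "x = (real b + 1/2) / real A"
    have bB: "real b + 1 \<le> real B" "real n \<le> real b" using b by auto
    have x1: "5/6 - x \<ge> (real B - real b - 1/2) / real A"
      using B Apos by (simp add: x_def field_simps)
    have "\<phi> x \<ge> 2 * (5/6 - x)"
    proof (rule \<phi>_chord)
      show "1/2 \<le> x" using bB(2) assms(2) Apos by (simp add: x_def field_simps)
      have "(real B - real b - 1/2) / real A \<ge> 0" using bB Apos by simp
      thus "x \<le> 5/6" using x1 by linarith
    qed
    thus "2 / real A * (real B - real b - 1/2) \<le> \<phi> ((real b + 1/2) / real A)"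
      using mult_left_mono[OF x1, of 2] unfolding x_def[symmetric] by simp
  qed
  moreover have "(\<Sum>b=n..<B. 2 / real A * (real B - real b - 1/2)) = 2 / real A * ((real B - real n)\<^sup>2 / 2)"
    by (simp only: sum_distrib_left[symmetric] sum_half_odd[OF assms(1)])
  ultimately show ?thesis by simp
qed

text \<open>All $A$ values add up to $\ln 2$, so the tangent bound beyond $5/6$ bounds the rest from below.\<close>

lemma S_ge_low:
  assumes "real n < real A / 6"
  shows "S n B \<ge> real A / 14 - 3 / real A"
proof -
  have nB: "n \<le> B"
  proof -
    have "real n < real B + 1" using assms B A1 by linarith
    thus ?thesis by linarith
  qed
  have "(\<Sum>b=0..<n. \<phi> ((real b + 1/2) / real A)) \<le> 0"
  proof (rule sum_nonpos)
    fix b assume "b \<in> {0..<n}"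
    hence "real b + 1/2 \<le> real A / 6" using assms by auto
    thus "\<phi> ((real b + 1/2) / real A) \<le> 0" using Apos by (intro \<phi>_nonpos) (auto simp: field_simps)
  qed
  moreover have "(\<Sum>b<A. \<phi> ((real b + 1/2) / real A)) = (\<Sum>b=0..<n. \<phi> ((real b + 1/2) / real A)) + S n B + (\<Sum>b=B..<A. \<phi> ((real b + 1/2) / real A))"
    unfolding S_def lessThan_atLeast0 using nB BA by (simp add: sum.atLeastLessThan_concat)
  moreover have "(\<Sum>b<A. \<phi> ((real b + 1/2) / real A)) = ln 2" using A by (rule sum_\<phi>_full)
  moreover have "(\<Sum>b=B..<A. \<phi> ((real b + 1/2) / real A)) \<le> (\<Sum>b=B..<A. pi * sqrt 3 * (5/6 - (real b + 1/2) / real A))"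
  proof (rule sum_mono)
    fix b assume "b \<in> {B..<A}"
    hence "real b + 1/2 < real A" by auto
    hence "(real b + 1/2) / real A < 1" using Apos by simp
    thus "\<phi> ((real b + 1/2) / real A) \<le> pi * sqrt 3 * (5/6 - (real b + 1/2) / real A)"
      using Apos by (intro \<phi>_le_tangent) auto
  qed
  moreover have "(\<Sum>b=B..<A. pi * sqrt 3 * (5/6 - (real b + 1/2) / real A)) = pi * sqrt 3 * ((\<Sum>b=B..<A. 5/6 - real B / real A) - (\<Sum>b=B..<A. real b + 1/2 - real B) / real A)"
  proof -
    have "(\<Sum>b=B..<A. 5/6 - (real b + 1/2) / real A) = (\<Sum>b=B..<A. (5/6 - real B / real A) - (real b + 1/2 - real B) / real A)"
      by (rule sum.cong) (auto simp: diff_divide_distrib)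
    also have "\<dots> = (\<Sum>b=B..<A. 5/6 - real B / real A) - (\<Sum>b=B..<A. real b + 1/2 - real B) / real A"
      unfolding sum_divide_distrib by (rule sum_subtractf)
    finally show ?thesis by (simp only: sum_distrib_left[symmetric])
  qed
  \<comment> \<open>With the rounding defect f = 5/6 A - B in [0, 1), the two sums combine to -A/72
    + f^2/(2A).\<close>
  moreover have "(\<Sum>b=B..<A. 5/6 - real B / real A) - (\<Sum>b=B..<A. real b + 1/2 - real B) / real A \<le> - (real A / 72) + 1 / (2 * real A)"
  proof -
    define f where "f = 5/6 * real A - real B"
    have f: "0 \<le> f" "f < 1" using B by (auto simp: f_def)
    have Bf: "real B = 5/6 * real A - f" by (simp add: f_def)
    have AB: "real (A - B) = real A / 6 + f" using BA by (simp add: f_def of_nat_diff)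
    have "5/6 - real B / real A = f / real A" using Apos by (simp add: Bf diff_divide_distrib)
    hence "(\<Sum>b=B..<A. 5/6 - real B / real A) = (real A / 6 + f) * (f / real A)"
      by (simp add: AB)
    moreover have "(\<Sum>b=B..<A. real b + 1/2 - real B) = (real A / 6 + f)\<^sup>2 / 2"
      using sum_half_odd'[of B A] BA AB by (simp add: of_nat_diff)
    ultimately have "(\<Sum>b=B..<A. 5/6 - real B / real A) - (\<Sum>b=B..<A. real b + 1/2 - real B) / real A
       = (real A / 6 + f) * (f / real A) - (real A / 6 + f)\<^sup>2 / 2 / real A" by (simp only:)
    also have "\<dots> = - (real A / 72) + f\<^sup>2 / (2 * real A)"
      using Apos by (simp add: power2_eq_square field_simps)
    also have "f\<^sup>2 / (2 * real A) \<le> 1 / (2 * real A)" using f Apos by (intro divide_right_mono) (auto simp: power_le_one)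
    finally show ?thesis by simp
  qed
  moreover have "pi * sqrt 3 * ((\<Sum>b=B..<A. 5/6 - real B / real A) - (\<Sum>b=B..<A. real b + 1/2 - real B) / real A) \<le> pi * sqrt 3 * (- (real A / 72) + 1 / (2 * real A))"
    using calculation(6) by (intro mult_left_mono) auto
  moreover have "pi * sqrt 3 * (- (real A / 72) + 1 / (2 * real A)) \<le> - (real A / 14) + 3 / real A"
  proof -
    have s: "1.732 \<le> sqrt 3" "sqrt 3 \<le> 1.733"
      by (rule real_le_rsqrt, simp add: power2_eq_square) (rule real_le_lsqrt, auto simp: power2_eq_square)
    have p: "3.14 \<le> pi" "pi \<le> 3.15" using pi_approx by auto
    \<comment> \<open>pi sqrt 3 = 5.44... lies between 72/14 = 5.14... and 6, which turns A/72 into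
      A/14.\<close>
    have "3.14 * 1.732 \<le> pi * sqrt 3" "pi * sqrt 3 \<le> 3.15 * 1.733" using s p by (intro mult_mono; simp)+
    hence c: "72/14 \<le> pi * sqrt 3" "pi * sqrt 3 \<le> 6" by auto
    have "72/14 * (real A / 72) \<le> pi * sqrt 3 * (real A / 72)" "pi * sqrt 3 * (1 / (2 * real A)) \<le> 6 * (1 / (2 * real A))"
      using c Apos by (intro mult_right_mono; simp)+
    moreover have "72/14 * (real A / 72) = real A / 14" "6 * (1 / (2 * real A)) = 3 / real A" by simp_all
    ultimately show ?thesis unfolding distrib_left mult_minus_right by linarith
  qed
  moreover have "ln 2 > (0::real)" by simp
  ultimately show ?thesis by linarith
qed

lemma S_ge_global:
  assumes "n \<le> B"
  shows "S n B \<ge> (real B - real n)\<^sup>2 / (16 * real A) - 40 / real A"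
proof -
  define D where "D = real B - real n"
  have D: "0 \<le> D" "D \<le> 5/6 * real A" using assms B by (auto simp: D_def)
  have D2: "D\<^sup>2 \<le> real A * real A"
  proof -
    have "D * D \<le> real A * real A" using D Apos by (intro mult_mono) auto
    thus ?thesis by (simp add: power2_eq_square)
  qed
  consider "real A / 2 \<le> real n" | "real n < real A / 6" | "real A / 6 \<le> real n" "real n < real A / 2" by linarith
  thus ?thesis
  proof cases
    case 1
    have "D\<^sup>2 / (16 * real A) \<le> D\<^sup>2 / real A" using Apos by (intro divide_left_mono) auto
    moreover have "40 / real A \<ge> 0" by simp
    ultimately show ?thesis using S_ge_chord[OF assms 1] unfolding D_def by linarith
  next
    case 2
    have "D\<^sup>2 / (16 * real A) \<le> real A * real A / (16 * real A)" using D2 Apos by (intro divide_right_mono) auto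
    hence "D\<^sup>2 / (16 * real A) \<le> real A / 16" using Apos by simp
    moreover have "3 / real A \<le> 40 / real A" using Apos by (intro divide_right_mono) auto
    ultimately show ?thesis using S_ge_low[OF 2] Apos unfolding D_def by linarith
  next
    case 3
    define m where "m = nat \<lceil>real A / 2\<rceil>"
    have m: "real A / 2 \<le> real m" "real m < real A / 2 + 1" unfolding m_def by linarith+
    have nm: "n \<le> m" using 3 m by linarith
    have pos: "\<phi> ((real b + 1/2) / real A) \<ge> 0" if "n \<le> b" "b < B" for b
    proof (rule \<phi>_nonneg)
      have "real A / 6 \<le> real b + 1/2" "real b + 1/2 \<le> 5/6 * real A" using that 3 B by linarith+
      thus "1/6 \<le> (real b + 1/2) / real A" "(real b + 1/2) / real A \<le> 5/6" using Apos by (auto simp: field_simps)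
    qed
    show ?thesis
    proof (cases "A \<ge> 24")
      case True
      hence A24: "real A \<ge> 24" by simp
      have mB: "m \<le> B" using m B A24 by linarith
      have "S n B = S n m + S m B" unfolding S_def using nm mB by (simp add: sum.atLeastLessThan_concat)
      moreover have "S n m \<ge> 0" unfolding S_def using mB by (intro sum_nonneg pos) auto
      moreover have "S m B \<ge> (real B - real m)\<^sup>2 / real A" using S_ge_chord[OF mB] m by simp
      moreover have "(real A / 4)\<^sup>2 / real A \<le> (real B - real m)\<^sup>2 / real A"
        using m B A24 by (intro divide_right_mono power_mono) auto
      moreover have "D\<^sup>2 / (16 * real A) \<le> (real A / 4)\<^sup>2 / real A"
        using D2 Apos by (simp add: power2_eq_square field_simps)
      moreover have "40 / real A \<ge> 0" by simp
      ultimately show ?thesis unfolding D_def by linarith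
    next
      case False
      hence "real A \<le> 23" by simp
      hence "real A * real A \<le> 23 * 23" using Apos by (intro mult_mono) auto
      hence "D\<^sup>2 \<le> 640" using D2 by simp
      hence "D\<^sup>2 / (16 * real A) \<le> 640 / (16 * real A)" using Apos by (intro divide_right_mono) auto
      moreover have "S n B \<ge> 0" unfolding S_def by (intro sum_nonneg pos) auto
      ultimately show ?thesis unfolding D_def by simp
    qed
  qed
qed

text \<open>The upper tangent bound works directly with r. Rounding in B costs 1/A and comparing r
  with 1/A costs 2/A per term; 18 = 6 * 3, with pi sqrt 3 <= 6.\<close>

lemma neg_sum_right:
  assumes "B \<le> n" "n \<le> A"
  shows "- (\<Sum>b=B..<n. \<phi> ((real b + 1/2) * r)) \<ge> pi * sqrt 3 / 2 * (real n - real B)\<^sup>2 / real A - 18 * (real n - real B) / real A"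
proof -
  define D where "D = real n - real B"
  have "(\<Sum>b=B..<n. \<phi> ((real b + 1/2) * r)) \<le> (\<Sum>b=B..<n. pi * sqrt 3 * (- ((real b + 1/2 - real B) / real A) + 3 / real A))"
  proof (rule sum_mono)
    fix b assume "b \<in> {B..<n}"
    hence b: "b < A" using assms by auto
    have "\<phi> ((real b + 1/2) * r) \<le> pi * sqrt 3 * (5/6 - (real b + 1/2) * r)"
      using arg01[OF b] by (intro \<phi>_le_tangent) auto
    also have "\<dots> \<le> pi * sqrt 3 * (- ((real b + 1/2 - real B) / real A) + 3 / real A)"
    proof (rule mult_left_mono)
      have "(5/6 * real A - real B) / real A \<le> 1 / real A" using B Apos by (intro divide_right_mono) auto
      hence "5/6 - real B / real A \<le> 1 / real A" using Apos by (simp add: diff_divide_distrib)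
      moreover have "(real b + 1/2 - real B) / real A = (real b + 1/2) / real A - real B / real A" by (rule diff_divide_distrib)
      moreover have "3 / real A = 1 / real A + 2 / real A" by simp
      ultimately show "5/6 - (real b + 1/2) * r \<le> - ((real b + 1/2 - real B) / real A) + 3 / real A"
        using arg_lower[OF b] by linarith
    qed auto
    finally show "\<phi> ((real b + 1/2) * r) \<le> pi * sqrt 3 * (- ((real b + 1/2 - real B) / real A) + 3 / real A)" .
  qed
  also have "\<dots> = pi * sqrt 3 * (- ((\<Sum>b=B..<n. real b + 1/2 - real B) / real A) + D * (3 / real A))"
  proof -
    have "(\<Sum>b=B..<n. - ((real b + 1/2 - real B) / real A) + 3 / real A)
      = - ((\<Sum>b=B..<n. real b + 1/2 - real B) / real A) + real (n - B) * (3 / real A)"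
      by (simp only: sum.distrib sum_negf sum_divide_distrib sum_constant card_atLeastLessThan)
    also have "real (n - B) = D" using assms(1) by (simp add: D_def of_nat_diff)
    finally show ?thesis by (simp only: sum_distrib_left[symmetric])
  qed
  also have "(\<Sum>b=B..<n. real b + 1/2 - real B) = D\<^sup>2 / 2" unfolding D_def using assms(1) by (rule sum_half_odd')
  also have "pi * sqrt 3 * (- (D\<^sup>2 / 2 / real A) + D * (3 / real A)) = - (pi * sqrt 3 / 2 * D\<^sup>2 / real A) + pi * sqrt 3 * (3 * D / real A)"
    by (simp add: algebra_simps)
  also have "pi * sqrt 3 * (3 * D / real A) \<le> 6 * (3 * D / real A)"
  proof (rule mult_right_mono)
    have "pi \<le> 3.15" using pi_approx by simp
    moreover have "sqrt 3 \<le> 1.8" by (rule real_le_lsqrt) (auto simp: power2_eq_square)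
    ultimately have "pi * sqrt 3 \<le> 3.15 * 1.8" by (intro mult_mono) auto
    thus "pi * sqrt 3 \<le> 6" by simp
    show "0 \<le> 3 * D / real A" using assms by (auto simp: D_def)
  qed
  finally show ?thesis unfolding D_def by simp
qed

end

text \<open>Here \<open>g b\<close> is the logarithm of the b-th block of the level and
  \<open>L\<close> its cotangent constant. The upper bound covers all digits, the lower one only
  those up to 11/12 A.\<close>

locale digit_change = digit_sum +
  fixes g :: "nat \<Rightarrow> real" and L :: real
  assumes L: "L \<ge> 1"
    and up: "\<And>b. b + 1 \<le> A \<Longrightarrow> g b \<le> \<phi> ((real b + 1/2) * r) + 100 * (1 / (real b + 1) + 1 / (real A - real b) + (1 + L) / real A)"
    and lo: "\<And>b. real b + 1 \<le> 11/12 * real A \<Longrightarrow> g b \<ge> \<phi> ((real b + 1/2) * r) - 6000 * (1 / (real b + 1) + (1 + L) / real A)"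
begin

text \<open>Logarithm gained when the digit n is changed to B; one of the two sums is always empty.
  \<open>X\<close> below is the scale of all errors linear in the distance |n - B|.\<close>

definition D :: "nat \<Rightarrow> real" where "D n = (\<Sum>b=n..<B. g b) - (\<Sum>b=B..<n. g b)"
definition X :: "nat \<Rightarrow> real" where "X n = L * \<bar>real n - real B\<bar> / real A"

lemma X_bounds:
  shows "\<bar>real n - real B\<bar> / real A \<le> X n" "\<bar>real n - real B\<bar> * ((1 + L) / real A) \<le> 2 * X n" "X n \<ge> 0"
proof -
  have "1 * \<bar>real n - real B\<bar> \<le> L * \<bar>real n - real B\<bar>" using L by (intro mult_right_mono) auto
  thus 1: "\<bar>real n - real B\<bar> / real A \<le> X n" unfolding X_def using Apos by (intro divide_right_mono) auto
  have "\<bar>real n - real B\<bar> * ((1 + L) / real A) = \<bar>real n - real B\<bar> / real A + X n"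
    by (simp add: X_def ring_distribs add_divide_distrib)
  thus "\<bar>real n - real B\<bar> * ((1 + L) / real A) \<le> 2 * X n" using 1 by linarith
  show "X n \<ge> 0" using L by (simp add: X_def)
qed

lemma pi_sqrt3: "5 \<le> pi * sqrt 3" "pi * sqrt 3 \<le> 6"
proof -
  have "pi \<le> 3.15" "3.14 \<le> pi" using pi_approx by auto
  moreover have "1.7 \<le> sqrt 3" by (rule real_le_rsqrt) (simp add: power2_eq_square)
  moreover have "sqrt 3 \<le> 1.8" by (rule real_le_lsqrt) (auto simp: power2_eq_square)
  ultimately have "pi * sqrt 3 \<le> 3.15 * 1.8" "3.14 * 1.7 \<le> pi * sqrt 3" by (intro mult_mono; simp)+
  thus "5 \<le> pi * sqrt 3" "pi * sqrt 3 \<le> 6" by auto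
qed

lemma sum_const_bound:
  fixes f :: "nat \<Rightarrow> real"
  assumes "n \<le> m" and "\<And>b. n \<le> b \<Longrightarrow> b < m \<Longrightarrow> f b \<le> c / real A"
  shows "(\<Sum>b=n..<m. f b) \<le> c * ((real m - real n) / real A)"
proof -
  have "(\<Sum>b=n..<m. f b) \<le> c / real A * (real m - real n)" by (rule sum_bound_const[OF assms])
  thus ?thesis by simp
qed

lemma sum_add_const: "(\<Sum>b=n..<m. f b + c) = (\<Sum>b=n..<m. f b) + real (m - n) * c" for f :: "nat \<Rightarrow> real"
  by (simp add: sum.distrib)

text \<open>The harmonic sum is kept explicit: it is O(X n) for n >= A/4 and logarithmic in A
  otherwise.\<close>

lemma D_left:
  assumes n: "n \<le> B"
  shows "D n \<ge> S n B - 12002 * X n - 6000 * (\<Sum>b=n..<B. 1 / (real b + 1))"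
proof -
  have ab: "\<bar>real n - real B\<bar> = real B - real n" using n by simp
  have "(\<Sum>b=n..<B. \<phi> ((real b + 1/2) * r) - (6000 * (1 / (real b + 1)) + 6000 * ((1 + L) / real A))) \<le> (\<Sum>b=n..<B. g b)"
  proof (rule sum_mono)
    fix b assume "b \<in> {n..<B}"
    hence "real b + 1 \<le> real B" by auto
    hence "real b + 1 \<le> 11/12 * real A" using B Apos by linarith
    from lo[OF this] show "\<phi> ((real b + 1/2) * r) - (6000 * (1 / (real b + 1)) + 6000 * ((1 + L) / real A)) \<le> g b"
      unfolding distrib_left by linarith
  qed
  moreover have "(\<Sum>b=n..<B. \<phi> ((real b + 1/2) * r) - (6000 * (1 / (real b + 1)) + 6000 * ((1 + L) / real A)))
    = (\<Sum>b=n..<B. \<phi> ((real b + 1/2) * r)) - (6000 * (\<Sum>b=n..<B. 1 / (real b + 1)) + real (B - n) * (6000 * ((1 + L) / real A)))"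
    by (simp only: sum_subtractf sum.distrib sum_distrib_left sum_constant card_atLeastLessThan)
  moreover have "real (B - n) * (6000 * ((1 + L) / real A)) \<le> 12000 * X n"
  proof -
    have "real (B - n) = real B - real n" using n by (simp add: of_nat_diff)
    hence "real (B - n) * (6000 * ((1 + L) / real A)) = 6000 * ((real B - real n) * ((1 + L) / real A))"
      by (simp only: mult.left_commute)
    thus ?thesis using X_bounds(2)[of n] unfolding ab by linarith
  qed
  moreover have "S n B - 2 * (real B - real n) / real A \<le> (\<Sum>b=n..<B. \<phi> ((real b + 1/2) * r))"
    using n BA by (intro S_rescale) auto
  moreover have "2 * (real B - real n) / real A = 2 * ((real B - real n) / real A)" by (rule times_divide_eq_right[symmetric])
  moreover have "(real B - real n) / real A \<le> X n" using X_bounds(1)[of n] unfolding ab .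
  moreover have "D n = (\<Sum>b=n..<B. g b)" using n by (simp add: D_def)
  ultimately show ?thesis by linarith
qed

lemma D_right:
  assumes n: "B \<le> n" "n \<le> A"
  shows "D n \<ge> pi * sqrt 3 / 2 * (real n - real B)\<^sup>2 / real A - 500 * X n - 100 * (\<Sum>b=B..<n. 1 / (real A - real b))"
proof -
  have ab: "\<bar>real n - real B\<bar> = real n - real B" using n by simp
  have "(\<Sum>b=B..<n. g b) \<le> (\<Sum>b=B..<n. \<phi> ((real b + 1/2) * r) + (100 * (1 / (real b + 1)) + (100 * (1 / (real A - real b)) + 100 * ((1 + L) / real A))))"
  proof (rule sum_mono)
    fix b assume "b \<in> {B..<n}"
    hence "b + 1 \<le> A" using n by auto
    from up[OF this] show "g b \<le> \<phi> ((real b + 1/2) * r) + (100 * (1 / (real b + 1)) + (100 * (1 / (real A - real b)) + 100 * ((1 + L) / real A)))"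
      unfolding distrib_left by linarith
  qed
  moreover have "(\<Sum>b=B..<n. \<phi> ((real b + 1/2) * r) + (100 * (1 / (real b + 1)) + (100 * (1 / (real A - real b)) + 100 * ((1 + L) / real A))))
    = (\<Sum>b=B..<n. \<phi> ((real b + 1/2) * r)) + (100 * (\<Sum>b=B..<n. 1 / (real b + 1)) + (100 * (\<Sum>b=B..<n. 1 / (real A - real b)) + real (n - B) * (100 * ((1 + L) / real A))))"
    by (simp only: sum.distrib sum_distrib_left sum_constant card_atLeastLessThan)
  moreover have "real (n - B) * (100 * ((1 + L) / real A)) \<le> 200 * X n"
  proof -
    have "real (n - B) = real n - real B" using n by (simp add: of_nat_diff)
    hence "real (n - B) * (100 * ((1 + L) / real A)) = 100 * ((real n - real B) * ((1 + L) / real A))"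
      by (simp only: mult.left_commute)
    thus ?thesis using X_bounds(2)[of n] unfolding ab by linarith
  qed
  moreover have "(\<Sum>b=B..<n. 1 / (real b + 1)) \<le> 2 * ((real n - real B) / real A)"
  proof (rule sum_const_bound[OF n(1)])
    fix b assume "B \<le> b"
    hence "real A / 2 \<le> real b + 1" using B Apos by linarith
    hence "1 / (real b + 1) \<le> 1 / (real A / 2)" using Apos by (intro divide_left_mono) auto
    thus "1 / (real b + 1) \<le> 2 / real A" by simp
  qed
  moreover have "- (\<Sum>b=B..<n. \<phi> ((real b + 1/2) * r)) \<ge> pi * sqrt 3 / 2 * (real n - real B)\<^sup>2 / real A - 18 * (real n - real B) / real A"
    by (rule neg_sum_right[OF n])
  moreover have "18 * (real n - real B) / real A = 18 * ((real n - real B) / real A)" by (rule times_divide_eq_right[symmetric])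
  moreover have "(real n - real B) / real A \<le> X n" using X_bounds(1)[of n] unfolding ab .
  moreover have "D n = - (\<Sum>b=B..<n. g b)" using n by (simp add: D_def)
  ultimately show ?thesis using X_bounds(3)[of n] by linarith
qed

lemma sum_inv_left: "n \<le> B \<Longrightarrow> real A / 4 \<le> real n \<Longrightarrow> (\<Sum>b=n..<B. 1 / (real b + 1)) \<le> 4 * X n"
proof -
  assume n: "n \<le> B" "real A / 4 \<le> real n"
  have "(\<Sum>b=n..<B. 1 / (real b + 1)) \<le> 4 * ((real B - real n) / real A)"
  proof (rule sum_const_bound[OF n(1)])
    fix b assume "n \<le> b"
    hence "real A / 4 \<le> real b + 1" using n by linarith
    hence "1 / (real b + 1) \<le> 1 / (real A / 4)" using Apos by (intro divide_left_mono) auto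
    thus "1 / (real b + 1) \<le> 4 / real A" by simp
  qed
  moreover have "(real B - real n) / real A \<le> X n" using X_bounds(1)[of n] n by simp
  ultimately show ?thesis by linarith
qed

lemma sum_inv_right: "B \<le> n \<Longrightarrow> real n \<le> 11/12 * real A \<Longrightarrow> (\<Sum>b=B..<n. 1 / (real A - real b)) \<le> 12 * X n"
proof -
  assume n: "B \<le> n" "real n \<le> 11/12 * real A"
  have "(\<Sum>b=B..<n. 1 / (real A - real b)) \<le> 12 * ((real n - real B) / real A)"
  proof (rule sum_const_bound[OF n(1)])
    fix b assume "b < n"
    hence "real A / 12 \<le> real A - real b" using n by linarith
    hence "1 / (real A - real b) \<le> 1 / (real A / 12)" using Apos by (intro divide_left_mono) auto
    thus "1 / (real A - real b) \<le> 12 / real A" by simp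
  qed
  moreover have "(real n - real B) / real A \<le> X n" using X_bounds(1)[of n] n by simp
  ultimately show ?thesis by linarith
qed

text \<open>Near 0 and near A the harmonic sums can reach the order of ln A, but there |n - B| is
  comparable to A, so part of the quadratic term pays for them, up to C/A.\<close>

lemma D_ge_coarse:
  assumes n: "n \<le> A" and C0: "C \<ge> 0" and C: "6000 * (1 + ln (real A)) \<le> 1/300 * real A + C / real A"
  shows "D n \<ge> (real n - real B)\<^sup>2 / (32 * real A) - (C + 41) / real A - 50000 * X n"
proof -
  define d where "d = \<bar>real n - real B\<bar>"
  have dd: "(real n - real B)\<^sup>2 = d\<^sup>2" "(real B - real n)\<^sup>2 = d\<^sup>2" by (simp_all add: d_def power2_commute)
  have X0: "X n \<ge> 0" by (rule X_bounds)
  have l0: "ln (real A) \<ge> 0" using A1 by simp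
  have h: "d\<^sup>2 / (16 * real A) = d\<^sup>2 / (32 * real A) + d\<^sup>2 / (32 * real A)" by simp
  have q0: "d\<^sup>2 / (32 * real A) \<ge> 0" by simp
  have k: "(C + 41) / real A = C / real A + 1 / real A + 40 / real A" by (simp add: add_divide_distrib)
  have C': "6000 + 6000 * ln (real A) \<le> 1/300 * real A + C / real A" using C by (simp only: distrib_left mult_1_right)
  have nn: "C / real A \<ge> 0" "1 / real A \<ge> 0" "40 / real A \<ge> 0" using C0 by auto
  \<comment> \<open>A/300 < A/288 = (A/3)^2/(32 A). On the left, n < A/4 forces d >= A/3 as soon as
    A >= 4; for smaller A the term 1/A suffices.\<close>
  have small: "1/300 * real A \<le> d\<^sup>2 / (32 * real A) + 1 / real A" if "real A \<ge> 4 \<Longrightarrow> real A / 12 * 4 \<le> d"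
  proof (cases "real A \<ge> 4")
    case True
    hence "(real A / 3)\<^sup>2 \<le> d\<^sup>2" using that by (intro power_mono) auto
    hence "(real A / 3)\<^sup>2 / (32 * real A) \<le> d\<^sup>2 / (32 * real A)" by (intro divide_right_mono) auto
    moreover have "(real A / 3)\<^sup>2 / (32 * real A) = real A / 288" using Apos by (simp add: power2_eq_square)
    moreover have "1 / real A \<ge> 0" by simp
    ultimately show ?thesis using Apos by linarith
  next
    case False
    hence "real A * real A \<le> 4 * 4" using Apos by (intro mult_mono) auto
    hence "1/300 * real A \<le> 1 / real A" using Apos by (simp add: field_simps)
    thus ?thesis using q0 by linarith
  qed
  show ?thesis
  proof (cases "n \<le> B")
    case nB: True
    note S = S_ge_global[OF nB, unfolded dd]
    show ?thesis
    proof (cases "real A / 4 \<le> real n")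
      case True
      have "D n \<ge> d\<^sup>2 / (16 * real A) - 40 / real A - 12002 * X n - 6000 * (4 * X n)"
        using D_left[OF nB] sum_inv_left[OF nB True] S by linarith
      thus ?thesis unfolding dd k using X0 h q0 nn by linarith
    next
      case False
      have "(\<Sum>b=n..<B. 1 / (real b + 1)) \<le> 1 + ln (real A)" using A BA by (intro sum_inverse_Suc) auto
      hence "D n \<ge> d\<^sup>2 / (16 * real A) - 40 / real A - 12002 * X n - (1/300 * real A + C / real A)"
        using D_left[OF nB] S C' by linarith
      moreover have "real A \<ge> 4 \<Longrightarrow> real A / 12 * 4 \<le> d" using False B nB unfolding d_def by linarith
      ultimately show ?thesis unfolding dd k using X0 h small nn by linarith
    qed
  next
    case False
    hence Bn: "B \<le> n" by simp
    have p: "pi * sqrt 3 / 2 * d\<^sup>2 / real A \<ge> 2 * d\<^sup>2 / real A"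
      using pi_sqrt3 by (intro divide_right_mono mult_right_mono) auto
    have p2: "2 * d\<^sup>2 / real A = 64 * (d\<^sup>2 / (32 * real A))" by simp
    note R = D_right[OF Bn n, unfolded dd]
    show ?thesis
    proof (cases "real n \<le> 11/12 * real A")
      case True
      show ?thesis unfolding dd k using sum_inv_right[OF Bn True] R p p2 X0 q0 nn by linarith
    next
      case False
      have "(\<Sum>b=B..<n. 1 / (real A - real b)) \<le> 1 + ln (real A)" using A n by (intro sum_inverse_diff) auto
      hence E: "100 * (\<Sum>b=B..<n. 1 / (real A - real b)) \<le> 1/300 * real A + C / real A" using C' l0 by linarith
      have "real A / 12 \<le> d" using False B Bn unfolding d_def by linarith
      hence "(real A / 12)\<^sup>2 \<le> d\<^sup>2" using Apos by (intro power_mono) auto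
      hence "(real A / 12)\<^sup>2 / (32 * real A) \<le> d\<^sup>2 / (32 * real A)" using Apos by (intro divide_right_mono) auto
      moreover have "(real A / 12)\<^sup>2 / (32 * real A) = real A / 4608" using Apos by (simp add: power2_eq_square)
      ultimately have "1/300 * real A \<le> 20 * (d\<^sup>2 / (32 * real A))" using Apos by linarith
      thus ?thesis unfolding dd k using R p p2 X0 q0 nn E by linarith
    qed
  qed
qed

text \<open>The sharp coefficient comes from the tangent at 5/6 and thus needs n near B. At distance
  at least A/12 - 1 the allowed cubic error outweighs the quadratic term up to O(1/A), and the
  coarse bound is enough.\<close>

lemma D_ge_fine:
  assumes n: "n \<le> A" and C0: "C \<ge> 0" and C: "6000 * (1 + ln (real A)) \<le> 1/300 * real A + C / real A"
  shows "D n \<ge> pi * sqrt 3 / 2 * (real n - real B)\<^sup>2 / real A - 1152 * \<bar>real n - real B\<bar>^3 / (real A)\<^sup>2 - (C + 44) / real A - 50000 * X n"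
proof -
  define d where "d = \<bar>real n - real B\<bar>"
  have d0: "d \<ge> 0" by (simp add: d_def)
  have dd: "(real n - real B)\<^sup>2 = d\<^sup>2" "(real B - real n)\<^sup>2 = d\<^sup>2" by (simp_all add: d_def power2_commute)
  have X0: "X n \<ge> 0" by (rule X_bounds)
  have k: "(C + 44) / real A = C / real A + 44 / real A" "(C + 41) / real A = C / real A + 41 / real A" by (simp_all add: add_divide_distrib)
  have nn: "C / real A \<ge> 0" "44 / real A = 44 * (1 / real A)" "41 / real A = 41 * (1 / real A)" "1 / real A \<ge> 0" "d^3 / (real A)\<^sup>2 \<ge> 0" "d\<^sup>2 / (32 * real A) \<ge> 0" using C0 d0 by auto
  have far: ?thesis if "real A / 12 - 1 \<le> d"
  proof -
    have "pi * sqrt 3 / 2 * d\<^sup>2 / real A \<le> 3 * d\<^sup>2 / real A"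
      using pi_sqrt3 by (intro divide_right_mono mult_right_mono) auto
    moreover have "3 * d\<^sup>2 / real A \<le> 1152 * (d^3 / (real A)\<^sup>2) + 3 * (1 / real A)"
    proof (cases "real A / 24 \<le> d")
      case True
      have "3 * d\<^sup>2 / real A = 72 * (d\<^sup>2 * (real A / 24)) / (real A)\<^sup>2" using Apos by (simp add: power2_eq_square)
      also have "\<dots> \<le> 72 * (d\<^sup>2 * d) / (real A)\<^sup>2" using True by (intro divide_right_mono mult_left_mono) auto
      also have "\<dots> = 72 * (d^3 / (real A)\<^sup>2)" by (simp add: power2_eq_square power3_eq_cube)
      finally show ?thesis using nn by linarith
    next
      case False
      hence "d \<le> 1" using that by linarith
      hence "d\<^sup>2 \<le> 1" using d0 by (simp add: power_le_one)
      hence "3 * d\<^sup>2 / real A \<le> 3 * (1 / real A)" using Apos by (simp add: divide_right_mono)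
      thus ?thesis using nn by linarith
    qed
    moreover have "1152 * d^3 / (real A)\<^sup>2 = 1152 * (d^3 / (real A)\<^sup>2)" by simp
    ultimately show ?thesis using D_ge_coarse[OF n C0 C] nn X0 unfolding dd d_def[symmetric] k by linarith
  qed
  show ?thesis
  proof (cases "n \<le> B")
    case nB: True
    show ?thesis
    proof (cases "3/4 * real A \<le> real n")
      case True
      have "real B - real n = d" using nB by (simp add: d_def)
      hence "S n B \<ge> pi * sqrt 3 / 2 * d\<^sup>2 / real A - 1152 * d^3 / (real A)\<^sup>2"
        using S_ge_local[OF nB True] by (simp only:)
      moreover have "(\<Sum>b=n..<B. 1 / (real b + 1)) \<le> 4 * X n" using True Apos by (intro sum_inv_left nB) auto
      ultimately show ?thesis using D_left[OF nB] nn X0 unfolding dd d_def[symmetric] k by linarith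
    next
      case False
      hence "real A / 12 - 1 \<le> d" using nB B unfolding d_def by linarith
      thus ?thesis by (rule far)
    qed
  next
    case False
    hence Bn: "B \<le> n" by simp
    show ?thesis
    proof (cases "real n \<le> 11/12 * real A")
      case True
      have "1152 * d^3 / (real A)\<^sup>2 = 1152 * (d^3 / (real A)\<^sup>2)" by simp
      thus ?thesis using sum_inv_right[OF Bn True] D_right[OF Bn n] nn X0 unfolding dd d_def[symmetric] k by linarith
    next
      case False
      hence "real A / 12 - 1 \<le> d" using Bn B unfolding d_def by linarith
      thus ?thesis by (rule far)
    qed
  qed
qed

text \<open>Needed only near B: it serves the lower bound of the sum over N, for which a window of
  digits around B suffices.\<close>

lemma D_le_fine:
  assumes n: "\<bar>real n - real B\<bar> \<le> real A / 20" and A36: "A \<ge> 36"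
  shows "D n \<le> pi * sqrt 3 / 2 * (real n - real B)\<^sup>2 / real A + 3000 * \<bar>real n - real B\<bar>^3 / (real A)\<^sup>2 + 50000 * X n"
proof -
  define d where "d = \<bar>real n - real B\<bar>"
  have d0: "d \<ge> 0" by (simp add: d_def)
  have dd: "(real n - real B)\<^sup>2 = d\<^sup>2" "(real B - real n)\<^sup>2 = d\<^sup>2" by (simp_all add: d_def power2_commute)
  have X0: "X n \<ge> 0" by (rule X_bounds)
  have A36': "real A \<ge> 36" using A36 by simp
  have d3: "3000 * d^3 / (real A)\<^sup>2 \<ge> 0" "2592 * d^3 / (real A)\<^sup>2 \<le> 3000 * d^3 / (real A)\<^sup>2" using d0 by (auto intro!: divide_right_mono mult_right_mono)
  show ?thesis
  proof (cases "n \<le> B")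
    case nB: True
    have db: "real B - real n = d" using nB by (simp add: d_def)
    have Xd: "d / real A \<le> X n" using X_bounds(1)[of n] unfolding d_def .
    have "(\<Sum>b=n..<B. g b) \<le> (\<Sum>b=n..<B. pi * sqrt 3 / real A * (real B - real b - 1/2) + ((818 / real A) + 100 * ((1 + L) / real A)))"
    proof (rule sum_mono)
      fix b assume b: "b \<in> {n..<B}"
      hence bA: "b + 1 \<le> A" "b < A" using BA by auto
      have b1: "real b + 1 \<le> real B" "real n \<le> real b" using b by auto
      have "\<phi> ((real b + 1/2) * r) \<le> pi * sqrt 3 * (5/6 - (real b + 1/2) * r)"
        using arg01[OF bA(2)] by (intro \<phi>_le_tangent) auto
      also have "\<dots> \<le> pi * sqrt 3 * ((real B - real b - 1/2) / real A + 3 / real A)"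
      proof (rule mult_left_mono)
        have "(5/6 * real A - real B) / real A \<le> 1 / real A" using B Apos by (intro divide_right_mono) auto
        hence "5/6 - real B / real A \<le> 1 / real A" using Apos by (simp add: diff_divide_distrib)
        moreover have "(real B - real b - 1/2) / real A = real B / real A - (real b + 1/2) / real A" by (simp add: diff_divide_distrib add_divide_distrib)
        moreover have "3 / real A = 1 / real A + 2 / real A" by simp
        ultimately show "5/6 - (real b + 1/2) * r \<le> (real B - real b - 1/2) / real A + 3 / real A"
          using arg_lower[OF bA(2)] by linarith
      qed auto
      also have "\<dots> = pi * sqrt 3 / real A * (real B - real b - 1/2) + pi * sqrt 3 * (3 / real A)"
        by (simp add: distrib_left)
      also have "pi * sqrt 3 * (3 / real A) \<le> 6 * (3 / real A)" using pi_sqrt3 by (intro mult_right_mono) auto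
      finally have 1: "\<phi> ((real b + 1/2) * r) \<le> pi * sqrt 3 / real A * (real B - real b - 1/2) + 18 / real A" by simp
      have "1 / (real b + 1) \<le> 1 / (real A / 2)" using b1 n B A36' by (intro divide_left_mono) auto
      hence 2: "100 * (1 / (real b + 1)) \<le> 200 / real A" by simp
      have "1 / (real A - real b) \<le> 1 / (real A / 6)" using b1 B A36' by (intro divide_left_mono) auto
      hence 3: "100 * (1 / (real A - real b)) \<le> 600 / real A" by simp
      have "818 / real A = 18 / real A + 200 / real A + 600 / real A" by (simp add: add_divide_distrib[symmetric])
      thus "g b \<le> pi * sqrt 3 / real A * (real B - real b - 1/2) + ((818 / real A) + 100 * ((1 + L) / real A))"
        using up[OF bA(1)] 1 2 3 unfolding distrib_left by linarith
    qed
    also have "\<dots> = pi * sqrt 3 / real A * (d\<^sup>2 / 2) + d * ((818 / real A) + 100 * ((1 + L) / real A))"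
    proof -
      have "real (B - n) = d" using nB db by (simp add: of_nat_diff)
      thus ?thesis by (simp only: sum_add_const sum_distrib_left[symmetric] sum_half_odd[OF nB] db)
    qed
    also have "d * ((818 / real A) + 100 * ((1 + L) / real A)) = 818 * (d / real A) + 100 * (d * ((1 + L) / real A))"
    proof -
      have "d * ((818 / real A) + 100 * y) = 818 * (d / real A) + 100 * (d * y)" for y by (simp add: distrib_left)
      thus ?thesis .
    qed
    also have "pi * sqrt 3 / real A * (d\<^sup>2 / 2) = pi * sqrt 3 / 2 * d\<^sup>2 / real A" by simp
    finally have "(\<Sum>b=n..<B. g b) \<le> pi * sqrt 3 / 2 * d\<^sup>2 / real A + (818 * (d / real A) + 100 * (d * ((1 + L) / real A)))" .
    moreover have "D n = (\<Sum>b=n..<B. g b)" using nB by (simp add: D_def)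
    ultimately show ?thesis using X_bounds(2)[of n] Xd X0 d3 unfolding dd d_def[symmetric] by linarith
  next
    case False
    hence Bn: "B \<le> n" and db: "real n - real B = d" and d1: "d \<ge> 1" by (auto simp: d_def)
    have Xd: "d / real A \<le> X n" using X_bounds(1)[of n] unfolding d_def .
    have nA: "n \<le> A" using n B Apos by linarith
    have "(\<Sum>b=B..<n. - g b) \<le> (\<Sum>b=B..<n. pi * sqrt 3 / real A * (real b + 1/2 - real B) + ((2592 * d\<^sup>2 / (real A)\<^sup>2 + 12000 / real A) + 6000 * ((1 + L) / real A)))"
    proof (rule sum_mono)
      fix b assume b: "b \<in> {B..<n}"
      hence bA: "b < A" using nA by auto
      have b1: "real b + 1 \<le> real n" "real B \<le> real b" using b by auto
      define x where "x = (real b + 1/2) * r"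
      have xu: "x \<le> (real b + 1/2) / real A" unfolding x_def using mult_left_mono[OF r(2), of "real b + 1/2"] by simp
      have xl: "x \<ge> (real b + 1/2) / real A - 2 / real A" unfolding x_def by (rule arg_lower[OF bA])
      have e1: "(real b + 1/2) / real A = real B / real A + (real b + 1/2 - real B) / real A" by (simp add: add_divide_distrib[symmetric])
      have e2: "real B / real A \<le> 5/6" using B Apos by (simp add: divide_le_eq)
      have "(5/6 * real A - real B) / real A \<le> 1 / real A" using B Apos by (intro divide_right_mono) auto
      hence e3: "5/6 - real B / real A \<le> 1 / real A" using Apos by (simp add: diff_divide_distrib)
      have e4: "(real b + 1/2 - real B) / real A \<le> d / real A" using b1 db Apos by (intro divide_right_mono) auto
      have e5: "(real b + 1/2 - real B) / real A \<ge> 0" using b1 Apos by simp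
      have e6: "d / real A \<le> 1/20" using n Apos unfolding d_def[symmetric] by (simp add: field_simps)
      have e7: "3 / real A = 1 / real A + 2 / real A" "1 / real A \<le> 1 / 36" "d / real A \<ge> 1 / real A" using A36' d1 by (auto intro!: divide_right_mono simp: field_simps)
      have x1: "x - 5/6 \<le> (real b + 1/2 - real B) / real A" using xu e1 e2 by linarith
      have x2: "5/6 - x \<le> 3 / real A" using xl e1 e3 e5 e7 by linarith
      \<comment> \<open>36 = 3 * 12: then 5/6 - 3/A >= 3/4. On the other side 5/6 + 1/20 < 11/12, so
        \<open>\<phi>_ge_tangent\<close> applies.\<close>
      have x3: "3/4 \<le> x" "x \<le> 11/12" using x1 x2 e4 e6 e7 by linarith+
      have "\<bar>x - 5/6\<bar> \<le> 3 * (d / real A)" unfolding abs_le_iff using x1 x2 e4 e7 by linarith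
      hence "\<bar>x - 5/6\<bar>\<^sup>2 \<le> (3 * (d / real A))\<^sup>2" by (intro power_mono) auto
      hence x4: "288 * (x - 5/6)\<^sup>2 \<le> 2592 * d\<^sup>2 / (real A)\<^sup>2" by (simp add: power_mult_distrib power_divide)
      have "\<phi> x \<ge> pi * sqrt 3 * (5/6 - x) - 288 * (x - 5/6)\<^sup>2" using x3 by (intro \<phi>_ge_tangent)
      moreover have "pi * sqrt 3 * (5/6 - x) = - (pi * sqrt 3 * (x - 5/6))" by (simp add: algebra_simps)
      moreover have "pi * sqrt 3 * (x - 5/6) \<le> pi * sqrt 3 * ((real b + 1/2 - real B) / real A)" using x1 by (intro mult_left_mono) auto
      ultimately have 1: "- \<phi> x \<le> pi * sqrt 3 / real A * (real b + 1/2 - real B) + 2592 * d\<^sup>2 / (real A)\<^sup>2" using x4 by simp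
      have "1 / (real b + 1) \<le> 1 / (real A / 2)" using b1 B A36' by (intro divide_left_mono) auto
      hence 2: "6000 * (1 / (real b + 1)) \<le> 12000 / real A" by simp
      have "real b + 1 \<le> 11/12 * real A" using b1 n B Apos by linarith
      from lo[OF this] show "- g b \<le> pi * sqrt 3 / real A * (real b + 1/2 - real B) + ((2592 * d\<^sup>2 / (real A)\<^sup>2 + 12000 / real A) + 6000 * ((1 + L) / real A))"
        using 1 2 unfolding distrib_left x_def by linarith
    qed
    also have "\<dots> = pi * sqrt 3 / real A * (d\<^sup>2 / 2) + d * ((2592 * d\<^sup>2 / (real A)\<^sup>2 + 12000 / real A) + 6000 * ((1 + L) / real A))"
    proof -
      have "real (n - B) = d" using Bn db by (simp add: of_nat_diff)
      thus ?thesis by (simp only: sum_add_const sum_distrib_left[symmetric] sum_half_odd'[OF Bn] db)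
    qed
    also have "d * ((2592 * d\<^sup>2 / (real A)\<^sup>2 + 12000 / real A) + 6000 * ((1 + L) / real A)) = 2592 * d^3 / (real A)\<^sup>2 + (12000 * (d / real A) + 6000 * (d * ((1 + L) / real A)))"
    proof -
      have "d * ((2592 * d\<^sup>2 / (real A)\<^sup>2 + 12000 / real A) + 6000 * y) = 2592 * d^3 / (real A)\<^sup>2 + (12000 * (d / real A) + 6000 * (d * y))" for y
        by (simp add: distrib_left power2_eq_square power3_eq_cube mult_ac)
      thus ?thesis .
    qed
    also have "pi * sqrt 3 / real A * (d\<^sup>2 / 2) = pi * sqrt 3 / 2 * d\<^sup>2 / real A" by simp
    finally have "(\<Sum>b=B..<n. - g b) \<le> pi * sqrt 3 / 2 * d\<^sup>2 / real A + (2592 * d^3 / (real A)\<^sup>2 + (12000 * (d / real A) + 6000 * (d * ((1 + L) / real A))))" .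
    moreover have "D n = (\<Sum>b=B..<n. - g b)" using Bn by (simp add: D_def sum_negf)
    ultimately show ?thesis using X_bounds(2)[of n] Xd X0 d3 unfolding dd d_def[symmetric] by linarith
  qed
qed

end

section \<open>Replacing the digits\<close>

context irrational begin

definition star_digit :: "nat \<Rightarrow> nat" where "star_digit k = nat \<lfloor>(5/6::real) * real (digit (Suc k))\<rfloor>"
definition star_tail :: "nat \<Rightarrow> nat \<Rightarrow> nat" where "star_tail j K = (\<Sum>l=j..<K. star_digit l * q l)"
text \<open>The displacement modulo 1, oriented by (-1)^j, that the N*-digits above level j produce
  in the rotation; \<open>star_tail_\<alpha>\<close> states this.\<close>

definition star_shift :: "nat \<Rightarrow> nat \<Rightarrow> real" where "star_shift j K = (-1)^j * (\<Sum>l=Suc j..<K. real (star_digit l) * ((-1)^l * \<delta> l))"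
definition ln_sinprod :: "nat \<Rightarrow> real" where "ln_sinprod N = (\<Sum>n=1..N. ln \<bar>2 * sin (pi * (real n * \<alpha>))\<bar>)"

lemma sin_nonzero: "n \<ge> 1 \<Longrightarrow> sin (pi * (real n * \<alpha>)) \<noteq> 0"
proof
  assume n: "n \<ge> 1" and "sin (pi * (real n * \<alpha>)) = 0"
  then obtain m :: int where "pi * (real n * \<alpha>) = of_int m * pi" by (auto simp: sin_zero_iff_int2)
  hence "real n * \<alpha> = of_int m" by simp
  hence "\<alpha> = of_int m / of_nat n" using n by (simp add: field_simps)
  hence "\<alpha> \<in> \<rat>" by simp
  thus False using irrational by simp
qed

lemma sinprod_pos: "sinprod N \<alpha> > 0"
  unfolding sinprod_def using sin_nonzero by (intro prod_pos) (auto simp: mult.assoc)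

lemma ln_sinprod: "ln (sinprod N \<alpha>) = ln_sinprod N"
proof -
  have "ln (sinprod N \<alpha>) = (\<Sum>n=1..N. ln \<bar>2 * sin (pi * real n * \<alpha>)\<bar>)"
    unfolding sinprod_def by (rule ln_prod) (use sin_nonzero in \<open>auto simp: mult.assoc\<close>)
  thus ?thesis by (simp add: ln_sinprod_def mult.assoc)
qed

lemma star_digit_bounds: "real (star_digit k) \<le> 5/6 * real (digit (Suc k))" "5/6 * real (digit (Suc k)) - 1 < real (star_digit k)"
proof -
  have "(0::int) \<le> \<lfloor>5/6 * real (digit (Suc k))\<rfloor>" by simp
  hence "real (star_digit k) = of_int \<lfloor>(5/6::real) * real (digit (Suc k))\<rfloor>" by (simp add: star_digit_def)
  thus "real (star_digit k) \<le> 5/6 * real (digit (Suc k))" "5/6 * real (digit (Suc k)) - 1 < real (star_digit k)" by linarith+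
qed

lemma star_digit_less: "star_digit k < digit (Suc k)"
  using star_digit_bounds(1)[of k] digit_ge_1[of k] by linarith

lemma star_tail_rec: "j < K \<Longrightarrow> star_tail j K = star_digit j * q j + star_tail (Suc j) K"
  unfolding star_tail_def by (simp add: sum.atLeast_Suc_lessThan)

lemma star_shift_rec: "Suc j < K \<Longrightarrow> star_shift j K = - (real (star_digit (Suc j)) * \<delta> (Suc j) + star_shift (Suc j) K)"
proof -
  assume j: "Suc j < K"
  define R where "R = (\<Sum>l=Suc (Suc j)..<K. real (star_digit l) * ((-1)^l * \<delta> l))"
  have "star_shift j K = (-1)^j * (real (star_digit (Suc j)) * ((-1)^Suc j * \<delta> (Suc j)) + R)"
    unfolding star_shift_def R_def using j by (simp add: sum.atLeast_Suc_lessThan)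
  moreover have "star_shift (Suc j) K = - ((-1)^j * R)" by (simp add: star_shift_def R_def)
  moreover have "(-1)^j * (-1)^j = (1::real)" by (simp flip: power_mult_distrib)
  hence "(-1)^j * (y * ((-1)^Suc j * d)) = - (y * d)" for y d :: real
    by (simp add: algebra_simps)
  ultimately show ?thesis by (simp only: distrib_left minus_add_distrib)
qed

text \<open>Digits of at most 5/6 of their maximum use at most 5/6 of \<delta>_j = a_(j+2)
  \<delta>_(j+1) + \<delta>_(j+2) on one side, and the alternating signs leave 5/6 \<delta>_(j+1) on
  the other; the pair of bounds reproduces itself.\<close>

lemma star_shift_bounds: "j < K \<Longrightarrow> - (5/6) * \<delta> j \<le> star_shift j K \<and> star_shift j K \<le> 5/6 * \<delta> (Suc j)"
proof (induction "K - j" arbitrary: j)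
  case (Suc m)
  show ?case
  proof (cases "Suc j < K")
    case True
    have IH: "- (5/6) * \<delta> (Suc j) \<le> star_shift (Suc j) K" "star_shift (Suc j) K \<le> 5/6 * \<delta> (Suc (Suc j))"
      using Suc.hyps(1)[of "Suc j"] Suc.hyps(2) True by auto
    have "real (star_digit (Suc j)) * \<delta> (Suc j) \<le> 5/6 * real (digit (j+2)) * \<delta> (Suc j)"
      using star_digit_bounds(1)[of "Suc j"] \<delta>_pos[of "Suc j"] by (intro mult_right_mono) auto
    also have "\<dots> = 5/6 * (real (digit (j+2)) * \<delta> (Suc j))" by (rule mult.assoc)
    finally have "real (star_digit (Suc j)) * \<delta> (Suc j) \<le> 5/6 * (real (digit (j+2)) * \<delta> (Suc j))" .
    moreover have "real (star_digit (Suc j)) * \<delta> (Suc j) \<ge> 0" using \<delta>_pos[of "Suc j"] by simp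
    moreover have "\<delta> j = real (digit (j+2)) * \<delta> (Suc j) + \<delta> (Suc (Suc j))" using \<delta>_Suc_Suc[of j] by simp
    ultimately show ?thesis unfolding star_shift_rec[OF True] using IH by (intro conjI; linarith)
  next
    case False
    hence "star_shift j K = 0" by (simp add: star_shift_def)
    thus ?thesis using \<delta>_pos[of j] \<delta>_pos[of "Suc j"] by simp
  qed
qed simp

lemma q_\<alpha>: "real (q k) * \<alpha> = (-1)^k * \<delta> k + of_int (p k)"
proof -
  have "(-1)^k * (-1)^k = (1::real)" by (simp flip: power_mult_distrib)
  thus ?thesis by (simp add: \<delta>_def mult.assoc[symmetric])
qed

lemma star_tail_\<alpha>: "\<exists>m::int. real (star_tail (Suc j) K) * \<alpha> = (-1)^j * star_shift j K + of_int m"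
proof -
  have "real (star_tail (Suc j) K) * \<alpha> = (\<Sum>l=Suc j..<K. real (star_digit l) * (real (q l) * \<alpha>))"
    by (simp add: star_tail_def sum_distrib_right mult.assoc)
  also have "\<dots> = (\<Sum>l=Suc j..<K. real (star_digit l) * ((-1)^l * \<delta> l)) + (\<Sum>l=Suc j..<K. of_int (int (star_digit l) * p l))"
    unfolding q_\<alpha> by (simp add: distrib_left sum.distrib)
  also have "(\<Sum>l=Suc j..<K. of_int (int (star_digit l) * p l)) = real_of_int (\<Sum>l=Suc j..<K. int (star_digit l) * p l)" by simp
  also have "(\<Sum>l=Suc j..<K. real (star_digit l) * ((-1)^l * \<delta> l)) = (-1)^j * star_shift j K"
  proof -
    have "(-1)^j * (-1)^j = (1::real)" by (simp flip: power_mult_distrib)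
    thus ?thesis by (simp add: star_shift_def mult.assoc[symmetric])
  qed
  finally show ?thesis by blast
qed

text \<open>One more unit at level j appends q_j factors, whose indices are M+1, ..., M+q_j shifted
  by U. Modulo 1, the displacement U \<alpha> is (-1)^j (b \<delta>_j + E) with E =
  \<open>star_shift j K\<close>.\<close>

lemma ln_sinprod_step: "ln_sinprod (M + Suc b * q j + star_tail (Suc j) K) - ln_sinprod (M + b * q j + star_tail (Suc j) K) = block_log j M (real b * \<delta> j + star_shift j K)"
proof -
  define U where "U = b * q j + star_tail (Suc j) K"
  obtain m where m: "real (star_tail (Suc j) K) * \<alpha> = (-1)^j * star_shift j K + of_int m" using star_tail_\<alpha> by blast
  have U: "real U * \<alpha> = (-1)^j * (real b * \<delta> j + star_shift j K) + of_int (int b * p j + m)"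
  proof -
    have "real U * \<alpha> = real b * (real (q j) * \<alpha>) + real (star_tail (Suc j) K) * \<alpha>" by (simp add: U_def algebra_simps)
    thus ?thesis unfolding q_\<alpha> m by (simp add: algebra_simps)
  qed
  have e: "M + Suc b * q j + star_tail (Suc j) K = (M + U) + q j" "M + b * q j + star_tail (Suc j) K = M + U" by (simp_all add: U_def)
  have "ln_sinprod (M + U + q j) - ln_sinprod (M + U) = (\<Sum>n=(M+U)+1..(M+U)+q j. ln \<bar>2 * sin (pi * (real n * \<alpha>))\<bar>)"
    unfolding ln_sinprod_def using sum.ub_add_nat[of 1 "M + U" "\<lambda>n. ln \<bar>2 * sin (pi * (real n * \<alpha>))\<bar>" "q j"] by simp
  also have "\<dots> = (\<Sum>n=M+1..M+q j. ln \<bar>2 * sin (pi * (real (n + U) * \<alpha>))\<bar>)"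
    by (rule sum.reindex_bij_witness[of _ "\<lambda>n. n + U" "\<lambda>n. n - U"]) auto
  also have "\<dots> = block_log j M (real b * \<delta> j + star_shift j K)"
    unfolding block_log_def
  proof (rule sum.cong)
    fix n
    have "real (n + U) * \<alpha> = real n * \<alpha> + real U * \<alpha>" by (simp add: distrib_right)
    also have "\<dots> = (real n * \<alpha> + (-1)^j * (real b * \<delta> j + star_shift j K)) + of_int (int b * p j + m)" unfolding U by (rule add.assoc[symmetric])
    finally have "\<bar>sin (pi * (real (n + U) * \<alpha>))\<bar> = \<bar>sin (pi * (real n * \<alpha> + (-1)^j * (real b * \<delta> j + star_shift j K)))\<bar>"
      by (simp only: abs_sin_pi_add_int)
    thus "ln \<bar>2 * sin (pi * (real (n + U) * \<alpha>))\<bar> = ln \<bar>2 * sin (pi * (real n * \<alpha> + (-1)^j * (real b * \<delta> j + star_shift j K)))\<bar>"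
      by (simp only: abs_mult)
  qed simp
  finally show ?thesis unfolding e .
qed

lemma ln_sinprod_multi: "n \<le> m \<Longrightarrow> ln_sinprod (M + m * q j + star_tail (Suc j) K) - ln_sinprod (M + n * q j + star_tail (Suc j) K) = (\<Sum>b=n..<m. block_log j M (real b * \<delta> j + star_shift j K))"
proof (induction m rule: dec_induct)
  case (step m)
  thus ?case using ln_sinprod_step[of M m j K] by simp
qed simp

text \<open>Change of the logarithm when the digit n of level j becomes that of N*, with the digits
  above already replaced and the lower part M not yet touched.\<close>

definition digit_gain :: "nat \<Rightarrow> nat \<Rightarrow> nat \<Rightarrow> nat \<Rightarrow> real" where
  "digit_gain j K M n = (\<Sum>b=n..<star_digit j. block_log j M (real b * \<delta> j + star_shift j K)) - (\<Sum>b=star_digit j..<n. block_log j M (real b * \<delta> j + star_shift j K))"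

lemma ln_sinprod_gain: "j < K \<Longrightarrow> ln_sinprod (M + n * q j + star_tail (Suc j) K) = ln_sinprod (M + star_tail j K) - digit_gain j K M n"
  using ln_sinprod_multi[of n "star_digit j" M j K] ln_sinprod_multi[of "star_digit j" n M j K]
  by (cases "n \<le> star_digit j") (auto simp: digit_gain_def star_tail_rec add.assoc[symmetric])

lemma q\<delta>_range: "1 / (real (digit (Suc j)) + 2) \<le> real (q j) * \<delta> j" "real (q j) * \<delta> j \<le> 1 / real (digit (Suc j))"
proof -
  define r where "r = real (q j) * \<delta> j"
  define s where "s = real (q' j) / real (q j) + \<delta> (Suc j) / \<delta> j"
  have qp: "real (q j) > 0" using q_ge_1[of j] by simp
  have dp: "\<delta> j > 0" "\<delta> (Suc j) > 0" by (rule \<delta>_pos)+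
  have r: "r > 0" using qp dp by (simp add: r_def)
  have A: "real (digit (Suc j)) \<ge> 1" using digit_ge_1[of j] by simp
  have "real (q' j) / real (q j) \<le> 1" "0 \<le> real (q' j) / real (q j)" "\<delta> (Suc j) / \<delta> j \<le> 1" "0 \<le> \<delta> (Suc j) / \<delta> j"
    using qp q'_le[of j] dp \<delta>_less[of j] by auto
  hence s: "0 \<le> s" "s \<le> 2" unfolding s_def by linarith+
  have "1 / r = real (digit (Suc j)) + s" unfolding r_def s_def q\<delta>_inverse by simp
  hence "r = 1 / (real (digit (Suc j)) + s)" using r s A by (simp add: field_simps)
  moreover have "1 / (real (digit (Suc j)) + 2) \<le> 1 / (real (digit (Suc j)) + s)" using s A by (intro divide_left_mono) auto
  moreover have "1 / (real (digit (Suc j)) + s) \<le> 1 / real (digit (Suc j))" using s A by (intro divide_left_mono) auto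
  ultimately show "1 / (real (digit (Suc j)) + 2) \<le> real (q j) * \<delta> j" "real (q j) * \<delta> j \<le> 1 / real (digit (Suc j))"
    unfolding r_def by auto
qed

lemma digit_change_gain:
  assumes "j < K" "M < q j"
  shows "digit_change (digit (Suc j)) (star_digit j) (real (q j) * \<delta> j) (\<lambda>b. block_log j M (real b * \<delta> j + star_shift j K)) (cot_const j M)"
proof
  note E = star_shift_bounds[OF assms(1)]
  show "1 \<le> digit (Suc j)" by (rule digit_ge_1)
  show "real (star_digit j) \<le> 5/6 * real (digit (Suc j))" "5/6 * real (digit (Suc j)) - 1 < real (star_digit j)" by (rule star_digit_bounds)+
  show "1 / (real (digit (Suc j)) + 2) \<le> real (q j) * \<delta> j" "real (q j) * \<delta> j \<le> 1 / real (digit (Suc j))" by (rule q\<delta>_range)+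
  have "ln (max 1 (real (digit j))) \<ge> 0" by simp
  thus "1 \<le> cot_const j M" unfolding cot_const_def using \<tau>_nonneg[of j] by (cases "bulk j M") auto
  show "block_log j M (real b * \<delta> j + star_shift j K) \<le> \<phi> ((real b + 1/2) * (real (q j) * \<delta> j)) + 100 * (1 / (real b + 1) + 1 / (real (digit (Suc j)) - real b) + (1 + cot_const j M) / real (digit (Suc j)))"
    if "b + 1 \<le> digit (Suc j)" for b using E assms(2) that by (intro block_log_bounds(1)) auto
  show "block_log j M (real b * \<delta> j + star_shift j K) \<ge> \<phi> ((real b + 1/2) * (real (q j) * \<delta> j)) - 6000 * (1 / (real b + 1) + (1 + cot_const j M) / real (digit (Suc j)))"
    if "real b + 1 \<le> 11/12 * real (digit (Suc j))" for b using E assms(2) that by (intro block_log_bounds(2)) auto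
qed

definition digit_dist :: "nat \<Rightarrow> nat \<Rightarrow> real" where "digit_dist j n = \<bar>real n - real (star_digit j)\<bar>"
text \<open>445 = 441 + 4, where the 4 bounds ln 36 and covers a preceding partial quotient too
  small for \<open>bulk_Suc\<close>.\<close>

definition lin_coeff :: "nat \<Rightarrow> real" where "lin_coeff j = 50000 * (445 + 10 * \<tau> j)"
text \<open>The price of a digit near the ends of its range, paid at the next level.\<close>

definition edge_cost :: "nat \<Rightarrow> nat \<Rightarrow> real" where "edge_cost j M = (if bulk j M then 0 else 50000 * ln (max 1 (real (digit j))))"

lemma digit_dist_le: "n \<le> digit (Suc j) \<Longrightarrow> digit_dist j n \<le> real (digit (Suc j))" and digit_dist_nonneg: "digit_dist j n \<ge> 0"
proof -
  assume "n \<le> digit (Suc j)"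
  thus "digit_dist j n \<le> real (digit (Suc j))" using star_digit_less[of j] unfolding digit_dist_def by simp
qed (simp add: digit_dist_def)

text \<open>As the distance is at most a_(j+1), the logarithm in \<open>cot_const\<close> costs at
  most the amount \<open>edge_cost\<close>, which does not depend on n; the remainder stays linear
  in the distance.\<close>

lemma cot_const_X:
  assumes "n \<le> digit (Suc j)"
  shows "50000 * (cot_const j M * digit_dist j n / real (digit (Suc j))) \<le> lin_coeff j * digit_dist j n / real (digit (Suc j)) + edge_cost j M"
proof -
  have A: "real (digit (Suc j)) > 0" using digit_ge_1[of j] by simp
  define y where "y = digit_dist j n / real (digit (Suc j))"
  have y: "0 \<le> y" "y \<le> 1" using digit_dist_le[OF assms] digit_dist_nonneg[of j n] A by (auto simp: y_def)
  have x0: "edge_cost j M \<ge> 0" by (simp add: edge_cost_def)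
  have "50000 * cot_const j M \<le> lin_coeff j + edge_cost j M" by (simp add: cot_const_def lin_coeff_def edge_cost_def)
  hence "50000 * cot_const j M * y \<le> (lin_coeff j + edge_cost j M) * y" using y by (intro mult_right_mono) auto
  also have "\<dots> = lin_coeff j * y + edge_cost j M * y" by (rule distrib_right)
  also have "edge_cost j M * y \<le> edge_cost j M * 1" using y x0 by (intro mult_left_mono) auto
  finally show ?thesis by (simp add: y_def)
qed

lemma digit_gain_lower:
  assumes "j < K" "M < q j" "n \<le> digit (Suc j)" and C: "C \<ge> 0" "6000 * (1 + ln (real (digit (Suc j)))) \<le> 1/300 * real (digit (Suc j)) + C / real (digit (Suc j))"
  shows "digit_gain j K M n \<ge> (digit_dist j n)\<^sup>2 / (32 * real (digit (Suc j))) - (C + 44) / real (digit (Suc j)) - lin_coeff j * digit_dist j n / real (digit (Suc j)) - edge_cost j M"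
    and "digit_gain j K M n \<ge> pi * sqrt 3 / 2 * (digit_dist j n)\<^sup>2 / real (digit (Suc j)) - 1152 * (digit_dist j n)^3 / (real (digit (Suc j)))\<^sup>2 - (C + 44) / real (digit (Suc j)) - lin_coeff j * digit_dist j n / real (digit (Suc j)) - edge_cost j M"
proof -
  interpret dc: digit_change "digit (Suc j)" "star_digit j" "real (q j) * \<delta> j" "\<lambda>b. block_log j M (real b * \<delta> j + star_shift j K)" "cot_const j M"
    by (rule digit_change_gain[OF assms(1,2)])
  have D: "dc.D n = digit_gain j K M n" by (simp add: dc.D_def digit_gain_def)
  have X: "dc.X n = cot_const j M * digit_dist j n / real (digit (Suc j))" by (simp add: dc.X_def digit_dist_def)
  have sq: "(real n - real (star_digit j))\<^sup>2 = (digit_dist j n)\<^sup>2" by (simp add: digit_dist_def)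
  have "(C + 41) / real (digit (Suc j)) \<le> (C + 44) / real (digit (Suc j))" by (intro divide_right_mono) auto
  thus "digit_gain j K M n \<ge> (digit_dist j n)\<^sup>2 / (32 * real (digit (Suc j))) - (C + 44) / real (digit (Suc j)) - lin_coeff j * digit_dist j n / real (digit (Suc j)) - edge_cost j M"
    using dc.D_ge_coarse[OF assms(3) C] cot_const_X[OF assms(3), of M] unfolding D X sq by linarith
  show "digit_gain j K M n \<ge> pi * sqrt 3 / 2 * (digit_dist j n)\<^sup>2 / real (digit (Suc j)) - 1152 * (digit_dist j n)^3 / (real (digit (Suc j)))\<^sup>2 - (C + 44) / real (digit (Suc j)) - lin_coeff j * digit_dist j n / real (digit (Suc j)) - edge_cost j M"
    using dc.D_ge_fine[OF assms(3) C] cot_const_X[OF assms(3), of M] unfolding D X sq digit_dist_def[symmetric] by linarith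
qed

lemma digit_gain_upper:
  assumes "j < K" "M < q j" "digit_dist j n \<le> real (digit (Suc j)) / 20" "digit (Suc j) \<ge> 36" and b: "bulk j M \<or> digit j < 36"
  shows "digit_gain j K M n \<le> pi * sqrt 3 / 2 * (digit_dist j n)\<^sup>2 / real (digit (Suc j)) + 3000 * (digit_dist j n)^3 / (real (digit (Suc j)))\<^sup>2 + lin_coeff j * digit_dist j n / real (digit (Suc j))"
proof -
  interpret dc: digit_change "digit (Suc j)" "star_digit j" "real (q j) * \<delta> j" "\<lambda>b. block_log j M (real b * \<delta> j + star_shift j K)" "cot_const j M"
    by (rule digit_change_gain[OF assms(1,2)])
  have D: "dc.D n = digit_gain j K M n" by (simp add: dc.D_def digit_gain_def)
  have X: "dc.X n = cot_const j M * digit_dist j n / real (digit (Suc j))" by (simp add: dc.X_def digit_dist_def)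
  have sq: "(real n - real (star_digit j))\<^sup>2 = (digit_dist j n)\<^sup>2" by (simp add: digit_dist_def)
  have "cot_const j M \<le> 445 + 10 * \<tau> j"
  proof (cases "bulk j M")
    case False
    hence "max 1 (real (digit j)) \<le> 36" using b by auto
    hence "ln (max 1 (real (digit j))) \<le> ln 36" by (subst ln_le_cancel_iff) auto
    also have "ln 36 \<le> (4::real)"
    proof -
      have "1 + 1 + 1\<^sup>2 / 2 \<le> exp (1::real)" by (rule exp_lower_Taylor_quadratic) simp
      hence "(5/2) ^ 4 \<le> exp (1::real) ^ 4" by (intro power_mono) auto
      also have "\<dots> = exp 4" using exp_of_nat_mult[of 4 "1::real"] by simp
      finally have "36 \<le> exp (4::real)" by (simp add: power4_eq_xxxx)
      hence "ln 36 \<le> ln (exp (4::real))" by (subst ln_le_cancel_iff) auto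
      thus ?thesis by simp
    qed
    finally show ?thesis using False by (simp add: cot_const_def)
  qed (simp add: cot_const_def)
  hence "50000 * (cot_const j M * (digit_dist j n / real (digit (Suc j)))) \<le> 50000 * ((445 + 10 * \<tau> j) * (digit_dist j n / real (digit (Suc j))))"
    using digit_dist_nonneg[of j n] by (intro mult_left_mono mult_right_mono) auto
  hence "50000 * (cot_const j M * digit_dist j n / real (digit (Suc j))) \<le> lin_coeff j * digit_dist j n / real (digit (Suc j))"
    by (simp only: lin_coeff_def times_divide_eq_right mult.assoc)
  thus ?thesis using dc.D_le_fine[of n] assms(3,4) unfolding D X sq digit_dist_def[symmetric] by linarith
qed

lemma digit_le: "N < q (Suc j) \<Longrightarrow> N div q j \<le> digit (Suc j)"
proof -
  assume "N < q (Suc j)"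
  hence "N < (digit (Suc j) + 1) * q j" using q'_le[of j] by (simp add: q_Suc)
  hence "N div q j < digit (Suc j) + 1" using q_ge_1[of j] by (simp add: less_mult_imp_div_less)
  thus ?thesis by simp
qed

text \<open>A digit near 5/6 a places the new lower part near 5/6 q_(j+1), inside the range from 1/2
  to 19/20. So for a >= 36 an edge cost at level j + 1 can only follow a digit far from that of N*
  at level j.\<close>

lemma bulk_Suc:
  assumes "M < q j" "digit_dist j n \<le> real (digit (Suc j)) / 20" "digit (Suc j) \<ge> 36"
  shows "bulk (Suc j) (M + n * q j)"
proof -
  define a Q where "a = real (digit (Suc j))" and "Q = real (q j)"
  have a: "a \<ge> 36" using assms(3) by (simp add: a_def)
  have Q: "Q \<ge> 1" using q_ge_1[of j] by (simp add: Q_def)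
  have qs: "real (q (Suc j)) = a * Q + real (q' j)" by (simp add: q_Suc a_def Q_def)
  have q'b: "0 \<le> real (q' j)" "real (q' j) \<le> Q" using q'_le[of j] by (auto simp: Q_def)
  have M: "real M + 1 \<le> Q" using assms(1) unfolding Q_def by linarith
  have n: "5/6 * a - 1 - a / 20 \<le> real n" "real n \<le> 5/6 * a + a / 20"
    using assms(2) star_digit_bounds[of j] unfolding digit_dist_def a_def by linarith+
  have "(a + 1) / 2 * Q \<le> real n * Q" using n a Q by (intro mult_right_mono) auto
  moreover have e: "real (M + n * q j) = real M + real n * Q" by (simp add: Q_def)
  moreover have "(a + 1) / 2 * Q = a * Q / 2 + Q / 2" by (simp add: field_simps)
  ultimately have 1: "real (q (Suc j)) / 2 \<le> real (M + n * q j)" unfolding qs e using q'b of_nat_0_le_iff[of M] unfolding add_divide_distrib by linarith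
  have "(real n + 1) * Q \<le> 19/20 * a * Q" using n a Q by (intro mult_right_mono) auto
  moreover have "(real n + 1) * Q = real n * Q + Q" by (simp add: distrib_right)
  ultimately have 2: "real (M + n * q j) + 1 \<le> 19/20 * real (q (Suc j))" unfolding qs e distrib_left mult.assoc using q'b M by linarith
  show ?thesis using 1 2 by (simp add: bulk_def)
qed

text \<open>The digits are split off by division from the top, which is the Ostrowski expansion of
  N.\<close>

fun digitwise :: "(nat \<Rightarrow> nat \<Rightarrow> real) \<Rightarrow> nat \<Rightarrow> nat \<Rightarrow> real" where
  "digitwise u 0 N = 0"
| "digitwise u (Suc j) N = u j (N div q j) + digitwise u j (N mod q j)"

text \<open>The edge cost paid at a level is the one credited one level below, so the costs
  telescope along the digits; at level 0 the cost is zero.\<close>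

lemma ln_sinprod_upper:
  assumes u: "\<And>j M n. j < K \<Longrightarrow> M < q j \<Longrightarrow> n \<le> digit (Suc j) \<Longrightarrow> - digit_gain j K M n \<le> u j n + edge_cost j M - edge_cost (Suc j) (M + n * q j)"
    and "j \<le> K" "N < q j"
  shows "ln_sinprod (N + star_tail j K) - ln_sinprod (star_tail 0 K) \<le> digitwise u j N - edge_cost j N"
  using assms(2,3)
proof (induction j arbitrary: N)
  case 0
  thus ?case by (simp add: edge_cost_def bulk_def)
next
  case (Suc j)
  define n M where "n = N div q j" and "M = N mod q j"
  have M: "M < q j" using q_ge_1[of j] by (simp add: M_def)
  have N: "N = M + n * q j" by (simp only: n_def M_def mod_div_mult_eq)
  have n: "n \<le> digit (Suc j)" using digit_le Suc.prems(2) by (simp add: n_def)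
  have "ln_sinprod (N + star_tail (Suc j) K) = ln_sinprod (M + star_tail j K) - digit_gain j K M n" unfolding N using ln_sinprod_gain[of j K M n] Suc.prems by simp
  moreover have "ln_sinprod (M + star_tail j K) - ln_sinprod (star_tail 0 K) \<le> digitwise u j M - edge_cost j M" using Suc.IH[OF _ M] Suc.prems by simp
  moreover have "- digit_gain j K M n \<le> u j n + edge_cost j M - edge_cost (Suc j) N" using u[of j M n] M n Suc.prems N by simp
  moreover have "digitwise u (Suc j) N = u j n + digitwise u j M" by (simp add: n_def M_def)
  ultimately show ?case by linarith
qed

fun admissible :: "(nat \<Rightarrow> nat \<Rightarrow> bool) \<Rightarrow> nat \<Rightarrow> nat \<Rightarrow> bool" where
  "admissible g 0 N = True"
| "admissible g (Suc j) N = (g j (N div q j) \<and> admissible g j (N mod q j))"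

text \<open>The second conjunct is an invariant: it is what \<open>digit_gain_upper\<close> demands
  at the next level, and \<open>bulk_Suc\<close> restores it, so no edge cost ever arises. The digit
  of N* is allowed for every A since it changes nothing.\<close>

lemma ln_sinprod_lower:
  assumes g: "\<And>j n. g j n \<Longrightarrow> n = star_digit j \<or> (digit (Suc j) \<ge> 36 \<and> digit_dist j n \<le> real (digit (Suc j)) / 20)"
    and "j \<le> K" "N < q j" "admissible g j N"
  shows "ln_sinprod (N + star_tail j K) - ln_sinprod (star_tail 0 K) \<ge> digitwise (\<lambda>j n. - (pi * sqrt 3 / 2 * (digit_dist j n)\<^sup>2 / real (digit (Suc j)) + 3000 * (digit_dist j n)^3 / (real (digit (Suc j)))\<^sup>2 + lin_coeff j * digit_dist j n / real (digit (Suc j)))) j N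
     \<and> (bulk j N \<or> digit j < 36)"
  using assms(2,3,4)
proof (induction j arbitrary: N)
  case 0
  thus ?case by (simp add: bulk_def)
next
  case (Suc j)
  define n M where "n = N div q j" and "M = N mod q j"
  have M: "M < q j" using q_ge_1[of j] by (simp add: M_def)
  have N: "N = M + n * q j" by (simp only: n_def M_def mod_div_mult_eq)
  have gd: "g j n" "admissible g j M" using Suc.prems(3) by (auto simp: n_def M_def)
  have e: "ln_sinprod (N + star_tail (Suc j) K) = ln_sinprod (M + star_tail j K) - digit_gain j K M n" unfolding N using ln_sinprod_gain[of j K M n] Suc.prems by simp
  have IH: "ln_sinprod (M + star_tail j K) - ln_sinprod (star_tail 0 K) \<ge> digitwise (\<lambda>j n. - (pi * sqrt 3 / 2 * (digit_dist j n)\<^sup>2 / real (digit (Suc j)) + 3000 * (digit_dist j n)^3 / (real (digit (Suc j)))\<^sup>2 + lin_coeff j * digit_dist j n / real (digit (Suc j)))) j M"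
    and b: "bulk j M \<or> digit j < 36" using Suc.IH[OF _ M gd(2)] Suc.prems by auto
  have 1: "digit_gain j K M n \<le> pi * sqrt 3 / 2 * (digit_dist j n)\<^sup>2 / real (digit (Suc j)) + 3000 * (digit_dist j n)^3 / (real (digit (Suc j)))\<^sup>2 + lin_coeff j * digit_dist j n / real (digit (Suc j))"
  proof (cases "n = star_digit j")
    case True
    thus ?thesis by (simp add: digit_gain_def digit_dist_def)
  next
    case False
    thus ?thesis using g[OF gd(1)] M b Suc.prems by (intro digit_gain_upper) auto
  qed
  have 2: "bulk (Suc j) N \<or> digit (Suc j) < 36"
  proof (cases "digit (Suc j) < 36")
    case False
    hence "digit_dist j n \<le> real (digit (Suc j)) / 20" using g[OF gd(1)] by (auto simp: digit_dist_def)
    thus ?thesis unfolding N using bulk_Suc[OF M] False by simp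
  qed simp
  show ?case using e IH 1 2 by (simp add: n_def[symmetric] M_def[symmetric])
qed

end

section \<open>Discrete Laplace method\<close>

definition gint :: "real \<Rightarrow> real" where "gint y = integral {0..y} (\<lambda>x. exp (- x\<^sup>2))"

lemma gint_0 [simp]: "gint 0 = 0" by (simp add: gint_def)

lemma gint_increment:
  assumes "0 \<le> x" "x \<le> y"
  shows "(y - x) * exp (- y\<^sup>2) \<le> gint y - gint x" "gint y - gint x \<le> (y - x) * exp (- x\<^sup>2)"
proof -
  have int: "(\<lambda>x. exp (- x\<^sup>2)) integrable_on {a..b}" for a b :: real
    by (intro integrable_continuous_real continuous_intros)
  have eq: "gint y - gint x = integral {x..y} (\<lambda>x. exp (- x\<^sup>2))"
    unfolding gint_def using Henstock_Kurzweil_Integration.integral_combine[OF assms int] by simp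
  have "integral {x..y} (\<lambda>_. exp (- y\<^sup>2)) \<le> integral {x..y} (\<lambda>x. exp (- x\<^sup>2))"
    using assms by (intro integral_le int) auto
  thus "(y - x) * exp (- y\<^sup>2) \<le> gint y - gint x" unfolding eq using assms by simp
  have "integral {x..y} (\<lambda>x. exp (- x\<^sup>2)) \<le> integral {x..y} (\<lambda>_. exp (- x\<^sup>2))"
    using assms by (intro integral_le int) (auto intro: power_mono)
  thus "gint y - gint x \<le> (y - x) * exp (- x\<^sup>2)" unfolding eq using assms by simp
qed

lemma gint_mono: "0 \<le> x \<Longrightarrow> x \<le> y \<Longrightarrow> gint x \<le> gint y"
  using gint_increment(1)[of x y] by (smt (verit) exp_ge_zero mult_nonneg_nonneg)

lemma gint_limit: "(gint \<longlongrightarrow> sqrt pi / 2) at_top"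
proof -
  define f :: "real \<Rightarrow> real" where "f = (\<lambda>x. indicator {0..} x *\<^sub>R exp (- x\<^sup>2))"
  have f: "has_bochner_integral lborel f (sqrt pi / 2)" unfolding f_def by (rule gaussian_moment_0)
  have "((\<lambda>y. \<integral>x. indicator {..y} x *\<^sub>R f x \<partial>lborel) \<longlongrightarrow> (\<integral>x. f x \<partial>lborel)) at_top"
    using f by (intro tendsto_integral_at_top) (auto intro: integrable.intros)
  moreover have "(\<integral>x. f x \<partial>lborel) = sqrt pi / 2" using f by (rule has_bochner_integral_integral_eq)
  moreover have "(\<integral>x. indicator {..y} x *\<^sub>R f x \<partial>lborel) = gint y" for y
  proof -
    have "(\<integral>x. indicator {..y} x *\<^sub>R f x \<partial>lborel) = (LINT x:{0..y}|lborel. exp (- x\<^sup>2))"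
      unfolding set_lebesgue_integral_def f_def by (rule Bochner_Integration.integral_cong) (auto simp: indicator_def)
    also have "\<dots> = gint y"
      unfolding gint_def by (intro set_borel_integral_eq_integral borel_integrable_atLeastAtMost' continuous_intros)
    finally show ?thesis .
  qed
  ultimately show ?thesis by simp
qed

lemma gint_upper: "0 \<le> y \<Longrightarrow> gint y \<le> sqrt pi / 2"
  by (rule tendsto_lowerbound[OF gint_limit])
    (auto intro!: eventually_mono[OF eventually_ge_at_top[of y]] gint_mono)

text \<open>The function gint x + exp (- x^2/2) decreases for x >= 1, because exp (- x^2) <= x exp
  (- x^2/2), and tends to sqrt pi/2.\<close>

lemma gint_tail: "y \<ge> 1 \<Longrightarrow> sqrt pi / 2 - exp (- y\<^sup>2 / 2) \<le> gint y"
proof -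
  assume y: "y \<ge> 1"
  have step: "gint z \<le> gint y + exp (- y\<^sup>2 / 2)" if yz: "y \<le> z" for z
  proof -
    define h where "h x = gint x + exp (- x\<^sup>2 / 2)" for x
    have "h z \<le> h y"
    proof (rule DERIV_nonpos_imp_decreasing_open[OF yz])
      fix x assume x: "y < x" "x < z"
      have "(gint has_real_derivative exp (- x\<^sup>2)) (at x within {0..z})"
        unfolding gint_def by (intro integral_has_real_derivative continuous_intros) (use x y in auto)
      hence "(gint has_real_derivative exp (- x\<^sup>2)) (at x)"
        using x y by (subst (asm) at_within_interior) auto
      hence d: "(h has_real_derivative (exp (- x\<^sup>2) - x * exp (- x\<^sup>2 / 2))) (at x)"
        unfolding h_def by (auto intro!: derivative_eq_intros)
      have "exp (- x\<^sup>2) \<le> exp (- x\<^sup>2 / 2)" by simp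
      moreover have "1 * exp (- x\<^sup>2 / 2) \<le> x * exp (- x\<^sup>2 / 2)" using x y by (intro mult_right_mono) auto
      ultimately show "\<exists>d. (h has_real_derivative d) (at x) \<and> d \<le> 0" using d
        by (intro exI[of _ "exp (- x\<^sup>2) - x * exp (- x\<^sup>2 / 2)"] conjI) linarith+
    next
      have "continuous_on {0..z} gint" unfolding gint_def
        by (intro indefinite_integral_continuous_1 integrable_continuous_real continuous_intros)
      hence "continuous_on {y..z} gint" by (rule continuous_on_subset) (use y in auto)
      thus "continuous_on {y..z} h" unfolding h_def by (intro continuous_intros) auto
    qed
    moreover have "exp (- z\<^sup>2 / 2) \<ge> 0" by simp
    ultimately show ?thesis unfolding h_def by linarith
  qed
  have "eventually (\<lambda>z. gint z \<le> gint y + exp (- y\<^sup>2 / 2)) at_top"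
    using eventually_ge_at_top[of y] by eventually_elim (rule step)
  from tendsto_upperbound[OF gint_limit this]
  have "sqrt pi / 2 \<le> gint y + exp (- y\<^sup>2 / 2)" by simp
  thus ?thesis by simp
qed

lemma sum_gauss_le:
  assumes a: "a > 0"
  shows "(\<Sum>m=1..k. exp (- a * (real m)\<^sup>2)) \<le> sqrt (pi / a) / 2"
proof -
  define s where "s = sqrt a"
  have s: "s > 0" "s\<^sup>2 = a" using a by (auto simp: s_def)
  have "s * (\<Sum>m=1..k. exp (- a * (real m)\<^sup>2)) \<le> gint (s * real k)"
  proof (induction k)
    case (Suc k)
    have "(s * real (Suc k) - s * real k) * exp (- (s * real (Suc k))\<^sup>2) \<le> gint (s * real (Suc k)) - gint (s * real k)"
      using s by (intro gint_increment) (auto intro: mult_left_mono)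
    moreover have "s * real (Suc k) - s * real k = s" by (simp add: algebra_simps)
    moreover have "(s * real (Suc k))\<^sup>2 = a * (real (Suc k))\<^sup>2" using s by (simp add: power_mult_distrib)
    ultimately show ?case using Suc by (simp add: distrib_left)
  qed simp
  also have "\<dots> \<le> sqrt pi / 2" using s by (intro gint_upper) auto
  finally have "(\<Sum>m=1..k. exp (- a * (real m)\<^sup>2)) \<le> sqrt pi / 2 / s" using s by (simp add: field_simps)
  also have "\<dots> = sqrt (pi / a) / 2" by (simp add: s_def real_sqrt_divide)
  finally show ?thesis .
qed

text \<open>A left-endpoint Riemann sum of the decreasing Gaussian, hence above the integral. The
  condition on k says s (k + 1) >= 1, where \<open>gint_tail\<close> bounds the missing
  part.\<close>

lemma sum_gauss_ge:
  assumes a: "a > 0" and k: "1 \<le> a * (real k + 1)\<^sup>2"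
  shows "(\<Sum>m\<le>k. exp (- a * (real m)\<^sup>2)) \<ge> sqrt (pi / a) / 2 - exp (- a * (real k + 1)\<^sup>2 / 2) / sqrt a"
proof -
  define s where "s = sqrt a"
  have s: "s > 0" "s\<^sup>2 = a" using a by (auto simp: s_def)
  have main: "s * (\<Sum>m\<le>k. exp (- a * (real m)\<^sup>2)) \<ge> gint (s * real (Suc k))" for k
  proof (induction k)
    case 0
    show ?case using gint_increment(2)[of 0 s] s by simp
  next
    case (Suc k)
    have "gint (s * real (Suc (Suc k))) - gint (s * real (Suc k)) \<le> (s * real (Suc (Suc k)) - s * real (Suc k)) * exp (- (s * real (Suc k))\<^sup>2)"
      using s by (intro gint_increment) (auto intro: mult_left_mono)
    moreover have "s * real (Suc (Suc k)) - s * real (Suc k) = s" by (simp add: algebra_simps)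
    moreover have "(s * real (Suc k))\<^sup>2 = a * (real (Suc k))\<^sup>2" using s by (simp add: power_mult_distrib)
    ultimately show ?case using Suc by (simp add: distrib_left)
  qed
  have sk: "(s * real (Suc k))\<^sup>2 = a * (real k + 1)\<^sup>2" using s by (simp add: power_mult_distrib add.commute)
  hence "1\<^sup>2 \<le> (s * real (Suc k))\<^sup>2" using k by simp
  hence "1 \<le> s * real (Suc k)" by (rule power2_le_imp_le) (use s in auto)
  from gint_tail[OF this] have "sqrt pi / 2 - exp (- (a * (real k + 1)\<^sup>2) / 2) \<le> s * (\<Sum>m\<le>k. exp (- a * (real m)\<^sup>2))"
    using main[of k] unfolding sk by linarith
  hence "(sqrt pi / 2 - exp (- (a * (real k + 1)\<^sup>2) / 2)) / s \<le> (\<Sum>m\<le>k. exp (- a * (real m)\<^sup>2))"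
    using s by (simp add: divide_le_eq mult.commute)
  moreover have "sqrt pi / 2 / s = sqrt (pi / a) / 2" by (simp add: s_def real_sqrt_divide)
  ultimately show ?thesis by (simp add: diff_divide_distrib s_def)
qed

lemma sum_gauss_two_sided_le:
  assumes a: "a > 0" and B: "B \<le> A"
  shows "(\<Sum>n\<le>A. exp (- a * (\<bar>real n - real B\<bar>)\<^sup>2)) \<le> 1 + sqrt (pi / a)"
proof -
  define f where "f n = exp (- a * (\<bar>real n - real B\<bar>)\<^sup>2)" for n
  have "{..A} = {..<B} \<union> insert B {B<..A}" using B by auto
  hence "sum f {..A} = sum f {..<B} + sum f (insert B {B<..A})" by (simp only:) (rule sum.union_disjoint; auto)
  also have "sum f (insert B {B<..A}) = 1 + sum f {B<..A}" by (simp add: f_def)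
  finally have "(\<Sum>n\<le>A. exp (- a * (\<bar>real n - real B\<bar>)\<^sup>2)) = (\<Sum>n<B. exp (- a * (\<bar>real n - real B\<bar>)\<^sup>2)) + (1 + (\<Sum>n\<in>{B<..A}. exp (- a * (\<bar>real n - real B\<bar>)\<^sup>2)))"
    unfolding f_def .
  also have "(\<Sum>n<B. exp (- a * (\<bar>real n - real B\<bar>)\<^sup>2)) = (\<Sum>m=1..B. exp (- a * (real m)\<^sup>2))"
    by (rule sum.reindex_bij_witness[of _ "\<lambda>m. B - m" "\<lambda>n. B - n"]) (auto simp: of_nat_diff power2_commute)
  also have "(\<Sum>n\<in>{B<..A}. exp (- a * (\<bar>real n - real B\<bar>)\<^sup>2)) = (\<Sum>m=1..A-B. exp (- a * (real m)\<^sup>2))"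
    by (rule sum.reindex_bij_witness[of _ "\<lambda>m. B + m" "\<lambda>n. n - B"]) (auto simp: of_nat_diff)
  finally show ?thesis using sum_gauss_le[OF a, of B] sum_gauss_le[OF a, of "A - B"] by linarith
qed

lemma sum_gauss_two_sided_ge:
  assumes a: "a > 0" and k: "1 \<le> a * (real k + 1)\<^sup>2" "k \<le> B"
  shows "(\<Sum>n=B-k..B+k. exp (- a * (\<bar>real n - real B\<bar>)\<^sup>2)) \<ge> sqrt (pi / a) - 2 * exp (- a * (real k + 1)\<^sup>2 / 2) / sqrt a - 1"
proof -
  define f where "f n = exp (- a * (\<bar>real n - real B\<bar>)\<^sup>2)" for n
  have "{B-k..B+k} = {B-k..<B} \<union> {B..B+k}" using k by auto
  hence "sum f {B-k..B+k} = sum f {B-k..<B} + sum f {B..B+k}" by (simp only:) (rule sum.union_disjoint; auto)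
  hence "(\<Sum>n=B-k..B+k. exp (- a * (\<bar>real n - real B\<bar>)\<^sup>2)) = (\<Sum>n=B-k..<B. exp (- a * (\<bar>real n - real B\<bar>)\<^sup>2)) + (\<Sum>n=B..B+k. exp (- a * (\<bar>real n - real B\<bar>)\<^sup>2))"
    unfolding f_def .
  also have "(\<Sum>n=B-k..<B. exp (- a * (\<bar>real n - real B\<bar>)\<^sup>2)) = (\<Sum>m\<in>{..k}-{0}. exp (- a * (real m)\<^sup>2))"
    by (rule sum.reindex_bij_witness[of _ "\<lambda>m. B - m" "\<lambda>n. B - n"]) (use k in \<open>auto simp: of_nat_diff power2_commute\<close>)
  also have "\<dots> = (\<Sum>m\<le>k. exp (- a * (real m)\<^sup>2)) - 1" by (subst sum_diff1) auto
  also have "(\<Sum>n=B..B+k. exp (- a * (\<bar>real n - real B\<bar>)\<^sup>2)) = (\<Sum>m\<le>k. exp (- a * (real m)\<^sup>2))"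
    by (rule sum.reindex_bij_witness[of _ "\<lambda>m. B + m" "\<lambda>n. n - B"]) (auto simp: of_nat_diff)
  finally show ?thesis using sum_gauss_ge[OF a k(1)] by (simp add: field_simps)
qed

section \<open>Error terms and the sum over the digit of one level\<close>

definition err1 :: "real \<Rightarrow> real \<Rightarrow> real" where
  "err1 a c = sqrt (ln (a / c + 2)) / (sqrt c * sqrt a)"

definition err2 :: "real \<Rightarrow> real \<Rightarrow> real" where
  "err2 a c = ln (a / c + 2) powr (3/2) / (c powr (3/2) * sqrt a)"

definition err :: "real \<Rightarrow> real \<Rightarrow> real" where
  "err a c = err1 a c + err2 a c + 1 / a"

lemma powr_3_2: "x > 0 \<Longrightarrow> x powr (3/2) = x * sqrt x"
  using powr_add[of x 1 "1/2"] by (simp add: powr_half_sqrt)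

locale laplace =
  fixes A B :: nat and c :: real
  assumes A: "A \<ge> 1" and B: "real B \<le> 5/6 * real A" "5/6 * real A - 1 < real B" and c: "c \<ge> 1/100"
begin

abbreviation a :: real where "a \<equiv> real A"
abbreviation d :: "nat \<Rightarrow> real" where "d n \<equiv> \<bar>real n - real B\<bar>"
text \<open>x = a/c is the squared width of the Gaussian. The cut-off \<open>R\<close> is such that
  R^2 = 1024 x L makes the tail a power of 1/(x + 2), while R/a and R^3/a^2 are the first two error
  terms up to constants. \<open>G0\<close> is the Gaussian integral over the whole line; here
  \<open>\<alpha>\<close> is the exponent of that Gaussian.\<close>

definition x :: real where "x = a / c"
definition L :: real where "L = ln (x + 2)"
definition R :: real where "R = 32 * sqrt x * sqrt L"
definition G0 :: real where "G0 = sqrt (2 * a / (sqrt 3 * c))"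
definition \<alpha> :: real where "\<alpha> = c * (pi * sqrt 3 / 2) / a"

lemma pos: "a \<ge> 1" "a > 0" "c > 0" "x > 0" "L \<ge> 2/3" "L > 0" "sqrt L \<ge> 2/3" "R \<ge> 0" "\<alpha> > 0" "G0 > 0"
proof -
  show a: "a \<ge> 1" "a > 0" using A by auto
  show c: "c > 0" using c by simp
  show x: "x > 0" using a c by (simp add: x_def)
  have "ln 2 \<le> ln (x + 2)" using x by (subst ln_le_cancel_iff) auto
  thus L: "L \<ge> 2/3" unfolding L_def using ln2_ge_two_thirds by linarith
  thus "L > 0" by linarith
  show "sqrt L \<ge> 2/3" using L by (intro real_le_rsqrt) (auto simp: power2_eq_square)
  show "R \<ge> 0" unfolding R_def using x L by simp
  show "\<alpha> > 0" unfolding \<alpha>_def using a c by simp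
  show "G0 > 0" unfolding G0_def using a c by simp
qed

lemma BA: "B < A" using B pos(2) by linarith

lemma sqrt_x: "sqrt x = sqrt a / sqrt c" by (simp add: x_def real_sqrt_divide)

lemma err1_eq: "err1 a c = sqrt L / (sqrt c * sqrt a)" by (simp add: err1_def L_def x_def)

lemma err_pos: "err1 a c > 0" "err2 a c > 0" "1 / a > 0"
  using pos by (auto simp: err1_def err2_def L_def x_def)

lemma err2_eq: "err2 a c = err1 a c * (L / c)"
  unfolding err2_def err1_def using pos by (simp add: powr_3_2 L_def x_def mult_ac)

lemma R_div: "R / a = 32 * err1 a c"
proof -
  have "sqrt a / a = 1 / sqrt a" using pos by (simp add: real_div_sqrt field_simps)
  moreover have "R / a = 32 * (sqrt a / a) / sqrt c * sqrt L" unfolding R_def sqrt_x by (simp add: mult_ac)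
  ultimately show ?thesis unfolding err1_eq by (simp add: mult_ac)
qed

lemma R_sq: "R\<^sup>2 = 1024 * x * L"
  unfolding R_def using pos by (simp add: power_mult_distrib)

lemma R_cube: "R^3 / a\<^sup>2 = 32768 * err2 a c"
proof -
  have "R^3 / a\<^sup>2 = R\<^sup>2 / a * (R / a)" by (simp add: power2_eq_square power3_eq_cube)
  also have "\<dots> = 32768 * (err1 a c * (L / c))" unfolding R_sq R_div using pos by (simp add: x_def)
  finally show ?thesis by (simp add: err2_eq)
qed

lemma inverse_sqrt_x: "1 / (c * sqrt x) \<le> 3/2 * err1 a c"
proof -
  have "c * sqrt x = sqrt c * sqrt a"
  proof -
    have "c / sqrt c = sqrt c" using pos by (simp add: real_div_sqrt)
    moreover have "c * sqrt x = c / sqrt c * sqrt a" unfolding sqrt_x by simp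
    ultimately show ?thesis by simp
  qed
  hence "1 / (c * sqrt x) = 1 / (sqrt c * sqrt a)" by simp
  also have "\<dots> \<le> (3/2 * sqrt L) / (sqrt c * sqrt a)" using pos by (intro divide_right_mono) auto
  finally show ?thesis by (simp add: err1_eq)
qed

lemma G0_eq: "G0 = sqrt (2 * x / sqrt 3)" "G0 = sqrt (pi / \<alpha>)" "ln G0 = ln (2 * a / (sqrt 3 * c)) / 2"
proof -
  show "G0 = sqrt (2 * x / sqrt 3)" by (simp add: G0_def x_def field_simps)
  show "G0 = sqrt (pi / \<alpha>)" using pos by (simp add: G0_def \<alpha>_def field_simps)
  show "ln G0 = ln (2 * a / (sqrt 3 * c)) / 2" unfolding G0_def using pos by (subst ln_sqrt) auto
qed

lemma G0_bounds: "sqrt x \<le> G0" "G0 \<le> x + 2" "G0\<^sup>2 \<le> 2 * x" "G0 \<le> 2 * sqrt x"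
proof -
  have s3: "1 \<le> sqrt 3" "sqrt 3 \<le> 2" by (auto intro: real_le_lsqrt)
  have 1: "x \<le> 2 * x / sqrt 3" using s3 pos by (simp add: field_simps)
  have 2: "2 * x / sqrt 3 \<le> 2 * x" using s3 pos by (simp add: field_simps)
  show "sqrt x \<le> G0" unfolding G0_eq(1) using 1 by simp
  show g2: "G0\<^sup>2 \<le> 2 * x" unfolding G0_eq(1) using 2 pos by simp
  have "(x + 2)\<^sup>2 = x\<^sup>2 + 4 * x + 4" by (simp add: power2_sum)
  hence "G0\<^sup>2 \<le> (x + 2)\<^sup>2" using g2 pos zero_le_power2[of x] by linarith
  thus "G0 \<le> x + 2" by (rule power2_le_imp_le) (use pos(4) in simp)
  have "(2 * sqrt x)\<^sup>2 = 4 * x" using pos(4) by (simp add: power_mult_distrib)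
  hence "G0\<^sup>2 \<le> (2 * sqrt x)\<^sup>2" using g2 pos(4) by linarith
  thus "G0 \<le> 2 * sqrt x" by (rule power2_le_imp_le) (use pos(4) in simp)
qed

lemma exp_mL: "exp (- L) = 1 / (x + 2)"
  unfolding L_def using pos by (simp add: exp_minus inverse_eq_divide)

lemma cube_bound: "0 \<le> y \<Longrightarrow> y \<le> R \<Longrightarrow> y / a + y^3 / a\<^sup>2 \<le> 32768 * (err1 a c + err2 a c)"
proof -
  assume y: "0 \<le> y" "y \<le> R"
  have "y / a \<le> R / a" using y pos by (intro divide_right_mono) auto
  moreover have "y^3 / a\<^sup>2 \<le> R^3 / a\<^sup>2" using y by (intro divide_right_mono power_mono) auto
  ultimately show ?thesis unfolding R_div R_cube distrib_left using err_pos by linarith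
qed

text \<open>Within distance R the sharp bound applies, with linear and cubic errors of the size of
  \<open>err\<close>. Beyond R, half of the coarse exponent yields exp (- L) = 1/(x + 2), and the
  other half a Gaussian sum of size O(1 + sqrt x), so the tail adds only a constant.\<close>

lemma laplace_upper:
  assumes C: "C \<ge> 0"
    and u1: "\<And>n. n \<le> A \<Longrightarrow> u n \<le> - ((d n)\<^sup>2 / (128 * a)) + C / a"
    and u2: "\<And>n. n \<le> A \<Longrightarrow> u n \<le> - (pi * sqrt 3 / 2 * (d n)\<^sup>2 / a) + C * (d n / a + (d n)^3 / a\<^sup>2 + 1 / a)"
  shows "1 / c * ln (\<Sum>n\<le>A. exp (c * u n)) \<le> 1 / (2 * c) * ln (2 * a / (sqrt 3 * c)) + (32768 * C + 100) * err a c"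
proof -
  define E where "E = 32768 * C * err a c"
  \<comment> \<open>Half of the coarse rate c/(128 a); with it \<gamma> R^2 = 4 L.\<close>
  define \<gamma> where "\<gamma> = c / (256 * a)"
  have g: "\<gamma> > 0" using pos by (simp add: \<gamma>_def)
  have E1: "C / a \<le> E"
  proof -
    have "1 / a \<le> 32768 * err a c" using err_pos unfolding err_def distrib_left by linarith
    from mult_left_mono[OF this C] show ?thesis by (simp add: E_def mult_ac)
  qed
  have bound: "exp (c * u n) \<le> exp (c * E) * (exp (- \<alpha> * (d n)\<^sup>2) + exp (- L) * exp (- \<gamma> * (d n)\<^sup>2))" if n: "n \<le> A" for n
  proof (cases "d n \<le> R")
    case True
    have "C * (d n / a + (d n)^3 / a\<^sup>2 + 1 / a) \<le> C * (32768 * err a c)"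
    proof (rule mult_left_mono[OF _ C])
      have "1 / a \<le> 32768 * (1 / a)" using err_pos(3) by linarith
      thus "d n / a + (d n)^3 / a\<^sup>2 + 1 / a \<le> 32768 * err a c"
        using cube_bound[of "d n"] True unfolding err_def distrib_left by linarith
    qed
    hence "u n \<le> - (pi * sqrt 3 / 2 * (d n)\<^sup>2 / a) + E" using u2[OF n] by (simp add: E_def)
    hence "c * u n \<le> c * (- (pi * sqrt 3 / 2 * (d n)\<^sup>2 / a) + E)" using pos by (intro mult_left_mono) auto
    also have "\<dots> = c * E + - \<alpha> * (d n)\<^sup>2" by (simp add: \<alpha>_def algebra_simps)
    finally have "exp (c * u n) \<le> exp (c * E) * exp (- \<alpha> * (d n)\<^sup>2)" by (simp flip: exp_add)
    also have "\<dots> \<le> exp (c * E) * (exp (- \<alpha> * (d n)\<^sup>2) + exp (- L) * exp (- \<gamma> * (d n)\<^sup>2))" by (intro mult_left_mono) auto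
    finally show ?thesis .
  next
    case False
    have "R\<^sup>2 \<le> (d n)\<^sup>2" using False pos by (intro power_mono) auto
    hence "\<gamma> * R\<^sup>2 \<le> \<gamma> * (d n)\<^sup>2" using g by (intro mult_left_mono) auto
    moreover have "\<gamma> * R\<^sup>2 = 4 * L" unfolding R_sq \<gamma>_def x_def using pos by simp
    ultimately have g4: "L \<le> \<gamma> * (d n)\<^sup>2" using pos by linarith
    have "c * u n \<le> c * (- ((d n)\<^sup>2 / (128 * a)) + E)" using u1[OF n] E1 pos by (intro mult_left_mono) auto
    also have "\<dots> = c * E - 2 * (\<gamma> * (d n)\<^sup>2)" by (simp add: \<gamma>_def algebra_simps)
    also have "\<dots> \<le> c * E + (- L + - \<gamma> * (d n)\<^sup>2)" using g4 by simp
    finally have "exp (c * u n) \<le> exp (c * E) * (exp (- L) * exp (- \<gamma> * (d n)\<^sup>2))" by (simp flip: exp_add)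
    also have "\<dots> \<le> exp (c * E) * (exp (- \<alpha> * (d n)\<^sup>2) + exp (- L) * exp (- \<gamma> * (d n)\<^sup>2))" by (intro mult_left_mono) auto
    finally show ?thesis .
  qed
  have "(\<Sum>n\<le>A. exp (c * u n)) \<le> (\<Sum>n\<le>A. exp (c * E) * (exp (- \<alpha> * (d n)\<^sup>2) + exp (- L) * exp (- \<gamma> * (d n)\<^sup>2)))"
    by (rule sum_mono) (use bound in auto)
  also have "\<dots> = exp (c * E) * ((\<Sum>n\<le>A. exp (- \<alpha> * (d n)\<^sup>2)) + exp (- L) * (\<Sum>n\<le>A. exp (- \<gamma> * (d n)\<^sup>2)))"
    by (simp only: sum_distrib_left[symmetric] sum.distrib)
  also have "\<dots> \<le> exp (c * E) * ((1 + G0) + 33)"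
  proof (intro mult_left_mono add_mono)
    show "(\<Sum>n\<le>A. exp (- \<alpha> * (d n)\<^sup>2)) \<le> 1 + G0"
      unfolding G0_eq(2) using pos BA by (intro sum_gauss_two_sided_le) auto
    have "sqrt (pi / \<gamma>) \<le> 32 * sqrt x"
    proof -
      have "pi / \<gamma> = 256 * pi * x" using pos by (simp add: \<gamma>_def x_def)
      also have "\<dots> \<le> 256 * 4 * x" using pi_less_4 pos by (intro mult_right_mono mult_left_mono) auto
      finally have "sqrt (pi / \<gamma>) \<le> sqrt (1024 * x)" by simp
      thus ?thesis by (simp add: real_sqrt_mult)
    qed
    moreover have "sqrt x \<le> x + 2" using G0_bounds by linarith
    ultimately have "1 + sqrt (pi / \<gamma>) \<le> 33 * (x + 2)" unfolding distrib_left using pos(4) by linarith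
    moreover have "(\<Sum>n\<le>A. exp (- \<gamma> * (d n)\<^sup>2)) \<le> 1 + sqrt (pi / \<gamma>)" using g BA by (intro sum_gauss_two_sided_le) auto
    ultimately have "exp (- L) * (\<Sum>n\<le>A. exp (- \<gamma> * (d n)\<^sup>2)) \<le> exp (- L) * (33 * (x + 2))" by (intro mult_left_mono) auto
    also have "\<dots> = 33" unfolding exp_mL using pos(4) by (simp add: field_simps)
    finally show "exp (- L) * (\<Sum>n\<le>A. exp (- \<gamma> * (d n)\<^sup>2)) \<le> 33" .
  qed auto
  also have "(1 + G0) + 33 = G0 + 34" by simp
  finally have S: "(\<Sum>n\<le>A. exp (c * u n)) \<le> exp (c * E) * (G0 + 34)" .
  have "(\<Sum>n\<le>A. exp (c * u n)) > 0" by (intro sum_pos) auto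
  hence "ln (\<Sum>n\<le>A. exp (c * u n)) \<le> ln (exp (c * E) * (G0 + 34))" using S by (subst ln_le_cancel_iff) auto
  also have "\<dots> = c * E + ln (G0 + 34)" using pos by (subst ln_mult) auto
  finally have "1 / c * ln (\<Sum>n\<le>A. exp (c * u n)) \<le> 1 / c * (c * E + ln (G0 + 34))" using pos by (intro mult_left_mono) auto
  also have "\<dots> = E + 1 / c * ln (G0 + 34)" using pos by (simp add: distrib_left)
  \<comment> \<open>For x >= 1 the summand 34 costs at most 34/G0 in the logarithm. For x < 1 the
    inequality 1/c < 1/a makes both logarithmic terms small: the first is O(1/a), and (ln G0)/c >=
    -1/a.\<close>
  also have "1 / c * ln (G0 + 34) \<le> 1 / c * ln G0 + 100 * err a c"
  proof (cases "x \<ge> 1")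
    case True
    have "ln (G0 + 34) = ln (G0 * (1 + 34 / G0))" using pos by (simp add: distrib_left)
    also have "\<dots> = ln G0 + ln (1 + 34 / G0)"
    proof (rule ln_mult_pos)
      have "34 / G0 > 0" using pos(10) by simp
      thus "1 + 34 / G0 > 0" by linarith
    qed (rule pos(10))
    also have "ln (1 + 34 / G0) \<le> 34 / G0" using pos by (intro ln_add_one_self_le_self) auto
    also have "34 / G0 \<le> 34 / sqrt x" using G0_bounds pos by (intro divide_left_mono) auto
    finally have "1 / c * ln (G0 + 34) \<le> 1 / c * (ln G0 + 34 / sqrt x)" using pos by (intro mult_left_mono) auto
    also have "\<dots> = 1 / c * ln G0 + 34 * (1 / (c * sqrt x))" by (simp add: distrib_left)
    finally show ?thesis using inverse_sqrt_x err_pos unfolding err_def distrib_left by linarith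
  next
    case False
    have "a < c" using False pos by (simp add: x_def)
    hence ca: "1 / c \<le> 1 / a" using pos by (intro divide_left_mono) auto
    have "sqrt x \<le> 1" using False by simp
    hence "G0 + 34 \<le> 36" using G0_bounds(4) by linarith
    hence "ln (G0 + 34) \<le> 36" using ln_le_minus_one[of "G0 + 34"] pos by linarith
    hence 1: "1 / c * ln (G0 + 34) \<le> 36 * (1 / a)" using ca pos mult_mono[of "1/c" "1/a" "ln (G0 + 34)" 36] by simp
    have "- ln G0 \<le> 1 / x"
    proof -
      have "ln (1 / sqrt x) \<le> 1 / sqrt x" using ln_le_minus_one[of "1 / sqrt x"] pos by simp
      moreover have "ln (sqrt x) \<le> ln G0" using G0_bounds(1) pos by (subst ln_le_cancel_iff) auto
      moreover have "ln (1 / sqrt x) = - ln (sqrt x)" using pos by (simp add: ln_div)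
      moreover have "1 / sqrt x \<le> 1 / x"
      proof -
        have "sqrt x * sqrt x \<le> sqrt x * 1" using \<open>sqrt x \<le> 1\<close> pos by (intro mult_left_mono) auto
        thus ?thesis using pos by (intro divide_left_mono) auto
      qed
      ultimately show ?thesis by linarith
    qed
    hence "1 / c * (- ln G0) \<le> 1 / c * (1 / x)" using pos by (intro mult_left_mono) auto
    also have "\<dots> = 1 / a" using pos by (simp add: x_def)
    finally have "1 / c * ln G0 \<ge> - (1 / a)" by simp
    thus ?thesis using 1 err_pos unfolding err_def distrib_left by linarith
  qed
  also have "1 / c * ln G0 = 1 / (2 * c) * ln (2 * a / (sqrt 3 * c))" by (simp add: G0_eq(3))
  finally show ?thesis by (simp add: E_def algebra_simps)
qed

text \<open>The exponents v are quantified inside, so that W is chosen from A, B and c alone. The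
  condition on the elements of W is the one that \<open>ln_sinprod_lower\<close> imposes on
  digits.\<close>

definition window :: "nat set \<Rightarrow> bool" where
  "window W \<longleftrightarrow> B \<in> W \<and> W \<subseteq> {..<A} \<and> (\<forall>n\<in>W. n = B \<or> (A \<ge> 36 \<and> d n \<le> a / 20)) \<and>
    (\<forall>C\<ge>0. \<forall>v. (\<forall>n\<in>W. v n \<ge> - (pi * sqrt 3 / 2 * (d n)\<^sup>2 / a) - C * (d n / a + (d n)^3 / a\<^sup>2)) \<longrightarrow>
      1 / c * ln (\<Sum>n\<in>W. exp (c * v n)) \<ge> 1 / (2 * c) * ln (2 * a / (sqrt 3 * c)) - (32768 * C + 20000000) * err a c)"

text \<open>If x < 36, A < 36 or R > a/20, the main term is itself within the error and W = {B}
  suffices. Otherwise W consists of the digits within R of B, where the Gaussian sum is complete up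
  to a bounded amount.\<close>

lemma ex_window: "\<exists>W. window W"
proof (cases "x \<ge> 36 \<and> A \<ge> 36 \<and> R \<le> a / 20")
  case False
  have tot: "1 / (2 * c) * ln (2 * a / (sqrt 3 * c)) \<le> 20000000 * err a c"
  proof -
    have G: "1 / (2 * c) * ln (2 * a / (sqrt 3 * c)) = 1 / c * ln G0" by (simp add: G0_eq(3))
    have "G0 > 0" by (rule pos)
    have "ln G0 \<le> ln (x + 2)" using G0_bounds pos by (subst ln_le_cancel_iff) auto
    hence gL: "1 / c * ln G0 \<le> 1 / c * L" unfolding L_def using pos by (intro mult_left_mono) auto
    have Lx: "L \<le> x + 1" unfolding L_def using ln_le_minus_one[of "x + 2"] pos by linarith
    consider "x < 36" | "A < 36" | "R > a / 20" using False by linarith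
    thus ?thesis
    proof cases
      case 1
      have "1 / c \<le> 36 * (1 / a)" using 1 pos by (simp add: x_def field_simps)
      hence "1 / c * L \<le> 36 * (1 / a) * 37" using Lx 1 pos by (intro mult_mono) auto
      thus ?thesis using gL err_pos unfolding G err_def distrib_left by linarith
    next
      case 2
      \<comment> \<open>The lower bound on c is used here: 1/c <= 100 and x <= 3600, and 100 * 3601
        * 36 stays below 20000000.\<close>
      have "x \<le> 36 / (1/100)" unfolding x_def using 2 c pos by (intro frac_le) auto
      moreover have "1 / c \<le> 100" using c pos by (simp add: field_simps)
      ultimately have "1 / c * L \<le> 100 * 3601" using Lx pos by (intro mult_mono) auto
      also have "\<dots> \<le> 100 * 3601 * (36 * (1 / a))" using 2 pos by (simp add: field_simps)
      finally show ?thesis using gL err_pos unfolding G err_def distrib_left by linarith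
    next
      case 3
      have "1 / 20 < R / a" using 3 pos by (simp add: field_simps)
      hence "err1 a c > 1 / 640" unfolding R_div by simp
      hence "1/640 * (L / c) \<le> err1 a c * (L / c)" using pos by (intro mult_right_mono) auto
      hence "1 / c * L \<le> 640 * err2 a c" unfolding err2_eq by simp
      thus ?thesis using gL err_pos unfolding G err_def distrib_left by linarith
    qed
  qed
  show ?thesis
    unfolding window_def
  proof (intro exI[of _ "{B}"] conjI allI impI)
    fix C :: real and v assume C: "0 \<le> C" and v: "\<forall>n\<in>{B}. v n \<ge> - (pi * sqrt 3 / 2 * (d n)\<^sup>2 / a) - C * (d n / a + (d n)^3 / a\<^sup>2)"
    have "v B \<ge> 0" using v by simp
    hence "1 / c * ln (\<Sum>n\<in>{B}. exp (c * v n)) \<ge> 0" using pos by simp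
    moreover have "32768 * C * err a c \<ge> 0" using C err_pos by (simp add: err_def)
    ultimately show "1 / c * ln (\<Sum>n\<in>{B}. exp (c * v n)) \<ge> 1 / (2 * c) * ln (2 * a / (sqrt 3 * c)) - (32768 * C + 20000000) * err a c"
      using tot unfolding distrib_right by linarith
  qed (use BA in auto)
next
  case True
  define k where "k = nat \<lfloor>R\<rfloor>"
  have k: "real k \<le> R" "R < real k + 1" using pos unfolding k_def by linarith+
  have a36: "a \<ge> 36" using True by simp
  have kB: "k \<le> B" using k True B a36 by linarith
  define W where "W = {B-k..B+k}"
  have dk: "d n \<le> real k" if "n \<in> W" for n using that kB unfolding W_def by auto
  have al: "\<alpha> * R\<^sup>2 \<ge> 2 * L"
  proof -
    have "\<alpha> * R\<^sup>2 = 512 * (pi * sqrt 3) * L" unfolding R_sq \<alpha>_def x_def using pos by simp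
    moreover have "1 * 1 \<le> pi * sqrt 3" using pi_gt3 by (intro mult_mono) auto
    hence "512 * 1 * L \<le> 512 * (pi * sqrt 3) * L" using pos by (intro mult_right_mono mult_left_mono) auto
    ultimately show ?thesis using pos by linarith
  qed
  have "R\<^sup>2 \<le> (real k + 1)\<^sup>2" using k pos by (intro power_mono) auto
  hence "\<alpha> * R\<^sup>2 \<le> \<alpha> * (real k + 1)\<^sup>2" using pos by (intro mult_left_mono) auto
  hence al2: "2 * L \<le> \<alpha> * (real k + 1)\<^sup>2" using al by linarith
  have sum: "(\<Sum>n\<in>W. exp (- \<alpha> * (d n)\<^sup>2)) \<ge> G0 - 3"
  proof -
    have "(\<Sum>n\<in>W. exp (- \<alpha> * (d n)\<^sup>2)) \<ge> sqrt (pi / \<alpha>) - 2 * exp (- \<alpha> * (real k + 1)\<^sup>2 / 2) / sqrt \<alpha> - 1"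
      unfolding W_def using al2 pos kB by (intro sum_gauss_two_sided_ge) auto
    moreover have "2 * exp (- \<alpha> * (real k + 1)\<^sup>2 / 2) / sqrt \<alpha> \<le> 2"
    proof -
      have e: "exp (- \<alpha> * (real k + 1)\<^sup>2 / 2) \<le> exp (- L)" using al2 by simp
      have "1 / sqrt \<alpha> \<le> sqrt pi / sqrt \<alpha>" using pos pi_gt3 by (intro divide_right_mono) auto
      also have "\<dots> = G0" unfolding G0_eq(2) by (simp add: real_sqrt_divide)
      also have "\<dots> \<le> x + 2" by (rule G0_bounds)
      finally have "exp (- \<alpha> * (real k + 1)\<^sup>2 / 2) * (1 / sqrt \<alpha>) \<le> exp (- L) * (x + 2)" using e pos by (intro mult_mono) auto
      also have "\<dots> = 1" unfolding exp_mL using pos by simp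
      finally show ?thesis by simp
    qed
    ultimately show ?thesis unfolding G0_eq(2) by linarith
  qed
  have "sqrt 36 \<le> sqrt x" using True by (simp only: real_sqrt_le_iff)
  hence G6: "G0 \<ge> 6" using G0_bounds(1) by simp
  have lnG: "ln (G0 - 3) \<ge> ln G0 - 6 / G0"
  proof -
    have "ln (G0 / (G0 - 3)) \<le> G0 / (G0 - 3) - 1" using G6 by (intro ln_le_minus_one) auto
    also have "\<dots> = 3 / (G0 - 3)" using G6 by (simp add: field_simps)
    also have "\<dots> \<le> 3 / (G0 / 2)" using G6 by (intro divide_left_mono) auto
    finally show ?thesis using G6 by (simp add: ln_div)
  qed
  show ?thesis
    unfolding window_def
  proof (intro exI[of _ W] conjI allI impI)
    show "B \<in> W" by (simp add: W_def)
    show "W \<subseteq> {..<A}"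
    proof
      fix n assume "n \<in> W"
      hence "real n \<le> real B + real k" by (auto simp: W_def)
      hence "real n < a" using k True B a36 by linarith
      thus "n \<in> {..<A}" by simp
    qed
    show "\<forall>n\<in>W. n = B \<or> (A \<ge> 36 \<and> d n \<le> a / 20)" using dk k True by fastforce
    fix C :: real and v assume C: "0 \<le> C" and v: "\<forall>n\<in>W. v n \<ge> - (pi * sqrt 3 / 2 * (d n)\<^sup>2 / a) - C * (d n / a + (d n)^3 / a\<^sup>2)"
    define E where "E = 32768 * C * err a c"
    have b: "exp (- (c * E)) * exp (- \<alpha> * (d n)\<^sup>2) \<le> exp (c * v n)" if n: "n \<in> W" for n
    proof -
      have "C * (d n / a + (d n)^3 / a\<^sup>2) \<le> C * (32768 * err a c)"
      proof (rule mult_left_mono[OF _ C])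
        show "d n / a + (d n)^3 / a\<^sup>2 \<le> 32768 * err a c"
          using cube_bound[of "d n"] dk[OF n] k err_pos(3) unfolding err_def distrib_left by linarith
      qed
      hence "- (pi * sqrt 3 / 2 * (d n)\<^sup>2 / a) - E \<le> v n" using v n by (auto simp: E_def)
      hence "c * (- (pi * sqrt 3 / 2 * (d n)\<^sup>2 / a) - E) \<le> c * v n" using pos by (intro mult_left_mono) auto
      moreover have "c * (- (pi * sqrt 3 / 2 * (d n)\<^sup>2 / a) - E) = - (c * E) + - \<alpha> * (d n)\<^sup>2" by (simp add: \<alpha>_def algebra_simps)
      ultimately show ?thesis by (simp flip: exp_add)
    qed
    have "exp (- (c * E)) * (G0 - 3) \<le> exp (- (c * E)) * (\<Sum>n\<in>W. exp (- \<alpha> * (d n)\<^sup>2))" using sum by (intro mult_left_mono) auto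
    also have "\<dots> \<le> (\<Sum>n\<in>W. exp (c * v n))" unfolding sum_distrib_left by (rule sum_mono) (rule b)
    finally have "ln (exp (- (c * E)) * (G0 - 3)) \<le> ln (\<Sum>n\<in>W. exp (c * v n))"
      using G6 by (subst ln_le_cancel_iff) (auto intro: order.strict_trans2[of 0 "exp (- (c * E)) * (G0 - 3)"])
    moreover have "ln (exp (- (c * E)) * (G0 - 3)) = - (c * E) + ln (G0 - 3)" using G6 by (subst ln_mult) auto
    ultimately have "- (c * E) + (ln G0 - 6 / G0) \<le> ln (\<Sum>n\<in>W. exp (c * v n))" using lnG by linarith
    hence "1 / c * (- (c * E) + (ln G0 - 6 / G0)) \<le> 1 / c * ln (\<Sum>n\<in>W. exp (c * v n))" using pos by (intro mult_left_mono) auto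
    moreover have "1 / c * (- (c * E) + (ln G0 - 6 / G0)) = - E + 1 / c * ln G0 - 6 * (1 / (c * G0))"
      using pos by (simp add: field_simps)
    moreover have "1 / (c * G0) \<le> 3/2 * err1 a c"
    proof -
      have "1 / (c * G0) \<le> 1 / (c * sqrt x)" using pos G0_bounds(1) by (intro divide_left_mono mult_left_mono) auto
      thus ?thesis using inverse_sqrt_x by linarith
    qed
    moreover have "1 / c * ln G0 = 1 / (2 * c) * ln (2 * a / (sqrt 3 * c))" by (simp add: G0_eq(3))
    moreover have "(32768 * C + 20000000) * err a c = E + 20000000 * err1 a c + 20000000 * err2 a c + 20000000 * (1 / a)"
      unfolding E_def by (simp add: err_def algebra_simps)
    ultimately show "1 / c * ln (\<Sum>n\<in>W. exp (c * v n)) \<ge> 1 / (2 * c) * ln (2 * a / (sqrt 3 * c)) - (32768 * C + 20000000) * err a c"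
      using err_pos by linarith
  qed
qed

end

section \<open>Proof of the theorem\<close>

definition level_slope :: "real \<Rightarrow> real" where
  "level_slope T = 50000 * (445 + 90 * T)"

text \<open>\<open>level_slope\<close> is the value of \<open>lin_coeff\<close> for \<tau> = 9 T.
  Its square comes from completing the square, which hides the linear error in the quadratic loss;
  C0 and C1 come from trading logarithms for linear terms.\<close>

definition level_const :: "real \<Rightarrow> real \<Rightarrow> real \<Rightarrow> real" where
  "level_const T C0 C1 = C0 + C1 + 1200 + level_slope T + 32 * (level_slope T)\<^sup>2"

context irrational begin

section \<open>Bound for the logarithmic sum \<open>\<tau>\<close>\<close>

lemma rev_den_sum: "n \<le> j \<Longrightarrow> (\<Sum>l\<le>n. 1 / real (rev_den j l)) \<le> 4"
  using rev_den_ge_1 rev_den_double by (intro sum_inverse_denominators[where J = j]) auto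

lemma rev_den_digit: "1 \<le> l \<Longrightarrow> l \<le> j \<Longrightarrow> digit (j - l + 1) * rev_den j (l - 1) \<le> rev_den j l"
proof (cases l)
  case (Suc m)
  assume "1 \<le> l" "l \<le> j"
  show ?thesis
  proof (cases m)
    case (Suc m')
    have "j - l + 1 = j - m' - 1" using Suc \<open>l = Suc m\<close> \<open>l \<le> j\<close> by simp
    thus ?thesis using Suc \<open>l = Suc m\<close> by simp
  qed (use Suc \<open>l \<le> j\<close> in simp)
qed simp

lemma rev_den_growth: "l \<le> j \<Longrightarrow> l \<le> 2 * rev_den j l"
proof (induction l rule: less_induct)
  case (less l)
  show ?case
  proof (cases "l < 2")
    case True
    thus ?thesis using rev_den_ge_1[of l j] less.prems by simp
  next
    case False
    then obtain m where m: "l = Suc (Suc m)" by (metis add_2_eq_Suc le_Suc_ex not_less)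
    have "2 * rev_den j m \<le> rev_den j l" "m \<le> 2 * rev_den j m" "rev_den j m \<ge> 1"
      using rev_den_double[of m j] less.IH[of m] rev_den_ge_1[of m j] less.prems m by auto
    thus ?thesis using m by linarith
  qed
qed

text \<open>From ln a_(j-l) <= T a_(j-l+1) and a_(j-l+1) * rev_den (l-1) <= rev_den l, the l-th term
  is at most 1/rev_den l + T/rev_den (l-1), which sums to at most 4 + 4 T. The digits below k0 sit
  at the last scales, whose denominators are large, and add at most 1; finally 5 + 4 T <= 9
  T.\<close>

lemma \<tau>_bound:
  assumes T: "T \<ge> 1" and k0: "\<And>k. k \<ge> k0 \<Longrightarrow> ln (real (digit k)) \<le> T * real (digit (Suc k))"
  shows "\<exists>k1. \<forall>j\<ge>k1. \<tau> j \<le> 9 * T"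
proof -
  define M where "M = (\<Sum>k<k0. ln (real (digit k) + 1))"
  have M0: "M \<ge> 0" unfolding M_def by (intro sum_nonneg) auto
  \<comment> \<open>Makes (j - k0)/2 >= k0 * M, so that by \<open>rev_den_growth\<close> the k0 last
    terms together stay below 1.\<close>
  define k1 where "k1 = k0 + 2 * nat \<lceil>real k0 * M\<rceil> + 1"
  have "\<tau> j \<le> 9 * T" if j: "j \<ge> k1" for j
  proof -
    define e where "e l = (if l \<in> {j - k0<..<j} then M / real (rev_den j (j - k0)) else 0)" for l
    have jk: "j > k0" using j by (simp add: k1_def)
    have bnd: "ln (real (rev_den j (l+1)) / real (rev_den j l)) / real (rev_den j l) \<le> 1 / real (rev_den j l) + T * (1 / real (rev_den j (l-1))) + e l"
      if l: "l \<in> {1..<j}" for l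
    proof -
      have r: "real (rev_den j l) \<ge> 1" "real (rev_den j (l-1)) \<ge> 1" "real (rev_den j (l+1)) \<ge> 1"
        using rev_den_ge_1[of l j] rev_den_ge_1[of "l-1" j] rev_den_ge_1[of "l+1" j] l by auto
      have dgl: "digit (j - l) \<ge> 1" using l by (intro digit_pos) auto
      have "real (rev_den j (l+1)) \<le> real ((digit (j - l) + 1) * rev_den j l)" using rev_den_ratio[of l j] l by (simp only: of_nat_le_iff) simp
      also have "\<dots> = (real (digit (j - l)) + 1) * real (rev_den j l)" by (simp add: distrib_right)
      finally have "real (rev_den j (l+1)) / real (rev_den j l) \<le> real (digit (j - l)) + 1" using r by (subst pos_divide_le_eq) auto
      hence "ln (real (rev_den j (l+1)) / real (rev_den j l)) \<le> ln (real (digit (j - l)) + 1)" using r by (subst ln_le_cancel_iff) auto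
      hence t1: "ln (real (rev_den j (l+1)) / real (rev_den j l)) / real (rev_den j l) \<le> ln (real (digit (j - l)) + 1) / real (rev_den j l)"
        using r by (intro divide_right_mono) auto
      show ?thesis
      proof (cases "j - l \<ge> k0")
        case True
        have "ln (real (digit (j - l)) + 1) \<le> ln (2 * real (digit (j - l)))" using dgl by (subst ln_le_cancel_iff) auto
        also have "\<dots> = ln 2 + ln (real (digit (j - l)))" using dgl by (subst ln_mult) auto
        also have "ln 2 \<le> (1::real)" using ln_le_minus_one[of "2::real"] by simp
        also have "ln (real (digit (j - l))) \<le> T * real (digit (j - l + 1))" using k0[OF True] by simp
        finally have "ln (real (digit (j - l)) + 1) / real (rev_den j l) \<le> (1 + T * real (digit (j - l + 1))) / real (rev_den j l)"
          using r by (intro divide_right_mono) auto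
        also have "\<dots> = 1 / real (rev_den j l) + T * (real (digit (j - l + 1)) / real (rev_den j l))" by (simp add: add_divide_distrib)
        also have "real (digit (j - l + 1)) / real (rev_den j l) \<le> 1 / real (rev_den j (l-1))"
        proof -
          have "real (digit (j - l + 1) * rev_den j (l-1)) \<le> real (rev_den j l)" using rev_den_digit[of l j] l by (simp only: of_nat_le_iff) simp
          thus ?thesis using r by (simp add: field_simps)
        qed
        finally have "ln (real (digit (j - l)) + 1) / real (rev_den j l) \<le> 1 / real (rev_den j l) + T * (1 / real (rev_den j (l-1)))"
          using T by (simp add: mult_left_mono)
        moreover have "e l \<ge> 0" using M0 by (simp add: e_def)
        ultimately show ?thesis using t1 by linarith
      next
        case False
        have "ln (real (digit (j - l)) + 1) \<le> M"
          unfolding M_def using False by (intro member_le_sum) auto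
        hence "ln (real (digit (j - l)) + 1) / real (rev_den j l) \<le> M / real (rev_den j l)" using r by (intro divide_right_mono) auto
        also have "\<dots> \<le> M / real (rev_den j (j - k0))"
        proof -
          have "rev_den j m \<le> rev_den j m'" if "m \<le> m'" "m' \<le> j" for m m'
            using that by (induction m' rule: dec_induct) (use rev_den_mono in \<open>auto intro: order_trans\<close>)
          hence "rev_den j (j - k0) \<le> rev_den j l" using False l by auto
          moreover have "rev_den j (j - k0) \<ge> 1" by (intro rev_den_ge_1) auto
          ultimately show ?thesis using M0 by (intro divide_left_mono) auto
        qed
        also have "\<dots> = e l" using False l by (auto simp: e_def)
        finally have "ln (real (digit (j - l)) + 1) / real (rev_den j l) \<le> e l" .
        moreover have "1 / real (rev_den j l) \<ge> 0" "T * (1 / real (rev_den j (l-1))) \<ge> 0" using T by auto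
        ultimately show ?thesis using t1 by linarith
      qed
    qed
    have "\<tau> j \<le> (\<Sum>l=1..<j. 1 / real (rev_den j l) + T * (1 / real (rev_den j (l-1))) + e l)"
      unfolding \<tau>_def by (rule sum_mono) (rule bnd)
    also have "\<dots> = (\<Sum>l=1..<j. 1 / real (rev_den j l)) + T * (\<Sum>l=1..<j. 1 / real (rev_den j (l-1))) + (\<Sum>l=1..<j. e l)"
      by (simp only: sum.distrib sum_distrib_left)
    also have "(\<Sum>l=1..<j. 1 / real (rev_den j l)) \<le> 4"
    proof -
      have "(\<Sum>l=1..<j. 1 / real (rev_den j l)) \<le> (\<Sum>l\<le>j. 1 / real (rev_den j l))" by (intro sum_mono2) auto
      also have "\<dots> \<le> 4" by (rule rev_den_sum) simp
      finally show ?thesis .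
    qed
    also have "(\<Sum>l=1..<j. 1 / real (rev_den j (l-1))) \<le> 4"
    proof -
      have "(\<Sum>l=1..<j. 1 / real (rev_den j (l-1))) = (\<Sum>l=0..<j-1. 1 / real (rev_den j l))"
        by (rule sum.reindex_bij_witness[of _ Suc "\<lambda>l. l - 1"]) auto
      also have "\<dots> \<le> (\<Sum>l\<le>j. 1 / real (rev_den j l))" by (intro sum_mono2) auto
      also have "\<dots> \<le> 4" by (rule rev_den_sum) simp
      finally show ?thesis .
    qed
    also have "(\<Sum>l=1..<j. e l) \<le> 1"
    proof -
      have "(\<Sum>l=1..<j. e l) = (\<Sum>l\<in>{j - k0<..<j}. M / real (rev_den j (j - k0)))"
        by (rule sum.mono_neutral_cong_right) (auto simp: e_def)
      also have "\<dots> = real (j - (j - k0) - 1) * (M / real (rev_den j (j - k0)))" by simp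
      also have "\<dots> \<le> real k0 * (M / real (rev_den j (j - k0)))" using M0 by (intro mult_right_mono) auto
      also have "\<dots> \<le> 1"
      proof -
        have "real (j - k0) \<le> real (2 * rev_den j (j - k0))" using rev_den_growth[of "j - k0" j] by (simp only: of_nat_le_iff)
        moreover have "real k0 * M \<le> real (nat \<lceil>real k0 * M\<rceil>)" by linarith
        moreover have "2 * real (nat \<lceil>real k0 * M\<rceil>) \<le> real (j - k0)" using j unfolding k1_def by linarith
        ultimately have "real k0 * M \<le> real (rev_den j (j - k0))" by simp
        moreover have "rev_den j (j - k0) \<ge> 1" by (intro rev_den_ge_1) auto
        ultimately show ?thesis by (simp add: divide_le_eq)
      qed
      finally show ?thesis .
    qed
    finally show ?thesis using T by simp
  qed
  thus ?thesis by blast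
qed

section \<open>Factorisation over the digits and the bound for one level\<close>

lemma digitwise_mono: "(\<And>i n. i < j \<Longrightarrow> n \<le> digit (Suc i) \<Longrightarrow> u i n \<le> b i) \<Longrightarrow> N < q j \<Longrightarrow> digitwise u j N \<le> (\<Sum>i<j. b i)"
proof (induction j arbitrary: N)
  case (Suc j)
  have "digitwise u j (N mod q j) \<le> (\<Sum>i<j. b i)" using Suc q_ge_1[of j] by (intro Suc.IH) auto
  moreover have "u j (N div q j) \<le> b j" using digit_le Suc.prems by auto
  ultimately show ?case by simp
qed simp

text \<open>Splitting off the top digit embeds the numbers below q_(j+1) into all pairs of a digit
  and a remainder; the pairs that do not occur only add positive terms.\<close>

lemma sum_digitwise_upper: "(\<Sum>N<q j. exp (c * digitwise u j N)) \<le> (\<Prod>i<j. \<Sum>n\<le>digit (Suc i). exp (c * u i n))"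
proof (induction j)
  case (Suc j)
  define f where "f N = (N div q j, N mod q j)" for N
  define h where "h = (\<lambda>(n, M). exp (c * u j n) * exp (c * digitwise u j M))"
  have inj: "inj_on f {..<q (Suc j)}"
    by (rule inj_onI) (simp add: f_def, metis div_mult_mod_eq)
  have sub: "f ` {..<q (Suc j)} \<subseteq> {..digit (Suc j)} \<times> {..<q j}"
    using digit_le q_ge_1[of j] by (auto simp: f_def)
  have "(\<Sum>N<q (Suc j). exp (c * digitwise u (Suc j) N)) = (\<Sum>N<q (Suc j). h (f N))"
    by (simp add: h_def f_def distrib_left exp_add)
  also have "\<dots> = (\<Sum>x\<in>f ` {..<q (Suc j)}. h x)" using sum.reindex[OF inj, of h] by simp
  also have "\<dots> \<le> (\<Sum>x\<in>{..digit (Suc j)} \<times> {..<q j}. h x)"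
    by (rule sum_mono2) (use sub in \<open>auto simp: h_def\<close>)
  also have "\<dots> = (\<Sum>n\<le>digit (Suc j). exp (c * u j n)) * (\<Sum>M<q j. exp (c * digitwise u j M))"
    by (simp add: h_def sum_product sum.cartesian_product)
  also have "\<dots> \<le> (\<Sum>n\<le>digit (Suc j). exp (c * u j n)) * (\<Prod>i<j. \<Sum>n\<le>digit (Suc i). exp (c * u i n))"
    by (intro mult_left_mono Suc.IH sum_nonneg) auto
  finally show ?case by (simp add: mult.commute)
qed simp

text \<open>Digits strictly below a_(j+1) can be combined freely, since M + n q_j < (n + 1) q_j <=
  q_(j+1). Hence the factorisation is exact.\<close>

lemma sum_digitwise_admissible:
  assumes "\<And>i. W i \<subseteq> {..<digit (Suc i)}"
  shows "(\<Sum>N | N < q j \<and> admissible (\<lambda>i n. n \<in> W i) j N. exp (c * digitwise v j N)) = (\<Prod>i<j. \<Sum>n\<in>W i. exp (c * v i n))"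
proof (induction j)
  case 0
  have "{N. N < q 0 \<and> admissible (\<lambda>i n. n \<in> W i) 0 N} = {0}" by auto
  thus ?case by simp
next
  case (Suc j)
  define Gd where "Gd = (\<lambda>j. {N. N < q j \<and> admissible (\<lambda>i n. n \<in> W i) j N})"
  have fin: "finite (W j)" using assms finite_subset by blast
  have "(\<Sum>N\<in>Gd (Suc j). exp (c * digitwise v (Suc j) N)) = (\<Sum>(n, M)\<in>W j \<times> Gd j. exp (c * v j n) * exp (c * digitwise v j M))"
  proof (rule sum.reindex_bij_witness[of _ "\<lambda>(n, M). M + n * q j" "\<lambda>N. (N div q j, N mod q j)"])
    fix N assume "N \<in> Gd (Suc j)"
    thus "(N div q j, N mod q j) \<in> W j \<times> Gd j" using q_ge_1[of j] by (auto simp: Gd_def)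
  next
    fix x assume "x \<in> W j \<times> Gd j"
    then obtain n M where x: "x = (n, M)" "n \<in> W j" "M \<in> Gd j" by auto
    have M: "M < q j" using x by (simp add: Gd_def)
    have "n < digit (Suc j)" using x assms by auto
    hence "Suc n * q j \<le> digit (Suc j) * q j" by (intro mult_le_mono1) auto
    hence "M + n * q j < q (Suc j)" using M by (simp add: q_Suc)
    thus "(case x of (n, M) \<Rightarrow> M + n * q j) \<in> Gd (Suc j)"
      and "((case x of (n, M) \<Rightarrow> M + n * q j) div q j, (case x of (n, M) \<Rightarrow> M + n * q j) mod q j) = x"
      using x M by (auto simp: Gd_def)
  qed (auto simp: distrib_left exp_add mod_div_mult_eq)
  also have "\<dots> = (\<Sum>n\<in>W j. exp (c * v j n)) * (\<Sum>M\<in>Gd j. exp (c * digitwise v j M))"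
    by (simp add: sum_product sum.cartesian_product)
  finally show ?case using Suc unfolding Gd_def by (simp add: mult.commute)
qed

text \<open>By \<open>bulk_Suc\<close> a cost arises only for d > a/20 or a < 36. In the first case
  d^2/(64 a) >= a/25600 and d^3/a^2 >= a/8000 both dominate the logarithm up to C/a; in the second
  the linear term itself is at most 1/a.\<close>

lemma edge_cost_Suc:
  assumes "M < q j" and C: "C \<ge> 0" "50000 * (1 + ln (real (digit (Suc j)))) \<le> 1/25600 * real (digit (Suc j)) + C / real (digit (Suc j))"
  shows "edge_cost (Suc j) (M + n * q j) \<le> (digit_dist j n)\<^sup>2 / (64 * real (digit (Suc j))) + (C + 1) / real (digit (Suc j))"
    and "edge_cost (Suc j) (M + n * q j) \<le> (digit_dist j n)^3 / (real (digit (Suc j)))\<^sup>2 + (C + 1) / real (digit (Suc j))"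
proof -
  define a where "a = real (digit (Suc j))"
  define d where "d = digit_dist j n"
  have a: "a \<ge> 1" using digit_ge_1[of j] by (simp add: a_def)
  have d: "d \<ge> 0" unfolding d_def by (rule digit_dist_nonneg)
  have k: "(C + 1) / a = C / a + 1 / a" by (rule add_divide_distrib)
  have nn: "d\<^sup>2 / (64 * a) \<ge> 0" "d^3 / a\<^sup>2 \<ge> 0" "C / a \<ge> 0" "1 / a \<ge> 0" using a d C by auto
  have "edge_cost (Suc j) (M + n * q j) \<le> d\<^sup>2 / (64 * a) + (C + 1) / a \<and> edge_cost (Suc j) (M + n * q j) \<le> d^3 / a\<^sup>2 + (C + 1) / a"
  proof (cases "bulk (Suc j) (M + n * q j)")
    case True
    thus ?thesis using nn k by (simp add: edge_cost_def)
  next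
    case False
    have l: "50000 + 50000 * ln a \<le> 1/25600 * a + C / a" using C(2) unfolding a_def distrib_left mult_1_right .
    have x: "edge_cost (Suc j) (M + n * q j) = 50000 * ln a" using False a by (simp add: edge_cost_def a_def)
    show ?thesis
    proof (cases "d > a / 20")
      case True
      have "(a / 20)\<^sup>2 \<le> d\<^sup>2" using True a by (intro power_mono) auto
      hence "(a / 20)\<^sup>2 / (64 * a) \<le> d\<^sup>2 / (64 * a)" using a by (intro divide_right_mono) auto
      moreover have "(a / 20)\<^sup>2 / (64 * a) = 1/25600 * a" using a by (simp add: power2_eq_square)
      moreover have "(a / 20)^3 \<le> d^3" using True a by (intro power_mono) auto
      hence "(a / 20)^3 / a\<^sup>2 \<le> d^3 / a\<^sup>2" using a by (intro divide_right_mono) auto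
      moreover have "(a / 20)^3 / a\<^sup>2 = a / 8000" using a by (simp add: power2_eq_square power3_eq_cube)
      ultimately show ?thesis using l x nn k a by linarith
    next
      case False': False
      have "digit (Suc j) < 36"
      proof (rule ccontr)
        assume "\<not> digit (Suc j) < 36"
        hence "bulk (Suc j) (M + n * q j)" using False' assms(1) by (intro bulk_Suc) (auto simp: d_def a_def)
        thus False using False by simp
      qed
      hence "a \<le> 36" by (simp add: a_def)
      hence "a * a \<le> 36 * 36" using a by (intro mult_mono) auto
      hence "1/25600 * a \<le> 1 / a" using a by (simp add: field_simps)
      thus ?thesis using l x nn k by linarith
    qed
  qed
  thus "edge_cost (Suc j) (M + n * q j) \<le> (digit_dist j n)\<^sup>2 / (64 * real (digit (Suc j))) + (C + 1) / real (digit (Suc j))"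
    and "edge_cost (Suc j) (M + n * q j) \<le> (digit_dist j n)^3 / (real (digit (Suc j)))\<^sup>2 + (C + 1) / real (digit (Suc j))"
    unfolding a_def d_def by auto
qed

text \<open>The two members are the hypotheses of \<open>laplace_upper\<close>: the coarse bound for
  the tail and the sharp one near the digit of N*.\<close>

definition level_bound :: "real \<Rightarrow> nat \<Rightarrow> nat \<Rightarrow> real" where
  "level_bound C j n = min (- ((digit_dist j n)\<^sup>2 / (128 * real (digit (Suc j)))) + C / real (digit (Suc j)))
     (- (pi * sqrt 3 / 2 * (digit_dist j n)\<^sup>2 / real (digit (Suc j))) + C * (digit_dist j n / real (digit (Suc j)) + (digit_dist j n)^3 / (real (digit (Suc j)))\<^sup>2 + 1 / real (digit (Suc j))))"

text \<open>The loss d^2/(32 a) is divided: 1/64 for the edge cost of the next level, 1/128 for the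
  linear error, and 1/128 remains. In the sharp bound the quadratic term must stay intact, so the
  edge cost is charged to the cubic error.\<close>

lemma level_upper:
  assumes "j < K" "M < q j" "n \<le> digit (Suc j)"
    and C0: "C0 \<ge> 0" "6000 * (1 + ln (real (digit (Suc j)))) \<le> 1/300 * real (digit (Suc j)) + C0 / real (digit (Suc j))"
    and C1: "C1 \<ge> 0" "50000 * (1 + ln (real (digit (Suc j)))) \<le> 1/25600 * real (digit (Suc j)) + C1 / real (digit (Suc j))"
    and W: "W \<ge> 0" "lin_coeff j \<le> W + e" "e \<ge> 0" and C: "C \<ge> C0 + C1 + 1200 + W + 32 * W\<^sup>2"
  shows "- digit_gain j K M n \<le> (e + level_bound C j n) + edge_cost j M - edge_cost (Suc j) (M + n * q j)"
proof -
  define a where "a = real (digit (Suc j))"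
  define d where "d = digit_dist j n"
  have a: "a \<ge> 1" using digit_ge_1[of j] by (simp add: a_def)
  have d: "d \<ge> 0" "d \<le> a" unfolding d_def a_def by (rule digit_dist_nonneg) (rule digit_dist_le[OF assms(3)])
  have da: "0 \<le> d / a" "d / a \<le> 1" using d a by auto
  have w: "lin_coeff j * d / a \<le> W * (d / a) + e"
  proof -
    have "lin_coeff j * (d / a) \<le> (W + e) * (d / a)" using W da by (intro mult_right_mono) auto
    also have "\<dots> = W * (d / a) + e * (d / a)" by (rule distrib_right)
    also have "e * (d / a) \<le> e * 1" using da W by (intro mult_left_mono) auto
    finally show ?thesis by simp
  qed
  \<comment> \<open>Completing the square; 64 is chosen to produce the share d^2/(128 a).\<close>
  have quad: "W * (d / a) \<le> d\<^sup>2 / (128 * a) + 32 * W\<^sup>2 / a"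
  proof -
    have "(d - 64 * W)\<^sup>2 \<ge> 0" by simp
    hence "128 * W * d \<le> d\<^sup>2 + 64 * 64 * W\<^sup>2" by (simp add: power2_eq_square algebra_simps)
    hence "128 * W * d / (128 * a) \<le> (d\<^sup>2 + 64 * 64 * W\<^sup>2) / (128 * a)" using a by (intro divide_right_mono) auto
    thus ?thesis using a by (simp add: add_divide_distrib)
  qed
  define s where "s = 1 / a"
  have s: "s \<ge> 0" using a by (simp add: s_def)
  have Cs: "(C0 + C1 + 1200 + W + 32 * W\<^sup>2) * s \<le> C * s" using C s by (intro mult_right_mono) auto
  have ex: "(C0 + C1 + 1200 + W + 32 * W\<^sup>2) * s = C0 * s + C1 * s + 1200 * s + W * s + (32 * W\<^sup>2) * s" by (simp add: distrib_right)
  have cs: "(C0 + 44) / a = C0 * s + 44 * s" "(C1 + 1) / a = C1 * s + s" "C / a = C * s" "32 * W\<^sup>2 / a = (32 * W\<^sup>2) * s"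
    by (simp_all add: s_def add_divide_distrib)
  have wn: "W * s \<ge> 0" "(32 * W\<^sup>2) * s \<ge> 0" using W s by auto
  have h: "d\<^sup>2 / (32 * a) = 4 * (d\<^sup>2 / (128 * a))" "d\<^sup>2 / (64 * a) = 2 * (d\<^sup>2 / (128 * a))" by simp_all
  note L1 = digit_gain_lower(1)[OF assms(1-3) C0, folded a_def d_def] edge_cost_Suc(1)[OF assms(2) C1, of n, folded a_def d_def]
  note L2 = digit_gain_lower(2)[OF assms(1-3) C0, folded a_def d_def] edge_cost_Suc(2)[OF assms(2) C1, of n, folded a_def d_def]
  have 1: "- digit_gain j K M n - e - edge_cost j M + edge_cost (Suc j) (M + n * q j) \<le> - (d\<^sup>2 / (128 * a)) + C / a"
    using L1 w quad Cs wn s unfolding cs h ex by linarith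
  have d3: "d^3 / a\<^sup>2 \<ge> 0" using d by simp
  have C1200: "C \<ge> 1200 + W" using C C0(1) C1(1) W zero_le_power2[of W] by linarith
  have "(1200 + W) * (d / a) \<le> C * (d / a)" "1200 * (d^3 / a\<^sup>2) \<le> C * (d^3 / a\<^sup>2)"
    using C1200 W da d3 by (intro mult_right_mono; simp)+
  moreover have "(1200 + W) * (d / a) = 1200 * (d / a) + W * (d / a)" by (rule distrib_right)
  moreover have "1152 * d^3 / a\<^sup>2 = 1152 * (d^3 / a\<^sup>2)" by simp
  ultimately have 2: "- digit_gain j K M n - e - edge_cost j M + edge_cost (Suc j) (M + n * q j) \<le> - (pi * sqrt 3 / 2 * d\<^sup>2 / a) + C * (d / a + d^3 / a\<^sup>2 + 1 / a)"
    using L2 w Cs wn s da d3 unfolding distrib_left cs ex s_def[symmetric] by linarith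
  show ?thesis using 1 2 unfolding level_bound_def a_def d_def by linarith
qed

lemma star_tail_less: "star_tail 0 K < q K"
proof (induction K)
  case (Suc K)
  have "Suc (star_digit K) * q K \<le> digit (Suc K) * q K" using star_digit_less[of K] by (intro mult_le_mono1) auto
  moreover have "star_tail 0 (Suc K) = star_tail 0 K + star_digit K * q K" by (simp add: star_tail_def)
  ultimately show ?case using Suc by (simp add: q_Suc)
qed (simp add: star_tail_def)

lemma Nstar_star_tail: "Nstar \<alpha> K = star_tail 0 K"
proof -
  have "\<lfloor>(5/6::real) * of_int (cf_digit \<alpha> (k+1))\<rfloor> * cf_den \<alpha> k = int (star_digit k * q k)" for k
  proof -
    have "(5/6::real) * of_int (cf_digit \<alpha> (k+1)) = 5/6 * real (digit (Suc k))" using real_digit[of k] by simp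
    moreover have "(0::int) \<le> \<lfloor>5/6 * real (digit (Suc k))\<rfloor>" by simp
    ultimately show ?thesis by (simp add: star_digit_def int_q)
  qed
  hence "(\<Sum>k<K. \<lfloor>(5/6::real) * of_int (cf_digit \<alpha> (k+1))\<rfloor> * cf_den \<alpha> k) = int (star_tail 0 K)"
    by (simp add: star_tail_def lessThan_atLeast0)
  thus ?thesis by (simp add: Nstar_def)
qed

lemma sinprod_powr: "sinprod N \<alpha> powr c = exp (c * ln_sinprod N)"
  using sinprod_pos[of N] by (simp add: powr_def ln_sinprod)

lemma sum_shift: "(\<Sum>i<K. f (Suc i)) = (\<Sum>k=1..K. f k)" for f :: "nat \<Rightarrow> real"
  by (rule sum.reindex_bij_witness[of _ "\<lambda>k. k - 1" Suc]) auto

context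
  fixes T C0 C1 :: real and k0 :: nat
  assumes T: "T \<ge> 1" and k0: "\<And>k. k \<ge> k0 \<Longrightarrow> ln (real (digit k)) \<le> T * real (digit (Suc k))"
    and C0: "C0 \<ge> 0" "\<And>A. A \<ge> 1 \<Longrightarrow> 6000 * (1 + ln (real A)) \<le> 1/300 * real A + C0 / real A"
    and C1: "C1 \<ge> 0" "\<And>A. A \<ge> 1 \<Longrightarrow> 50000 * (1 + ln (real A)) \<le> 1/25600 * real A + C1 / real A"
begin

abbreviation slope :: real where "slope \<equiv> level_slope T"
abbreviation K0 :: real where "K0 \<equiv> level_const T C0 C1"
text \<open>What a level adds to the linear coefficient when \<tau> j exceeds 9 T. This happens at
  finitely many levels only, so the total is a constant depending on \<alpha>.\<close>

definition excess :: "nat \<Rightarrow> real" where "excess j = max 0 (lin_coeff j - slope)"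

lemma slope_pos: "slope \<ge> 3000" using T by (simp add: level_slope_def)
lemma excess: "excess j \<ge> 0" "lin_coeff j \<le> slope + excess j" by (auto simp: excess_def)
lemma K0_ge: "K0 \<ge> 3000 + slope"
proof -
  have "slope * 1 \<le> slope * slope" using slope_pos by (intro mult_left_mono) auto
  hence "slope \<le> slope\<^sup>2" by (simp add: power2_eq_square)
  thus ?thesis using C0(1) C1(1) slope_pos unfolding level_const_def by linarith
qed

lemma excess_sum: "\<exists>D\<ge>0. \<forall>K. (\<Sum>j<K. excess j) \<le> D"
proof -
  obtain k1 where k1: "\<And>j. j \<ge> k1 \<Longrightarrow> \<tau> j \<le> 9 * T" using \<tau>_bound[OF T k0] by blast
  have z: "excess j = 0" if "j \<ge> k1" for j using k1[OF that] by (simp add: excess_def lin_coeff_def level_slope_def)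
  have "(\<Sum>j<K. excess j) \<le> (\<Sum>j<k1. excess j)" for K
  proof -
    have "(\<Sum>j<K. excess j) \<le> (\<Sum>j<max K k1. excess j)" using excess by (intro sum_mono2) auto
    also have "\<dots> = (\<Sum>j<k1. excess j)" using z by (intro sum.mono_neutral_right) auto
    finally show ?thesis .
  qed
  moreover have "(\<Sum>j<k1. excess j) \<ge> 0" using excess by (intro sum_nonneg) auto
  ultimately show ?thesis by blast
qed

lemma ln_sinprod_le: "N < q K \<Longrightarrow> ln_sinprod N \<le> ln_sinprod (star_tail 0 K) + digitwise (\<lambda>j n. excess j + level_bound K0 j n) K N"
proof -
  assume N: "N < q K"
  have "ln_sinprod (N + star_tail K K) - ln_sinprod (star_tail 0 K) \<le> digitwise (\<lambda>j n. excess j + level_bound K0 j n) K N - edge_cost K N"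
  proof (rule ln_sinprod_upper[OF _ order_refl N])
    fix j M n assume a: "j < K" "M < q j" "n \<le> digit (Suc j)"
    have A: "digit (Suc j) \<ge> 1" by (rule digit_ge_1)
    show "- digit_gain j K M n \<le> excess j + level_bound K0 j n + edge_cost j M - edge_cost (Suc j) (M + n * q j)"
      using level_upper[OF a C0(1) C0(2)[OF A] C1(1) C1(2)[OF A], of slope "excess j" K0] excess slope_pos level_const_def by simp
  qed
  moreover have "star_tail K K = 0" by (simp add: star_tail_def)
  moreover have "edge_cost K N \<ge> 0" by (simp add: edge_cost_def)
  ultimately show ?thesis by simp
qed

lemma level_bound_le: "level_bound K0 j n \<le> K0 / real (digit (Suc j))"
proof -
  have "(digit_dist j n)\<^sup>2 / (128 * real (digit (Suc j))) \<ge> 0" by simp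
  thus ?thesis unfolding level_bound_def by linarith
qed

lemma laplace_level: "c \<ge> 1/100 \<Longrightarrow> laplace (digit (Suc i)) (star_digit i) c"
  by unfold_locales (use digit_ge_1 star_digit_bounds in auto)

text \<open>After the factorisation each level is a factor exp (c * excess) times a one-digit sum,
  so division by c returns the excess without any dependence on c.\<close>

lemma moment_upper:
  assumes c: "c \<ge> 1/100"
  shows "1 / c * ln (\<Sum>N<q K. sinprod N \<alpha> powr c) \<le> ln_sinprod (star_tail 0 K) + (\<Sum>i<K. excess i)
     + (\<Sum>i<K. 1 / (2 * c) * ln (2 * real (digit (Suc i)) / (sqrt 3 * c))) + (32768 * K0 + 100) * (\<Sum>i<K. err (real (digit (Suc i))) c)"
proof -
  have cp: "c > 0" using c by simp
  define u where "u = (\<lambda>j n. excess j + level_bound K0 j n)"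
  define P where "P i = (\<Sum>n\<le>digit (Suc i). exp (c * u i n))" for i
  have P: "P i > 0" for i unfolding P_def by (intro sum_pos) auto
  have S0: "(\<Sum>N<q K. sinprod N \<alpha> powr c) > 0" unfolding sinprod_powr using q_ge_1[of K] by (intro sum_pos) (auto simp: lessThan_empty_iff)
  have "(\<Sum>N<q K. sinprod N \<alpha> powr c) \<le> (\<Sum>N<q K. exp (c * ln_sinprod (star_tail 0 K)) * exp (c * digitwise u K N))"
  proof (rule sum_mono)
    fix N assume "N \<in> {..<q K}"
    hence "c * ln_sinprod N \<le> c * (ln_sinprod (star_tail 0 K) + digitwise u K N)" using ln_sinprod_le[of N K] cp by (intro mult_left_mono) (auto simp: u_def)
    thus "sinprod N \<alpha> powr c \<le> exp (c * ln_sinprod (star_tail 0 K)) * exp (c * digitwise u K N)"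
      unfolding sinprod_powr by (simp add: distrib_left flip: exp_add)
  qed
  also have "\<dots> = exp (c * ln_sinprod (star_tail 0 K)) * (\<Sum>N<q K. exp (c * digitwise u K N))" by (rule sum_distrib_left[symmetric])
  also have "\<dots> \<le> exp (c * ln_sinprod (star_tail 0 K)) * (\<Prod>i<K. P i)" unfolding P_def by (intro mult_left_mono sum_digitwise_upper) auto
  finally have "ln (\<Sum>N<q K. sinprod N \<alpha> powr c) \<le> ln (exp (c * ln_sinprod (star_tail 0 K)) * (\<Prod>i<K. P i))"
    using S0 P by (subst ln_le_cancel_iff) (auto intro!: mult_pos_pos prod_pos)
  also have "\<dots> = c * ln_sinprod (star_tail 0 K) + ln (\<Prod>i<K. P i)"
    using P by (subst ln_mult_pos) (auto intro!: prod_pos)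
  also have "ln (\<Prod>i<K. P i) = (\<Sum>i<K. ln (P i))" by (intro ln_prod, simp, metis P less_irrefl)
  finally have "1 / c * ln (\<Sum>N<q K. sinprod N \<alpha> powr c) \<le> 1 / c * (c * ln_sinprod (star_tail 0 K) + (\<Sum>i<K. ln (P i)))"
    using cp by (intro mult_left_mono) auto
  also have "\<dots> = ln_sinprod (star_tail 0 K) + (\<Sum>i<K. 1 / c * ln (P i))" using cp by (simp add: distrib_left sum_distrib_left)
  also have "(\<Sum>i<K. 1 / c * ln (P i)) \<le> (\<Sum>i<K. excess i + (1 / (2 * c) * ln (2 * real (digit (Suc i)) / (sqrt 3 * c)) + (32768 * K0 + 100) * err (real (digit (Suc i))) c))"
  proof (rule sum_mono)
    fix i
    interpret l: laplace "digit (Suc i)" "star_digit i" c using c by (rule laplace_level)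
    have "P i = exp (c * excess i) * (\<Sum>n\<le>digit (Suc i). exp (c * level_bound K0 i n))"
      by (simp add: P_def u_def distrib_left exp_add sum_distrib_left)
    moreover have "(\<Sum>n\<le>digit (Suc i). exp (c * level_bound K0 i n)) > 0" by (intro sum_pos) auto
    ultimately have "ln (P i) = c * excess i + ln (\<Sum>n\<le>digit (Suc i). exp (c * level_bound K0 i n))" by (simp add: ln_mult_pos)
    hence "1 / c * ln (P i) = excess i + 1 / c * ln (\<Sum>n\<le>digit (Suc i). exp (c * level_bound K0 i n))" using cp by (simp add: add_divide_distrib)
    also have "1 / c * ln (\<Sum>n\<le>digit (Suc i). exp (c * level_bound K0 i n)) \<le> 1 / (2 * c) * ln (2 * real (digit (Suc i)) / (sqrt 3 * c)) + (32768 * K0 + 100) * err (real (digit (Suc i))) c"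
      using K0_ge slope_pos by (intro l.laplace_upper) (auto simp: level_bound_def digit_dist_def)
    finally show "1 / c * ln (P i) \<le> excess i + (1 / (2 * c) * ln (2 * real (digit (Suc i)) / (sqrt 3 * c)) + (32768 * K0 + 100) * err (real (digit (Suc i))) c)" by simp
  qed
  also have "\<dots> = (\<Sum>i<K. excess i) + ((\<Sum>i<K. 1 / (2 * c) * ln (2 * real (digit (Suc i)) / (sqrt 3 * c))) + (32768 * K0 + 100) * (\<Sum>i<K. err (real (digit (Suc i))) c))"
    by (simp only: sum.distrib sum_distrib_left[symmetric])
  finally show ?thesis by linarith
qed

lemma moment_lower:
  assumes c: "c \<ge> 1/100"
  shows "1 / c * ln (\<Sum>N<q K. sinprod N \<alpha> powr c) \<ge> ln_sinprod (star_tail 0 K) - (\<Sum>i<K. excess i)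
     + (\<Sum>i<K. 1 / (2 * c) * ln (2 * real (digit (Suc i)) / (sqrt 3 * c))) - (32768 * K0 + 20000000) * (\<Sum>i<K. err (real (digit (Suc i))) c)"
proof -
  have cp: "c > 0" using c by simp
  define v where "v = (\<lambda>j n. - (pi * sqrt 3 / 2 * (digit_dist j n)\<^sup>2 / real (digit (Suc j)) + 3000 * (digit_dist j n)^3 / (real (digit (Suc j)))\<^sup>2 + lin_coeff j * digit_dist j n / real (digit (Suc j))))"
  have "\<forall>i. \<exists>W. laplace.window (digit (Suc i)) (star_digit i) c W"
    by (intro allI laplace.ex_window laplace_level c)
  then obtain W where W: "\<And>i. laplace.window (digit (Suc i)) (star_digit i) c (W i)" by metis
  note W' = W[unfolded laplace.window_def[OF laplace_level[OF c]]]
  have WB: "star_digit i \<in> W i" and WA: "W i \<subseteq> {..<digit (Suc i)}" for i using W'[of i] by blast+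
  have Wd: "n = star_digit i \<or> (digit (Suc i) \<ge> 36 \<and> digit_dist i n \<le> real (digit (Suc i)) / 20)" if "n \<in> W i" for i n
    using W'[of i] that unfolding digit_dist_def by blast
  have WL: "1 / c * ln (\<Sum>n\<in>W i. exp (c * v n)) \<ge> 1 / (2 * c) * ln (2 * real (digit (Suc i)) / (sqrt 3 * c)) - (32768 * C + 20000000) * err (real (digit (Suc i))) c"
    if "C \<ge> 0" "\<And>n. n \<in> W i \<Longrightarrow> v n \<ge> - (pi * sqrt 3 / 2 * (digit_dist i n)\<^sup>2 / real (digit (Suc i))) - C * (digit_dist i n / real (digit (Suc i)) + (digit_dist i n)^3 / (real (digit (Suc i)))\<^sup>2)" for i C v
    using W'[of i] that unfolding digit_dist_def by blast
  have finW: "finite (W i)" for i using WA finite_subset by blast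
  define P where "P i = (\<Sum>n\<in>W i. exp (c * v i n))" for i
  have P: "P i > 0" for i unfolding P_def using WB finW by (intro sum_pos) auto
  define Gd where "Gd = {N. N < q K \<and> admissible (\<lambda>i n. n \<in> W i) K N}"
  have "exp (c * ln_sinprod (star_tail 0 K)) * (\<Prod>i<K. P i) = (\<Sum>N\<in>Gd. exp (c * ln_sinprod (star_tail 0 K)) * exp (c * digitwise v K N))"
    unfolding Gd_def P_def sum_digitwise_admissible[OF WA, symmetric] by (rule sum_distrib_left)
  also have "\<dots> \<le> (\<Sum>N\<in>Gd. sinprod N \<alpha> powr c)"
  proof (rule sum_mono)
    fix N assume "N \<in> Gd"
    hence "ln_sinprod (N + star_tail K K) - ln_sinprod (star_tail 0 K) \<ge> digitwise v K N"
      unfolding v_def Gd_def using ln_sinprod_lower[of "\<lambda>i n. n \<in> W i" K K N, OF Wd] by auto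
    hence "ln_sinprod (star_tail 0 K) + digitwise v K N \<le> ln_sinprod N" by (simp add: star_tail_def)
    hence "c * (ln_sinprod (star_tail 0 K) + digitwise v K N) \<le> c * ln_sinprod N" using cp by (intro mult_left_mono) auto
    thus "exp (c * ln_sinprod (star_tail 0 K)) * exp (c * digitwise v K N) \<le> sinprod N \<alpha> powr c"
      unfolding sinprod_powr by (simp add: distrib_left flip: exp_add)
  qed
  also have "\<dots> \<le> (\<Sum>N<q K. sinprod N \<alpha> powr c)" by (rule sum_mono2) (auto simp: Gd_def)
  finally have "ln (exp (c * ln_sinprod (star_tail 0 K)) * (\<Prod>i<K. P i)) \<le> ln (\<Sum>N<q K. sinprod N \<alpha> powr c)"
    using P by (intro ln_mono) (auto intro!: mult_pos_pos prod_pos)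
  moreover have "ln (exp (c * ln_sinprod (star_tail 0 K)) * (\<Prod>i<K. P i)) = c * ln_sinprod (star_tail 0 K) + (\<Sum>i<K. ln (P i))"
  proof -
    have "ln (exp (c * ln_sinprod (star_tail 0 K)) * (\<Prod>i<K. P i)) = c * ln_sinprod (star_tail 0 K) + ln (\<Prod>i<K. P i)"
      using P by (subst ln_mult_pos) (auto intro!: prod_pos)
    also have "ln (\<Prod>i<K. P i) = (\<Sum>i<K. ln (P i))" by (intro ln_prod, simp, metis P less_irrefl)
    finally show ?thesis .
  qed
  ultimately have "1 / c * (c * ln_sinprod (star_tail 0 K) + (\<Sum>i<K. ln (P i))) \<le> 1 / c * ln (\<Sum>N<q K. sinprod N \<alpha> powr c)"
    using cp by (intro mult_left_mono) auto
  moreover have "1 / c * (c * ln_sinprod (star_tail 0 K) + (\<Sum>i<K. ln (P i))) = ln_sinprod (star_tail 0 K) + (\<Sum>i<K. 1 / c * ln (P i))" using cp by (simp add: distrib_left sum_distrib_left)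
  moreover have "(\<Sum>i<K. 1 / c * ln (P i)) \<ge> (\<Sum>i<K. - excess i + (1 / (2 * c) * ln (2 * real (digit (Suc i)) / (sqrt 3 * c)) - (32768 * K0 + 20000000) * err (real (digit (Suc i))) c))"
  proof (rule sum_mono)
    fix i
    \<comment> \<open>With d/a <= 1, adding the excess to the exponent compensates the part of
      \<open>lin_coeff\<close> above \<open>slope\<close>; the window property then applies with C =
      K0.\<close>
    define Q where "Q = (\<Sum>n\<in>W i. exp (c * (excess i + v i n)))"
    have "Q = exp (c * excess i) * P i" by (simp add: Q_def P_def distrib_left exp_add sum_distrib_left)
    hence "ln Q = c * excess i + ln (P i)" using P by (simp add: ln_mult_pos)
    hence "1 / c * ln (P i) = - excess i + 1 / c * ln Q" using cp by (simp add: add_divide_distrib)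
    moreover have "1 / c * ln Q \<ge> 1 / (2 * c) * ln (2 * real (digit (Suc i)) / (sqrt 3 * c)) - (32768 * K0 + 20000000) * err (real (digit (Suc i))) c"
      unfolding Q_def
    proof (rule WL)
      show "K0 \<ge> 0" using K0_ge slope_pos by linarith
      fix n assume "n \<in> W i"
      hence n: "n \<le> digit (Suc i)" using WA[of i] by auto
      define a d where "a = real (digit (Suc i))" and "d = digit_dist i n"
      have a: "a \<ge> 1" using digit_ge_1[of i] by (simp add: a_def)
      have d: "0 \<le> d" "d \<le> a" unfolding d_def a_def by (rule digit_dist_nonneg) (rule digit_dist_le[OF n])
      have da: "0 \<le> d / a" "d / a \<le> 1" "d^3 / a\<^sup>2 \<ge> 0" using d a by auto
      have "lin_coeff i * (d / a) \<le> (slope + excess i) * (d / a)" using excess da by (intro mult_right_mono) auto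
      also have "\<dots> = slope * (d / a) + excess i * (d / a)" by (rule distrib_right)
      also have "excess i * (d / a) \<le> excess i * 1" using da excess by (intro mult_left_mono) auto
      finally have "lin_coeff i * d / a \<le> slope * (d / a) + excess i" by simp
      moreover have "slope * (d / a) \<le> K0 * (d / a)" "3000 * (d^3 / a\<^sup>2) \<le> K0 * (d^3 / a\<^sup>2)"
        using K0_ge slope_pos da by (intro mult_right_mono; simp)+
      moreover have "3000 * d^3 / a\<^sup>2 = 3000 * (d^3 / a\<^sup>2)" by simp
      ultimately show "excess i + v i n \<ge> - (pi * sqrt 3 / 2 * (digit_dist i n)\<^sup>2 / real (digit (Suc i))) - K0 * (digit_dist i n / real (digit (Suc i)) + (digit_dist i n)^3 / (real (digit (Suc i)))\<^sup>2)"
        unfolding v_def a_def[symmetric] d_def[symmetric] distrib_left by linarith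
    qed
    ultimately show "- excess i + (1 / (2 * c) * ln (2 * real (digit (Suc i)) / (sqrt 3 * c)) - (32768 * K0 + 20000000) * err (real (digit (Suc i))) c) \<le> 1 / c * ln (P i)" by linarith
  qed
  moreover have "(\<Sum>i<K. - excess i + (1 / (2 * c) * ln (2 * real (digit (Suc i)) / (sqrt 3 * c)) - (32768 * K0 + 20000000) * err (real (digit (Suc i))) c))
    = - (\<Sum>i<K. excess i) + ((\<Sum>i<K. 1 / (2 * c) * ln (2 * real (digit (Suc i)) / (sqrt 3 * c))) - (32768 * K0 + 20000000) * (\<Sum>i<K. err (real (digit (Suc i))) c))"
    by (simp only: sum.distrib sum_subtractf sum_negf sum_distrib_left[symmetric])
  ultimately show ?thesis by linarith
qed

text \<open>N* is itself a competitor, which gives the lower bound. For the upper bound the coarse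
  estimate without its negative square leaves K0/a per level.\<close>

lemma max_bounds:
  "ln_sinprod (star_tail 0 K) \<le> ln (Max {sinprod N \<alpha> | N. N < q K})"
  "ln (Max {sinprod N \<alpha> | N. N < q K}) \<le> ln_sinprod (star_tail 0 K) + (\<Sum>i<K. excess i) + K0 * (\<Sum>i<K. 1 / real (digit (Suc i)))"
proof -
  define S where "S = {sinprod N \<alpha> | N. N < q K}"
  have "S = (\<lambda>N. sinprod N \<alpha>) ` {..<q K}" by (auto simp: S_def)
  hence fin: "finite S" by simp
  have mem: "sinprod (star_tail 0 K) \<alpha> \<in> S" using star_tail_less by (auto simp: S_def)
  have "sinprod (star_tail 0 K) \<alpha> \<le> Max S" using fin mem by (rule Max_ge)
  thus "ln_sinprod (star_tail 0 K) \<le> ln (Max {sinprod N \<alpha> | N. N < q K})"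
    unfolding S_def[symmetric] ln_sinprod[symmetric] using sinprod_pos by (intro ln_mono) auto
  have "Max S \<in> S" using fin mem by (intro Max_in) auto
  then obtain N where N: "N < q K" "Max S = sinprod N \<alpha>" by (auto simp: S_def)
  have "digitwise (\<lambda>j n. excess j + level_bound K0 j n) K N \<le> (\<Sum>i<K. excess i + K0 * (1 / real (digit (Suc i))))"
    using level_bound_le by (intro digitwise_mono N) auto
  hence "ln_sinprod N \<le> ln_sinprod (star_tail 0 K) + (\<Sum>i<K. excess i + K0 * (1 / real (digit (Suc i))))" using ln_sinprod_le[OF N(1)] by linarith
  also have "(\<Sum>i<K. excess i + K0 * (1 / real (digit (Suc i)))) = (\<Sum>i<K. excess i) + K0 * (\<Sum>i<K. 1 / real (digit (Suc i)))"
    by (simp only: sum.distrib sum_distrib_left)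
  finally show "ln (Max {sinprod N \<alpha> | N. N < q K}) \<le> ln_sinprod (star_tail 0 K) + (\<Sum>i<K. excess i) + K0 * (\<Sum>i<K. 1 / real (digit (Suc i)))"
    unfolding S_def[symmetric] N(2) ln_sinprod by linarith
qed

lemma final_bounds:
  "\<exists>D. \<forall>K c. c \<ge> 0.01 \<longrightarrow>
     \<bar>(1/c) * ln (\<Sum>N<nat (cf_den \<alpha> K). sinprod N \<alpha> powr c) - ln (sinprod (Nstar \<alpha> K) \<alpha>)
        - (1/(2*c)) * (\<Sum>k=1..K. ln (2 * real_of_int (cf_digit \<alpha> k) / (sqrt 3 * c)))\<bar>
       \<le> (32768 * K0 + 20000000) * (\<Sum>k=1..K. err (real_of_int (cf_digit \<alpha> k)) c) + D
   \<and> \<bar>ln (Max {sinprod N \<alpha> | N. N < nat (cf_den \<alpha> K)}) - ln (sinprod (Nstar \<alpha> K) \<alpha>)\<bar>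
       \<le> (32768 * K0 + 20000000) * (\<Sum>k=1..K. 1 / real_of_int (cf_digit \<alpha> k)) + D"
proof -
  obtain D where D: "\<And>K. (\<Sum>j<K. excess j) \<le> D" using excess_sum by blast
  have CC0: "K0 \<ge> 0" using K0_ge slope_pos by linarith
  show ?thesis
  proof (intro exI[of _ D] allI impI conjI)
    fix K :: nat and c :: real assume "c \<ge> 0.01"
    hence c: "c \<ge> 1/100" by simp
    define Er where "Er = (\<Sum>i<K. err (real (digit (Suc i))) c)"
    have Er0: "Er \<ge> 0" unfolding Er_def
    proof (intro sum_nonneg)
      fix i
      interpret l: laplace "digit (Suc i)" "star_digit i" c using c by (rule laplace_level)
      show "0 \<le> err (real (digit (Suc i))) c" using l.err_pos by (simp add: err_def)
    qed
    have qK: "nat (cf_den \<alpha> K) = q K" by (simp add: q_def)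
    have dgk: "(\<Sum>k=1..K. f (real_of_int (cf_digit \<alpha> k))) = (\<Sum>i<K. f (real (digit (Suc i))))" for f :: "real \<Rightarrow> real"
      by (subst sum_shift[symmetric]) (simp add: real_digit)
    have mL: "(1/(2*c)) * (\<Sum>k=1..K. ln (2 * real_of_int (cf_digit \<alpha> k) / (sqrt 3 * c))) = (\<Sum>i<K. 1 / (2 * c) * ln (2 * real (digit (Suc i)) / (sqrt 3 * c)))"
      by (simp only: dgk[of "\<lambda>y. ln (2 * y / (sqrt 3 * c))"] sum_distrib_left)
    have "(32768 * K0 + 100) * Er \<le> (32768 * K0 + 20000000) * Er" using Er0 by (intro mult_right_mono) auto
    thus "\<bar>(1/c) * ln (\<Sum>N<nat (cf_den \<alpha> K). sinprod N \<alpha> powr c) - ln (sinprod (Nstar \<alpha> K) \<alpha>)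
        - (1/(2*c)) * (\<Sum>k=1..K. ln (2 * real_of_int (cf_digit \<alpha> k) / (sqrt 3 * c)))\<bar>
       \<le> (32768 * K0 + 20000000) * (\<Sum>k=1..K. err (real_of_int (cf_digit \<alpha> k)) c) + D"
      unfolding mL qK Nstar_star_tail ln_sinprod dgk[of "\<lambda>y. err y c"] Er_def[symmetric] abs_le_iff
      using moment_upper[OF c, of K] moment_lower[OF c, of K] D[of K] unfolding Er_def[symmetric] by linarith
    define I where "I = (\<Sum>i<K. 1 / real (digit (Suc i)))"
    have I0: "I \<ge> 0" unfolding I_def by (intro sum_nonneg) auto
    have "K0 * I \<le> (32768 * K0 + 20000000) * I" using I0 CC0 by (intro mult_right_mono) auto
    moreover have "(32768 * K0 + 20000000) * I \<ge> 0" using I0 CC0 by simp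
    moreover have "D \<ge> 0" using D[of 0] by simp
    ultimately show "\<bar>ln (Max {sinprod N \<alpha> | N. N < nat (cf_den \<alpha> K)}) - ln (sinprod (Nstar \<alpha> K) \<alpha>)\<bar>
       \<le> (32768 * K0 + 20000000) * (\<Sum>k=1..K. 1 / real_of_int (cf_digit \<alpha> k)) + D"
      unfolding qK Nstar_star_tail ln_sinprod dgk[of "\<lambda>y. 1 / y"] I_def[symmetric] abs_le_iff
      using max_bounds[of K] D[of K] unfolding I_def[symmetric] by linarith
  qed
qed

end
end

theorem theorem2:
  "\<forall>T::real. T \<ge> 1 \<longrightarrow> (\<exists>C::real. \<forall>(\<alpha>::real) (k0::nat).
     (\<alpha> \<notin> \<rat> \<and> k0 \<ge> 1 \<and>
      (\<forall>k\<ge>k0. ln (real_of_int (cf_digit \<alpha> k)) / real_of_int (cf_digit \<alpha> (k+1)) \<le> T))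
     \<longrightarrow> (\<exists>D::real. \<forall>(K::nat) (c::real). c \<ge> 0.01 \<longrightarrow>
        \<bar>(1/c) * ln (\<Sum>N<nat (cf_den \<alpha> K). sinprod N \<alpha> powr c)
          - ln (sinprod (Nstar \<alpha> K) \<alpha>)
          - (1/(2*c)) * (\<Sum>k=1..K. ln (2 * real_of_int (cf_digit \<alpha> k) / (sqrt 3 * c)))\<bar>
        \<le> C * (\<Sum>k=1..K.
                 sqrt (ln (real_of_int (cf_digit \<alpha> k) / c + 2))
                   / (sqrt c * sqrt (real_of_int (cf_digit \<alpha> k)))
               + ln (real_of_int (cf_digit \<alpha> k) / c + 2) powr (3/2)
                   / (c powr (3/2) * sqrt (real_of_int (cf_digit \<alpha> k)))
               + 1 / real_of_int (cf_digit \<alpha> k)) + D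
      \<and> \<bar>ln (Max {sinprod N \<alpha> | N. N < nat (cf_den \<alpha> K)})
          - ln (sinprod (Nstar \<alpha> K) \<alpha>)\<bar>
        \<le> C * (\<Sum>k=1..K. 1 / real_of_int (cf_digit \<alpha> k)) + D))"
proof (intro allI impI, goal_cases)
  case T: (1 T)
  \<comment> \<open>C0 and C1 are absolute, so the constant C is fixed by T before \<alpha> and k0
    appear.\<close>
  obtain C0 where C0: "C0 \<ge> 0" "\<And>A. A \<ge> 1 \<Longrightarrow> 6000 * (1 + ln (real A)) \<le> 1/300 * real A + C0 / real A"
    using ln_le_linear_plus_inverse[of "1/300" 6000] by auto
  obtain C1 where C1: "C1 \<ge> 0" "\<And>A. A \<ge> 1 \<Longrightarrow> 50000 * (1 + ln (real A)) \<le> 1/25600 * real A + C1 / real A"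
    using ln_le_linear_plus_inverse[of "1/25600" 50000] by auto
  define C where "C = 32768 * level_const T C0 C1 + 20000000"
  show ?case
  proof (rule exI[of _ C], intro allI impI, goal_cases)
    case a: (1 \<alpha> k0)
    interpret irrational \<alpha> by unfold_locales (use a in blast)
    have k0: "ln (real (digit k)) \<le> T * real (digit (Suc k))" if kk: "k \<ge> k0" for k
    proof -
      \<comment> \<open>k0 >= 1 excludes k = 0: the integer part of \<alpha> may be negative, and
        \<open>digit 0\<close> then differs from \<open>cf_digit \<alpha> 0\<close>.\<close>
      obtain m where m: "k = Suc m" using kk a by (cases k) auto
      have "ln (real (digit k)) / real (digit (Suc k)) \<le> T" using a kk m real_digit[of m] real_digit[of k] by simp
      thus ?thesis using digit_ge_1[of k] by (simp add: divide_le_eq)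
    qed
    show ?case
      by (rule final_bounds[of T k0 C0 C1, folded C_def, unfolded err_def err1_def err2_def])
        (rule T, erule k0, rule C0(1), erule C0(2), rule C1(1), erule C1(2))
  qed
qed

end
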